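(* Let $X\subset\mathbb{P}^3$ be a smooth surface of degree $d$, let $E\subset X$ be an integral curve, and let $S\subset E$ be a finite set of closed points (with its reduced structure). If $(E,X)$ is first order $S$-free, then for any curve $C\subset X$ such that $C.E\subset S$, $(C\cup E,X)$ is a simple extension of $(C,X)$. In particular, if there exists a curve $C\subset X$ such that $(C\cup E,X)$ is not a simple extension of $(C,X)$, then $(E,X)$ is not first order $S$-free for any finite set $S\subset E$ of closed points containing $C.E$.
   Context: The base field is $\mathbb{C}$. A curve is a closed subscheme of $\mathbb{P}^3$ of pure dimension $1$ (not necessarily reduced). For curves $C,E$ on a smooth surface $X$, $C.E$ denotes the scheme-theoretic intersection, the inclusion $C.E\subset S$ is an inclusion of subschemes, and $C\cup E$ denotes the divisor $C+E$ on $X$. For a closed subscheme $Y\subset\mathbb{P}^3$, $\mathcal{N}_{Y|\mathbb{P}^3}=\mathcal{H}om_{\mathbb{P}^3}(\mathcal{I}_Y,\mathcal{O}_Y)$. For a curve $E$ on a smooth surface $X\subset \mathbb{P}^3$ there is the exact sequence of normal sheaves $0\to\mathcal{N}_{E|X}\to\mathcal{N}_{E|\mathbb{P}^3}\to\mathcal{N}_{X|\mathbb{P}^3}\otimes\mathcal{O}_E\to0$. First order $S$-free: let $S\subset E$ be a finite set of reduced closed points and, for $p\in S$, put $S_p:=S\setminus\{p\}$. Let $r^c_p:H^0(\mathcal{N}_{E|\mathbb{P}^3})\to H^0(\mathcal{N}_{E|\mathbb{P}^3}\otimes\mathcal{O}_{S_p})$ be the restriction and let $r_p:H^0(\mathcal{N}_{E|\mathbb{P}^3})\to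 H^0(\mathcal{N}_{E|\mathbb{P}^3}\otimes\mathcal{O}_p)\to H^0(\mathcal{N}_{X|\mathbb{P}^3}\otimes\mathcal{O}_p)$ be restriction followed by the map induced by the normal sequence above. $(E,X)$ is first order $S$-free if for each $p\in S$ there exists $\xi_p\in H^0(\mathcal{N}_{E|\mathbb{P}^3})$ with $r^c_p(\xi_p)=0$ and $r_p(\xi_p)\ne0$. For effective divisors $C\le D$ on $X$, $\Upsilon^5_{C\le D}:H^0(\mathcal{N}_{D|\mathbb{P}^3})\to H^0(\mathcal{N}_{D|\mathbb{P}^3}\otimes\mathcal{O}_C)$ is the restriction map, and $\Upsilon^6_{C\le D}:H^0(\mathcal{N}_{C|\mathbb{P}^3})\to H^0(\mathcal{N}_{D|\mathbb{P}^3}\otimes\mathcal{O}_C)$ is obtained by applying $\mathcal{H}om_{\mathbb{P}^3}(-,\mathcal{O}_C)$ and global sections to $\mathcal{I}_D\hookrightarrow\mathcal{I}_C$. $(D,X)$ is a simple extension of $(C,X)$ if (1) $D-C=nC'$ for some positive integer $n$ and reduced curve $C'\subset X$ such that $C'\cap C_{\mathrm{red}}$ consists of finitely many points; and (2) $\mathrm{Im}\,\Upsilon^6_{C\le D}\subset\mathrm{Im}\,\Upsilon^5_{C\le D}$. *)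

theory Defs
  imports
    "HOL.Complex"
    "HOL-Library.Poly_Mapping"
    "HOL-Library.Numeral_Type"
    "HOL-Library.Extended_Nat"
    "HOL-Library.FuncSet"
    "HOL-Computational_Algebra.Fraction_Field"
    "HOL-Algebra.Ideal_Product"
    "HOL-Algebra.QuotRing"
    "HOL-Algebra.Module"
begin

text \<open>
  Projective 3-space is \<open>Proj \<complex>[x\<^sub>0,x\<^sub>1,x\<^sub>2,x\<^sub>3]\<close>. Since it is an integral scheme, its structure
  sheaf is handled through its stalks inside the field of fractions of \<open>\<complex>[x\<^sub>0,x\<^sub>1,x\<^sub>2,x\<^sub>3]\<close>; the
  sections over a nonempty open set are the elements lying in all stalks there.
\<close>

section \<open>Projective space\<close>

type_synonym cpoly = "(4 \<Rightarrow>\<^sub>0 nat) \<Rightarrow>\<^sub>0 complex"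
type_synonym ratfun = "cpoly fract"
type_synonym point = "cpoly set"

definition ring_on :: "'a::comm_ring_1 set \<Rightarrow> 'a ring" where
  "ring_on A = \<lparr>carrier = A, monoid.mult = (*), one = 1, ring.zero = 0, add = (+)\<rparr>"

abbreviation cpoly_ring :: "cpoly ring" where
  "cpoly_ring \<equiv> ring_on UNIV"

definition coord :: "4 \<Rightarrow> cpoly" where
  "coord i = Poly_Mapping.single (Poly_Mapping.single i 1) 1"

text \<open>The zero polynomial is homogeneous of every degree.\<close>

definition homog :: "nat \<Rightarrow> cpoly \<Rightarrow> bool" where
  "homog d F \<longleftrightarrow> (\<forall>m\<in>Poly_Mapping.keys F. (\<Sum>i\<in>UNIV. Poly_Mapping.lookup m i) = d)"

definition pdiff :: "4 \<Rightarrow> cpoly \<Rightarrow> cpoly" where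
  "pdiff i F = (\<Sum>m\<in>Poly_Mapping.keys F.
     Poly_Mapping.single (m - Poly_Mapping.single i 1)
       (of_nat (Poly_Mapping.lookup m i) * Poly_Mapping.lookup F m))"

definition homog_ideal :: "cpoly set \<Rightarrow> bool" where
  "homog_ideal I \<longleftrightarrow> I = Idl\<^bsub>cpoly_ring\<^esub> {F \<in> I. \<exists>d. homog d F}"

text \<open>The homogeneous primes that do not contain the irrelevant ideal.\<close>

definition P3 :: "point set" where
  "P3 = {p. primeideal p cpoly_ring \<and> homog_ideal p \<and> \<not> range coord \<subseteq> p}"

definition zclosed :: "point set \<Rightarrow> bool" where
  "zclosed Z \<longleftrightarrow> (\<exists>A. (\<forall>F\<in>A. \<exists>d. homog d F) \<and> Z = {p \<in> P3. A \<subseteq> p})"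

definition zopen :: "point set \<Rightarrow> bool" where
  "zopen U \<longleftrightarrow> U \<subseteq> P3 \<and> zclosed (P3 - U)"

definition closed_point :: "point \<Rightarrow> bool" where
  "closed_point p \<longleftrightarrow> p \<in> P3 \<and> zclosed {p}"

text \<open>
  Dimension of the closure \<open>{x \<in> P3. q \<subseteq> x}\<close> of the point \<open>q\<close>, as the supremum of the lengths of
  chains of irreducible closed subsets, that is, of chains of points of the closure.
\<close>

definition closure_dim :: "point \<Rightarrow> enat" where
  "closure_dim q = (SUP n \<in> {n. \<exists>f :: nat \<Rightarrow> point.
      (\<forall>i\<le>n. f i \<in> P3 \<and> q \<subseteq> f i) \<and> (\<forall>i<n. f i \<subset> f (Suc i))}. enat n)"

definition local_set :: "point \<Rightarrow> ratfun set" where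
  "local_set q = {Fract a b | a b d. homog d a \<and> homog d b \<and> b \<notin> q}"

definition local_max :: "point \<Rightarrow> ratfun set" where
  "local_max q = {Fract a b | a b d. homog d a \<and> homog d b \<and> b \<notin> q \<and> a \<in> q}"

definition stalk :: "point \<Rightarrow> ratfun ring" where
  "stalk q = ring_on (local_set q)"

definition reg_sections :: "point set \<Rightarrow> ratfun set" where
  "reg_sections U = {f. \<forall>q\<in>U. f \<in> local_set q}"


section \<open>Closed subschemes\<close>

text \<open>
  A closed subscheme \<open>Y\<close> is represented by its coherent ideal sheaf, given by the family of stalks
  \<open>Y q\<close> of \<open>\<I>\<^sub>Y\<close>. Local finite generation makes such a family a (coherent) subsheaf of \<open>\<O>\<close>:
  \<open>\<I>\<^sub>Y(U)\<close> consists of the \<open>f \<in> \<O>(U)\<close> with \<open>f \<in> Y q\<close> for all \<open>q \<in> U\<close>. Only the values at points of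
  \<open>P3\<close> matter. The stalk of \<open>\<O>\<^sub>Y\<close> at \<open>q\<close> is \<open>stalk q Quot Y q\<close>.
\<close>

type_synonym scheme = "point \<Rightarrow> ratfun set"

definition closed_subscheme :: "scheme \<Rightarrow> bool" where
  "closed_subscheme Y \<longleftrightarrow>
     (\<forall>q\<in>P3. ideal (Y q) (stalk q)) \<and>
     (\<forall>q\<in>P3. \<exists>U A. zopen U \<and> q \<in> U \<and> finite A \<and> A \<subseteq> reg_sections U \<and>
        (\<forall>x\<in>U. Y x = Idl\<^bsub>stalk x\<^esub> A))"

definition scheme_eq :: "scheme \<Rightarrow> scheme \<Rightarrow> bool" where
  "scheme_eq Y Z \<longleftrightarrow> (\<forall>q\<in>P3. Y q = Z q)"

definition subscheme :: "scheme \<Rightarrow> scheme \<Rightarrow> bool" where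
  "subscheme Y Z \<longleftrightarrow> (\<forall>q\<in>P3. Z q \<subseteq> Y q)"

definition supp :: "scheme \<Rightarrow> point set" where
  "supp Y = {q \<in> P3. Y q \<noteq> local_set q}"

definition scheme_inter :: "scheme \<Rightarrow> scheme \<Rightarrow> scheme" where
  "scheme_inter Y Z = (\<lambda>q. Y q <+>\<^bsub>stalk q\<^esub> Z q)"

text \<open>A set of closed points with its reduced structure; used for finite sets only.\<close>

definition reduced_points :: "point set \<Rightarrow> scheme" where
  "reduced_points S = (\<lambda>q. if q \<in> S then local_max q else local_set q)"

definition reduced_scheme :: "scheme \<Rightarrow> bool" where
  "reduced_scheme Y \<longleftrightarrow>
     (\<forall>q\<in>P3. \<forall>f\<in>local_set q. \<forall>n::nat. f ^ n \<in> Y q \<longrightarrow> f \<in> Y q)"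

definition irreducible_scheme :: "scheme \<Rightarrow> bool" where
  "irreducible_scheme Y \<longleftrightarrow> supp Y \<noteq> {} \<and>
     (\<forall>A B. zclosed A \<and> zclosed B \<and> supp Y \<subseteq> A \<union> B \<longrightarrow> supp Y \<subseteq> A \<or> supp Y \<subseteq> B)"

definition integral_scheme :: "scheme \<Rightarrow> bool" where
  "integral_scheme Y \<longleftrightarrow> reduced_scheme Y \<and> irreducible_scheme Y"

text \<open>Points \<open>q\<close> whose maximal ideal is the annihilator of an element of the stalk of \<open>\<O>\<^sub>Y\<close> at \<open>q\<close>.\<close>

definition assoc_point :: "scheme \<Rightarrow> point \<Rightarrow> bool" where
  "assoc_point Y q \<longleftrightarrow> q \<in> P3 \<and>
     (\<exists>s\<in>local_set q. local_max q = {a \<in> local_set q. a * s \<in> Y q})"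

text \<open>
  Pure dimension 1 is understood without embedded points, so that the curves on a smooth surface
  are exactly its nonzero effective divisors.
\<close>

definition curve :: "scheme \<Rightarrow> bool" where
  "curve C \<longleftrightarrow> closed_subscheme C \<and> supp C \<noteq> {} \<and>
     (\<forall>q. assoc_point C q \<longrightarrow> closure_dim q = 1)"

definition hypersurface :: "cpoly \<Rightarrow> scheme" where
  "hypersurface F = (\<lambda>q. {Fract a b | a b d. homog d a \<and> homog d b \<and> b \<notin> q \<and> F dvd a})"

text \<open>Smoothness is the Jacobian criterion at every point of the surface.\<close>

definition smooth_surface :: "nat \<Rightarrow> scheme \<Rightarrow> bool" where
  "smooth_surface d X \<longleftrightarrow> d \<ge> 1 \<and>
     (\<exists>F. F \<noteq> 0 \<and> homog d F \<and> scheme_eq X (hypersurface F) \<and>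
        (\<forall>q\<in>P3. F \<in> q \<longrightarrow> (\<exists>i. pdiff i F \<notin> q)))"

text \<open>
  Addition of effective divisors on the surface \<open>X\<close>: the ideal of \<open>C + C'\<close> in \<open>\<O>\<^sub>X\<close> is the product
  of the ideals of \<open>C\<close> and \<open>C'\<close>. The zero divisor is the empty subscheme.
\<close>

definition divisor_add :: "scheme \<Rightarrow> scheme \<Rightarrow> scheme \<Rightarrow> scheme" where
  "divisor_add X C C' = (\<lambda>q. (C q \<cdot>\<^bsub>stalk q\<^esub> C' q) <+>\<^bsub>stalk q\<^esub> X q)"

definition divisor_multiple :: "scheme \<Rightarrow> nat \<Rightarrow> scheme \<Rightarrow> scheme" where
  "divisor_multiple X n C = (divisor_add X C ^^ n) local_set"


section \<open>Sheaves of homomorphisms and normal sheaves\<close>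

text \<open>
  The stalk at \<open>q\<close> of \<open>\<H>om(\<I>\<^sub>Y,\<O>\<^sub>Z)\<close>. As \<open>\<I>\<^sub>Y\<close> is coherent, it is the module of homomorphisms
  between the stalks. Values are cosets of \<open>Z q\<close>. The multiplicative fields of the record play no
  role.
\<close>

definition hom_stalk ::
  "scheme \<Rightarrow> scheme \<Rightarrow> point \<Rightarrow> (ratfun, ratfun \<Rightarrow> ratfun set) module" where
  "hom_stalk Y Z q =
    (let R = stalk q; Q = R Quot Z q in
     \<lparr>carrier = {\<phi> \<in> Y q \<rightarrow>\<^sub>E carrier Q.
         (\<forall>f\<in>Y q. \<forall>g\<in>Y q. \<phi> (f \<oplus>\<^bsub>R\<^esub> g) = \<phi> f \<oplus>\<^bsub>Q\<^esub> \<phi> g) \<and>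
         (\<forall>a\<in>carrier R. \<forall>f\<in>Y q. \<phi> (a \<otimes>\<^bsub>R\<^esub> f) = (Z q +>\<^bsub>R\<^esub> a) \<otimes>\<^bsub>Q\<^esub> \<phi> f)},
      monoid.mult = undefined, one = undefined,
      ring.zero = (\<lambda>f\<in>Y q. \<zero>\<^bsub>Q\<^esub>),
      add = (\<lambda>\<phi> \<psi>. \<lambda>f\<in>Y q. \<phi> f \<oplus>\<^bsub>Q\<^esub> \<psi> f),
      smult = (\<lambda>a \<phi>. \<lambda>f\<in>Y q. (Z q +>\<^bsub>R\<^esub> a) \<otimes>\<^bsub>Q\<^esub> \<phi> f)\<rparr>)"

text \<open>
  \<open>H\<^sup>0(\<H>om(\<I>\<^sub>Y,\<O>\<^sub>Z))\<close>: the sheaf homomorphisms \<open>\<I>\<^sub>Y \<rightarrow> \<O>\<^sub>Z\<close>, as families of stalk homomorphisms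
  mapping sections of \<open>\<I>\<^sub>Y\<close> to sections of \<open>\<O>\<^sub>Z\<close>; the latter are the families of elements of the
  stalks of \<open>\<O>\<^sub>Z\<close> that locally lift to \<open>\<O>\<close>.
\<close>

definition hom_sections :: "scheme \<Rightarrow> scheme \<Rightarrow> (point \<Rightarrow> ratfun \<Rightarrow> ratfun set) set" where
  "hom_sections Y Z = {\<xi> \<in> (\<Pi>\<^sub>E q\<in>P3. carrier (hom_stalk Y Z q)).
     \<forall>U f. zopen U \<and> f \<in> reg_sections U \<and> (\<forall>q\<in>U. f \<in> Y q) \<longrightarrow>
       (\<forall>x\<in>U. \<exists>V g. zopen V \<and> x \<in> V \<and> V \<subseteq> U \<and> g \<in> reg_sections V \<and>
          (\<forall>q\<in>V. \<xi> q f = Z q +>\<^bsub>stalk q\<^esub> g))}"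

abbreviation normal_stalk where "normal_stalk Y \<equiv> hom_stalk Y Y"
abbreviation normal_sections where "normal_sections Y \<equiv> hom_sections Y Y"

definition ideal_smult :: "('a, 'r) ring_scheme \<Rightarrow> 'a set \<Rightarrow> ('a, 'b, 'm) module_scheme \<Rightarrow> 'b set"
  where "ideal_smult R I M =
    \<Inter>{H. submodule H R M \<and> (\<forall>a\<in>I. \<forall>m\<in>carrier M. a \<odot>\<^bsub>M\<^esub> m \<in> H)}"

text \<open>
  The restriction \<open>H\<^sup>0(\<N>\<^sub>Y) \<rightarrow> H\<^sup>0(\<N>\<^sub>Y \<otimes> \<O>\<^sub>Z)\<close>. The stalk of \<open>\<N>\<^sub>Y \<otimes> \<O>\<^sub>Z\<close> at \<open>q\<close> is the quotient of
  the stalk of \<open>\<N>\<^sub>Y\<close> by its multiple by the ideal of \<open>Z\<close>; elements are cosets.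
\<close>

definition restrict_normal ::
  "scheme \<Rightarrow> scheme \<Rightarrow> (point \<Rightarrow> ratfun \<Rightarrow> ratfun set) \<Rightarrow> point \<Rightarrow> (ratfun \<Rightarrow> ratfun set) set" where
  "restrict_normal Y Z \<xi> = (\<lambda>q\<in>P3.
     ideal_smult (stalk q) (Z q) (normal_stalk Y q) +>\<^bsub>normal_stalk Y q\<^esub> \<xi> q)"

definition zero_restricted :: "scheme \<Rightarrow> scheme \<Rightarrow> point \<Rightarrow> (ratfun \<Rightarrow> ratfun set) set" where
  "zero_restricted Y Z = (\<lambda>q\<in>P3. ideal_smult (stalk q) (Z q) (normal_stalk Y q))"

text \<open>
  For \<open>Z \<subseteq> Y \<subseteq> W\<close>, the map \<open>\<N>\<^sub>Y \<otimes> \<O>\<^sub>Z \<rightarrow> \<H>om(\<I>\<^sub>W,\<O>\<^sub>Z)\<close> induced by \<open>\<I>\<^sub>W \<subseteq> \<I>\<^sub>Y\<close> and \<open>\<O>\<^sub>Y \<rightarrow> \<O>\<^sub>Z\<close>.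
  The class \<open>T q\<close> of \<open>\<eta>\<close> is sent to \<open>f \<mapsto> \<eta> f + Z q\<close>; all \<open>\<eta> \<in> T q\<close> give the same coset, so their
  union is that coset. For \<open>W = Y\<close> locally a complete intersection this is the canonical
  isomorphism \<open>\<N>\<^sub>Y \<otimes> \<O>\<^sub>Z = \<H>om(\<I>\<^sub>Y,\<O>\<^sub>Z)\<close>.
\<close>

definition induced_hom ::
  "scheme \<Rightarrow> scheme \<Rightarrow> (point \<Rightarrow> (ratfun \<Rightarrow> ratfun set) set) \<Rightarrow> point \<Rightarrow> ratfun \<Rightarrow> ratfun set" where
  "induced_hom W Z T = (\<lambda>q\<in>P3. \<lambda>f\<in>W q. \<Union>\<eta>\<in>T q. \<eta> f <+>\<^bsub>stalk q\<^esub> Z q)"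

definition zero_hom :: "scheme \<Rightarrow> scheme \<Rightarrow> point \<Rightarrow> ratfun \<Rightarrow> ratfun set" where
  "zero_hom W Z = (\<lambda>q\<in>P3. \<lambda>f\<in>W q. Z q)"


section \<open>First order freeness and simple extensions\<close>

definition rc_map ::
  "scheme \<Rightarrow> point set \<Rightarrow> point \<Rightarrow> (point \<Rightarrow> ratfun \<Rightarrow> ratfun set) \<Rightarrow>
   point \<Rightarrow> (ratfun \<Rightarrow> ratfun set) set" where
  "rc_map E S p = restrict_normal E (reduced_points (S - {p}))"

text \<open>
  The normal sequence has \<open>\<N>\<^sub>E = \<H>om(\<I>\<^sub>E,\<O>\<^sub>E) \<rightarrow> \<H>om(\<I>\<^sub>X,\<O>\<^sub>E) = \<N>\<^sub>X \<otimes> \<O>\<^sub>E\<close>, and \<open>\<N>\<^sub>X \<otimes> \<O>\<^sub>p\<close> is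
  realised as \<open>\<H>om(\<I>\<^sub>X,\<O>\<^sub>p)\<close>, the ideal \<open>\<I>\<^sub>X\<close> being invertible.
\<close>

definition r_map ::
  "scheme \<Rightarrow> scheme \<Rightarrow> point \<Rightarrow> (point \<Rightarrow> ratfun \<Rightarrow> ratfun set) \<Rightarrow> point \<Rightarrow> ratfun \<Rightarrow> ratfun set" where
  "r_map E X p \<xi> =
     induced_hom X (reduced_points {p}) (restrict_normal E (reduced_points {p}) \<xi>)"

definition first_order_free :: "scheme \<Rightarrow> scheme \<Rightarrow> point set \<Rightarrow> bool" where
  "first_order_free E X S \<longleftrightarrow>
     (\<forall>p\<in>S. \<exists>\<xi>\<in>normal_sections E.
        rc_map E S p \<xi> = zero_restricted E (reduced_points (S - {p})) \<and>
        r_map E X p \<xi> \<noteq> zero_hom X (reduced_points {p}))"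

definition Upsilon5 ::
  "scheme \<Rightarrow> scheme \<Rightarrow> (point \<Rightarrow> ratfun \<Rightarrow> ratfun set) \<Rightarrow> point \<Rightarrow> (ratfun \<Rightarrow> ratfun set) set" where
  "Upsilon5 C D = restrict_normal D C"

definition Upsilon6 ::
  "scheme \<Rightarrow> scheme \<Rightarrow> (point \<Rightarrow> ratfun \<Rightarrow> ratfun set) \<Rightarrow> point \<Rightarrow> ratfun \<Rightarrow> ratfun set" where
  "Upsilon6 C D \<xi> = (\<lambda>q\<in>P3. \<lambda>f\<in>D q. \<xi> q f)"

text \<open>
  \<open>simple_extension X C D\<close>: \<open>(D,X)\<close> is a simple extension of \<open>(C,X)\<close>. The images of the two maps
  are compared in \<open>H\<^sup>0(\<N>\<^sub>D \<otimes> \<O>\<^sub>C) = H\<^sup>0(\<H>om(\<I>\<^sub>D,\<O>\<^sub>C))\<close> by the canonical isomorphism.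
\<close>

definition simple_extension :: "scheme \<Rightarrow> scheme \<Rightarrow> scheme \<Rightarrow> bool" where
  "simple_extension X C D \<longleftrightarrow>
     (\<exists>n C'. n > 0 \<and> curve C' \<and> reduced_scheme C' \<and> subscheme C' X \<and>
        finite (supp C' \<inter> supp C) \<and>
        scheme_eq D (divisor_add X C (divisor_multiple X n C'))) \<and>
     Upsilon6 C D ` normal_sections C
       \<subseteq> induced_hom D C ` Upsilon5 C D ` normal_sections D"

end

theory Submission
  imports Defs
    "HOL-Analysis.Continuum_Not_Denumerable"
    "HOL-Computational_Algebra.Fundamental_Theorem_Algebra"
begin

text \<open>
  Put \<open>D = C + E\<close>. Since \<open>D = C \<union> E\<close> as schemes, a section of \<open>\<N>\<^sub>D\<close> is a pair of sections of
  \<open>\<H>om(\<I>\<^sub>D,\<O>\<^sub>C)\<close> and \<open>\<H>om(\<I>\<^sub>D,\<O>\<^sub>E)\<close> that agree on \<open>C.E\<close>. Given \<open>\<xi> \<in> H\<^sup>0(\<N>\<^sub>C)\<close>, the first component is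
  the image of \<open>\<xi>\<close>, and the second is induced by a linear combination \<open>\<zeta> = \<Sum> c\<^sub>p \<xi>\<^sub>p\<close> of the sections
  provided by first order freeness. At \<open>p \<in> C.E\<close> both components kill \<open>\<I>\<^sub>C \<I>\<^sub>E\<close>, so they agree as
  soon as they have the same value at \<open>p\<close> on a local equation of \<open>X\<close>; this determines \<open>c\<^sub>p\<close>, because the
  residue field at \<open>p\<close> is \<open>\<complex>\<close> and the other \<open>\<xi>\<^sub>q\<close> vanish at \<open>p\<close>.

  The equality \<open>\<I>\<^sub>D = \<I>\<^sub>C \<inter> \<I>\<^sub>E\<close> at \<open>p \<in> C.E\<close> uses that \<open>\<I>\<^sub>C + \<I>\<^sub>E = \<mm>\<close> there. As \<open>\<mm>/\<I>\<^sub>X\<close> has two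
  generators and neither \<open>\<I>\<^sub>C\<close> nor \<open>\<I>\<^sub>E\<close> equals \<open>\<mm>\<close>, one has \<open>\<mm> = (x, y) + \<I>\<^sub>X\<close> with \<open>x \<in> \<I>\<^sub>C\<close> and \<open>y \<in> \<I>\<^sub>E\<close>.
  If \<open>f = a x + b y + w\<close> lies in both ideals, then \<open>b y \<in> \<I>\<^sub>C\<close> and \<open>a x \<in> \<I>\<^sub>E\<close>, hence \<open>b \<in> \<I>\<^sub>C\<close> and
  \<open>a \<in> \<I>\<^sub>E\<close> because curves have no embedded points.
\<close>

section \<open>Ideals as plain sets\<close>

text \<open>All stalks are subrings of the single field \<open>ratfun\<close>, so ideals are plain
  subsets, and a homomorphism into a quotient is a function of representatives that is linear up to
  the ideal.

  That the residue field at a closed point is C is not built into the definitions, where a point is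
  a homogeneous prime and closed means Zariski closed. It comes from the weak Nullstellensatz, which
  is proved by a cardinality argument because C is uncountable. The resulting coordinates of a
  closed point also give explicit generators of its maximal ideal, and the Jacobian criterion
  eliminates one of them modulo I_X.

  The obstacle in the gluing is regularity: where two sections agree modulo I_C + I_E, their
  difference is split into a part in I_C and a part in I_E point by point, without any continuity.
  Coherence of the two ideal sheaves is what turns such a splitting at one point into a lift on a
  neighbourhood.\<close>

definition subring_set :: "'a::comm_ring_1 set \<Rightarrow> bool" where
  "subring_set R \<longleftrightarrow> 0 \<in> R \<and> 1 \<in> R \<and>
     (\<forall>a\<in>R. \<forall>b\<in>R. a + b \<in> R \<and> a * b \<in> R) \<and> (\<forall>a\<in>R. - a \<in> R)"

definition idl :: "'a::comm_ring_1 set \<Rightarrow> 'a set \<Rightarrow> bool" where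
  "idl R I \<longleftrightarrow> I \<subseteq> R \<and> 0 \<in> I \<and> (\<forall>a\<in>I. \<forall>b\<in>I. a + b \<in> I) \<and> (\<forall>r\<in>R. \<forall>a\<in>I. r * a \<in> I)"

lemma subring_set_UNIV [simp]: "subring_set UNIV"
  by (simp add: subring_set_def)

lemma ring_on_simps [simp]:
  "carrier (ring_on R) = R" "monoid.mult (ring_on R) = (*)" "one (ring_on R) = 1"
  "ring.zero (ring_on R) = 0" "add (ring_on R) = (+)"
  by (simp_all add: ring_on_def)

lemma cring_ring_on:
  assumes "subring_set R"
  shows "cring (ring_on R)"
proof (rule cringI)
  show "abelian_group (ring_on R)"
  proof (rule abelian_groupI)
    fix x assume "x \<in> carrier (ring_on R)"
    then show "\<exists>y\<in>carrier (ring_on R). y \<oplus>\<^bsub>ring_on R\<^esub> x = \<zero>\<^bsub>ring_on R\<^esub>"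
      using assms by (intro bexI[of _ "- x"]) (auto simp: subring_set_def)
  qed (use assms in \<open>auto simp: subring_set_def algebra_simps\<close>)
  show "comm_monoid (ring_on R)"
    by (rule comm_monoidI) (use assms in \<open>auto simp: subring_set_def algebra_simps\<close>)
qed (auto simp: algebra_simps)

lemma idl_zero: "idl R I \<Longrightarrow> 0 \<in> I"
  and idl_add: "idl R I \<Longrightarrow> a \<in> I \<Longrightarrow> b \<in> I \<Longrightarrow> a + b \<in> I"
  and idl_mult: "idl R I \<Longrightarrow> r \<in> R \<Longrightarrow> a \<in> I \<Longrightarrow> r * a \<in> I"
  and idl_mult': "idl R I \<Longrightarrow> r \<in> R \<Longrightarrow> a \<in> I \<Longrightarrow> a * r \<in> I"
  and idl_subset: "idl R I \<Longrightarrow> a \<in> I \<Longrightarrow> a \<in> R"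
  by (auto simp: idl_def mult.commute)

lemma idl_uminus: "subring_set R \<Longrightarrow> idl R I \<Longrightarrow> a \<in> I \<Longrightarrow> - a \<in> I"
  using idl_mult[of R I "-1" a] by (auto simp: subring_set_def)

lemma idl_diff: "subring_set R \<Longrightarrow> idl R I \<Longrightarrow> a \<in> I \<Longrightarrow> b \<in> I \<Longrightarrow> a - b \<in> I"
  using idl_add[of R I a "- b"] idl_uminus[of R I b] by simp

lemma idl_cong: "subring_set R \<Longrightarrow> idl R I \<Longrightarrow> a - b \<in> I \<Longrightarrow> b \<in> I \<longleftrightarrow> a \<in> I"
  using idl_add[of R I "a - b" b] idl_diff[of R I a "a - b"] by auto

lemma idl_one: "subring_set R \<Longrightarrow> idl R I \<Longrightarrow> 1 \<in> I \<longleftrightarrow> I = R"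
  unfolding idl_def subring_set_def by (metis mult.right_neutral subsetI subset_antisym)

lemma ideal_iff_idl:
  assumes "subring_set R"
  shows "ideal I (ring_on R) \<longleftrightarrow> idl R I"
proof
  assume "ideal I (ring_on R)"
  then interpret ideal I "ring_on R" .
  show "idl R I"
    unfolding idl_def
    using a_subset additive_subgroup.zero_closed[OF is_additive_subgroup]
      additive_subgroup.a_closed[OF is_additive_subgroup] I_l_closed
    by (intro conjI ballI) simp_all
next
  assume I: "idl R I"
  interpret cring "ring_on R" using assms by (rule cring_ring_on)
  have minus: "inv\<^bsub>add_monoid (ring_on R)\<^esub> a = - a" if "a \<in> R" for a
    unfolding a_inv_def[symmetric]
    by (rule minus_equality) (use that assms in \<open>auto simp: subring_set_def\<close>)
  show "ideal I (ring_on R)"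
  proof (rule idealI)
    show "subgroup I (add_monoid (ring_on R))"
      using I idl_uminus[OF assms I] minus by (auto simp: subgroup_def idl_def)
  qed (use ring_axioms in \<open>simp_all add: idl_mult[OF I] idl_mult'[OF I]\<close>)
qed

text \<open>The set is I + R x. It occurs as one step of the weak Nullstellensatz, as p + (x_i - 1),
  and with I = {0} as the principal ideal of a surface.\<close>

lemma idl_adjoin:
  assumes R: "subring_set R" and I: "idl R I" and x: "x \<in> R"
  shows "idl R {y. \<exists>r\<in>R. y - r * x \<in> I}"
  unfolding idl_def
proof (intro conjI ballI subsetI; (elim CollectE bexE)?)
  fix y r assume r: "r \<in> R" "y - r * x \<in> I"
  then have "(y - r * x) + r * x \<in> R"
    using R x idl_subset[OF I r(2)] unfolding subring_set_def by blast
  then show "y \<in> R" by simp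
next
  show "0 \<in> {y. \<exists>r\<in>R. y - r * x \<in> I}"
    using R idl_zero[OF I] by (intro CollectI bexI[of _ 0]) (auto simp: subring_set_def)
next
  fix u v r s assume *: "r \<in> R" "u - r * x \<in> I" "s \<in> R" "v - s * x \<in> I"
  have "u + v - (r + s) * x \<in> I"
    using idl_add[OF I *(2,4)] by (simp add: algebra_simps)
  then show "u + v \<in> {y. \<exists>r\<in>R. y - r * x \<in> I}"
    using R * by (intro CollectI bexI[of _ "r + s"]) (auto simp: subring_set_def)
next
  fix t u r assume *: "t \<in> R" "r \<in> R" "u - r * x \<in> I"
  have "t * u - (t * r) * x \<in> I"
    using idl_mult[OF I *(1,3)] by (simp add: algebra_simps)
  then show "t * u \<in> {y. \<exists>r\<in>R. y - r * x \<in> I}"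
    using R * by (intro CollectI bexI[of _ "t * r"]) (auto simp: subring_set_def)
qed


section \<open>Polynomials\<close>

abbreviation const :: "complex \<Rightarrow> cpoly" where
  "const c \<equiv> Poly_Mapping.single 0 c"

abbreviation mdeg :: "(4 \<Rightarrow>\<^sub>0 nat) \<Rightarrow> nat" where
  "mdeg m \<equiv> \<Sum>i\<in>UNIV. Poly_Mapping.lookup m i"

lemma mdeg_add: "mdeg (m + n) = mdeg m + mdeg n"
  by (simp add: lookup_add sum.distrib)

lemma const_mult: "const a * const b = const (a * b)"
  by (simp add: mult_single)

lemma cpoly_induct [case_names zero single add]:
  fixes F :: cpoly
  assumes "P 0" "\<And>m c. P (Poly_Mapping.single m c)" "\<And>F G. P F \<Longrightarrow> P G \<Longrightarrow> P (F + G)"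
  shows "P F"
proof -
  have eq: "F = (\<Sum>m\<in>Poly_Mapping.keys F. Poly_Mapping.single m (Poly_Mapping.lookup F m))"
    by (rule poly_mapping_eqI)
      (auto simp: lookup_sum lookup_single when_def in_keys_iff)
  have "P (\<Sum>m\<in>A. Poly_Mapping.single m (Poly_Mapping.lookup F m))" for A
    by (induction A rule: infinite_finite_induct) (auto intro: assms)
  then show ?thesis by (subst eq)
qed

lemma single_coord_power: "coord i ^ n = Poly_Mapping.single (Poly_Mapping.single i n) 1"
proof (induction n)
  case (Suc n)
  have "Poly_Mapping.single i (Suc n) = Poly_Mapping.single i 1 + Poly_Mapping.single i n"
    by (simp flip: single_add)
  then show ?case using Suc by (simp add: coord_def mult_single)
qed simp

lemma monomial_eq:
  "Poly_Mapping.single m c = const c * (\<Prod>i\<in>UNIV. coord i ^ Poly_Mapping.lookup m i)"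
proof -
  have *: "(\<Prod>i\<in>A. coord i ^ Poly_Mapping.lookup m i)
      = Poly_Mapping.single (\<Sum>i\<in>A. Poly_Mapping.single i (Poly_Mapping.lookup m i)) 1"
    if "finite A" for A
    using that by (induction A) (auto simp: single_coord_power mult_single)
  have "(\<Sum>i\<in>UNIV. Poly_Mapping.single i (Poly_Mapping.lookup m i)) = m"
    by (rule poly_mapping_eqI) (simp add: lookup_sum lookup_single when_def)
  then show ?thesis by (simp add: * mult_single)
qed

text \<open>The coordinates generate the polynomial ring over C, so a property of evaluations that
  respects sums and products is checked on constants and coordinates alone.\<close>

lemma cpoly_alg_induct [case_names const coord add mult]:
  fixes F :: cpoly
  assumes const: "\<And>c. P (const c)" and coord: "\<And>i. P (coord i)"
    and add: "\<And>F G. P F \<Longrightarrow> P G \<Longrightarrow> P (F + G)" and mult: "\<And>F G. P F \<Longrightarrow> P G \<Longrightarrow> P (F * G)"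
  shows "P F"
proof (induction F rule: cpoly_induct)
  case zero
  show ?case using const[of 0] by simp
next
  case (single m c)
  have one: "P 1" using const[of 1] by simp
  have "P (coord i ^ n)" for i n by (induction n) (auto intro: one coord mult)
  then have "P (\<Prod>i\<in>A. coord i ^ Poly_Mapping.lookup m i)" for A
    by (induction A rule: infinite_finite_induct) (auto intro: one mult)
  then show ?case by (subst monomial_eq) (intro mult const)
qed (fact add)

text \<open>The homomorphism extending \<open>h\<close> that sends x_i to \<open>y i\<close>. With
  the identity for \<open>h\<close> it gives values at vectors of C^4, with \<open>scal\<close>
  dehomogenisation, with a \<mapsto> \<open>[:a:]\<close> restriction to a line.\<close>

definition ev :: "(complex \<Rightarrow> 'a::comm_ring_1) \<Rightarrow> (4 \<Rightarrow> 'a) \<Rightarrow> cpoly \<Rightarrow> 'a" where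
  "ev h y F = (\<Sum>m\<in>Poly_Mapping.keys F. h (Poly_Mapping.lookup F m) *
     (\<Prod>i\<in>UNIV. y i ^ Poly_Mapping.lookup m i))"

definition scalar_hom :: "(complex \<Rightarrow> 'a::comm_ring_1) \<Rightarrow> bool" where
  "scalar_hom h \<longleftrightarrow> h 0 = 0 \<and> h 1 = 1 \<and> (\<forall>a b. h (a + b) = h a + h b) \<and> (\<forall>a b. h (a * b) = h a * h b)"

lemma ev_single:
  assumes "scalar_hom h"
  shows "ev h y (Poly_Mapping.single m c) = h c * (\<Prod>i\<in>UNIV. y i ^ Poly_Mapping.lookup m i)"
  using assms by (cases "c = 0") (auto simp: ev_def scalar_hom_def)

lemma ev_const: "scalar_hom h \<Longrightarrow> ev h y (const c) = h c"
  by (simp add: ev_single)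

lemma ev_one: "scalar_hom h \<Longrightarrow> ev h y 1 = 1"
  using ev_const[of h y 1] by (simp add: scalar_hom_def)

lemma ev_coord: "scalar_hom h \<Longrightarrow> ev h y (coord i) = y i"
proof -
  assume h: "scalar_hom h"
  have "(\<Prod>j\<in>UNIV. y j ^ Poly_Mapping.lookup (Poly_Mapping.single i (1::nat)) j)
      = (\<Prod>j\<in>UNIV. if j = i then y j else 1)"
    by (rule prod.cong) (auto simp: lookup_single when_def)
  also have "\<dots> = y i" by (simp add: prod.delta)
  finally show ?thesis using h by (simp add: coord_def ev_single scalar_hom_def)
qed

lemma ev_zero: "ev h y 0 = 0"
  by (simp add: ev_def)

lemma ev_add: "scalar_hom h \<Longrightarrow> ev h y (F + G) = ev h y F + ev h y G"
  unfolding ev_def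
  by (rule setsum_keys_plus_distrib) (auto simp: scalar_hom_def algebra_simps)

lemma ev_mult:
  assumes h: "scalar_hom h"
  shows "ev h y (F * G) = ev h y F * ev h y G"
proof (induction F rule: cpoly_induct)
  case (single m c)
  show ?case
  proof (induction G rule: cpoly_induct)
    case (single n d)
    have "(\<Prod>i\<in>UNIV. y i ^ Poly_Mapping.lookup (m + n) i)
      = (\<Prod>i\<in>UNIV. y i ^ Poly_Mapping.lookup m i) * (\<Prod>i\<in>UNIV. y i ^ Poly_Mapping.lookup n i)"
      by (simp add: lookup_add power_add prod.distrib)
    moreover have "h (c * d) = h c * h d" using h by (simp add: scalar_hom_def)
    ultimately show ?case by (simp only: mult_single ev_single[OF h] mult_ac)
  qed (simp_all add: ev_zero ev_add[OF h] algebra_simps)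
qed (simp_all add: ev_zero ev_add[OF h] algebra_simps)

lemma ev_uminus:
  assumes "scalar_hom h"
  shows "ev h y (- F) = - ev h y F"
  using ev_add[OF assms, of y F "- F"] by (simp add: ev_zero eq_neg_iff_add_eq_0 add.commute)

lemma ev_diff: "scalar_hom h \<Longrightarrow> ev h y (F - G) = ev h y F - ev h y G"
  using ev_add[of h y F "- G"] by (simp add: ev_uminus)

lemma ev_sum: "scalar_hom h \<Longrightarrow> ev h y (sum f A) = (\<Sum>a\<in>A. ev h y (f a))"
  by (induction A rule: infinite_finite_induct) (auto simp: ev_zero ev_add)

lemma scalar_hom_id: "scalar_hom (\<lambda>c. c)"
  by (simp add: scalar_hom_def)

lemma ev_homog_scale:
  assumes h: "scalar_hom h" and F: "homog d F"
  shows "ev h (\<lambda>i. s * y i) F = s ^ d * ev h y F"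
proof -
  have "(\<Prod>i\<in>UNIV. (s * y i) ^ Poly_Mapping.lookup m i)
      = s ^ d * (\<Prod>i\<in>UNIV. y i ^ Poly_Mapping.lookup m i)" if "m \<in> Poly_Mapping.keys F" for m
    using F that by (simp add: power_mult_distrib prod.distrib power_sum[symmetric] homog_def)
  then show ?thesis
    unfolding ev_def sum_distrib_left by (intro sum.cong) (auto simp: algebra_simps)
qed

section \<open>Weak Nullstellensatz over the complex numbers\<close>

lemma lookup_const_mult: "Poly_Mapping.lookup (const a * F) m = a * Poly_Mapping.lookup F m"
  by (induction F rule: cpoly_induct)
    (auto simp: mult_single lookup_single when_def lookup_add algebra_simps)

text \<open>Gaussian elimination in the space spanned by the monomials in K. If infinitely many
  members have coefficient 0 at k, these live on the smaller set; otherwise some member with nonzero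
  coefficient serves as pivot \<open>g b\<close>, and subtracting multiples of it clears k from the
  others.\<close>

lemma finite_support_dependence:
  fixes g :: "complex \<Rightarrow> cpoly"
  assumes "finite K" "infinite B" "\<And>c. c \<in> B \<Longrightarrow> Poly_Mapping.keys (g c) \<subseteq> K"
  shows "\<exists>A\<subseteq>B. finite A \<and> (\<exists>l. (\<exists>c\<in>A. l c \<noteq> 0) \<and> (\<Sum>c\<in>A. const (l c) * g c) = 0)"
  using assms
proof (induction K arbitrary: B g rule: finite_induct)
  case empty
  then obtain c where "c \<in> B" by (metis ex_in_conv finite.emptyI)
  then have "Poly_Mapping.keys (g c) = {}" using empty(2) by blast
  then have "g c = 0" by (intro poly_mapping_eqI) (auto simp: in_keys_iff)
  with \<open>c \<in> B\<close> show ?case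
    by (intro exI[of _ "{c}"] exI[of _ "\<lambda>_. 1"] conjI bexI[of _ c]) simp_all
next
  case (insert k K)
  show ?case
  proof (cases "infinite {c\<in>B. Poly_Mapping.lookup (g c) k = 0}")
    case True
    have *: "Poly_Mapping.keys (g c) \<subseteq> K" if "c \<in> {c\<in>B. Poly_Mapping.lookup (g c) k = 0}" for c
      using that insert.prems(2)[of c] by (auto simp: in_keys_iff)
    have "\<exists>A\<subseteq>{c\<in>B. Poly_Mapping.lookup (g c) k = 0}. finite A \<and>
        (\<exists>l. (\<exists>c\<in>A. l c \<noteq> 0) \<and> (\<Sum>c\<in>A. const (l c) * g c) = 0)"
      by (rule insert.IH[OF True]) (erule *)
    then obtain A l c0 where "A \<subseteq> {c\<in>B. Poly_Mapping.lookup (g c) k = 0}" "finite A"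
      "c0 \<in> A" "l c0 \<noteq> 0" "(\<Sum>c\<in>A. const (l c) * g c) = 0"
      by (elim exE conjE bexE)
    then show ?thesis
      by (intro exI[of _ A] exI[of _ l] conjI bexI[of _ c0]) auto
  next
    case False
    define B' where "B' = {c\<in>B. Poly_Mapping.lookup (g c) k \<noteq> 0}"
    have "B = {c\<in>B. Poly_Mapping.lookup (g c) k = 0} \<union> B'" by (auto simp: B'_def)
    then have inf: "infinite B'" using False insert.prems(1) by (metis finite_Un)
    then obtain b where b: "b \<in> B'" by (metis ex_in_conv finite.emptyI)
    define r where "r c = Poly_Mapping.lookup (g c) k / Poly_Mapping.lookup (g b) k" for c
    define g' where "g' c = g c - const (r c) * g b" for c
    have *: "Poly_Mapping.keys (g' c) \<subseteq> K" if "c \<in> B' - {b}" for c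
    proof
      fix m assume m: "m \<in> Poly_Mapping.keys (g' c)"
      have "m \<noteq> k"
        using m b by (auto simp: in_keys_iff g'_def lookup_minus lookup_const_mult r_def B'_def)
      moreover have "m \<in> Poly_Mapping.keys (g c) \<union> Poly_Mapping.keys (g b)"
        using m by (auto simp: in_keys_iff g'_def lookup_minus lookup_const_mult)
      ultimately show "m \<in> K" using insert.prems(2)[of c] insert.prems(2)[of b] that b
        by (auto simp: B'_def)
    qed
    have "\<exists>A\<subseteq>B' - {b}. finite A \<and>
        (\<exists>l. (\<exists>c\<in>A. l c \<noteq> 0) \<and> (\<Sum>c\<in>A. const (l c) * g' c) = 0)"
      by (rule insert.IH[OF infinite_remove[OF inf]]) (erule *)
    then obtain A l c0 where A: "A \<subseteq> B' - {b}" "finite A"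
      and l: "c0 \<in> A" "l c0 \<noteq> 0" and 0: "(\<Sum>c\<in>A. const (l c) * g' c) = 0"
      by (elim exE conjE bexE)
    \<comment> \<open>The multiples of \<open>g b\<close> subtracted in the \<open>g' c\<close> are
      collected in the coefficient of b.\<close>
    define l' where "l' = l(b := - (\<Sum>c\<in>A. l c * r c))"
    have [simp]: "b \<notin> A" using A by auto
    have const_sum: "const (\<Sum>c\<in>A. h c) = (\<Sum>c\<in>A. const (h c))" for h
      by (induction A rule: infinite_finite_induct) (auto simp: single_add)
    have "(\<Sum>c\<in>A. const (l' c) * g c) = (\<Sum>c\<in>A. const (l c) * g c)"
      by (rule sum.cong) (auto simp: l'_def)
    moreover have "const (l' b) = - (\<Sum>c\<in>A. const (l c) * const (r c))"
      by (simp add: l'_def single_uminus const_sum const_mult)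
    ultimately have "(\<Sum>c\<in>insert b A. const (l' c) * g c) = (\<Sum>c\<in>A. const (l c) * g' c)"
      using A(2) by (simp add: g'_def algebra_simps sum_subtractf sum_distrib_left)
    moreover have "l' c0 \<noteq> 0" using l by (auto simp: l'_def)
    ultimately show ?thesis using A b l 0
      by (intro exI[of _ "insert b A"] exI[of _ l'] conjI bexI[of _ c0]) (auto simp: B'_def)
  qed
qed

definition upoly_ev :: "cpoly \<Rightarrow> complex poly \<Rightarrow> cpoly" where
  "upoly_ev x f = poly (map_poly const f) x"

lemma upoly_ev_pCons: "upoly_ev x (pCons a f) = const a + x * upoly_ev x f"
  by (simp add: upoly_ev_def map_poly_pCons)

lemma upoly_ev_0 [simp]: "upoly_ev x 0 = 0"
  by (simp add: upoly_ev_def)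

lemma upoly_ev_add: "upoly_ev x (f + g) = upoly_ev x f + upoly_ev x g"
proof -
  have "map_poly const (f + g) = map_poly const f + map_poly const g"
    by (rule poly_eqI) (simp add: coeff_map_poly single_add)
  then show ?thesis by (simp add: upoly_ev_def)
qed

lemma upoly_ev_smult: "upoly_ev x (smult a f) = const a * upoly_ev x f"
  by (induction f) (auto simp: upoly_ev_pCons const_mult[symmetric] algebra_simps)

lemma upoly_ev_mult: "upoly_ev x (f * g) = upoly_ev x f * upoly_ev x g"
  by (induction f)
    (auto simp: upoly_ev_pCons upoly_ev_add upoly_ev_smult algebra_simps)

lemma upoly_ev_1 [simp]: "upoly_ev x 1 = 1"
  by (simp add: one_pCons upoly_ev_pCons)

lemma upoly_ev_sum: "upoly_ev x (sum f A) = (\<Sum>a\<in>A. upoly_ev x (f a))"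
  by (induction A rule: infinite_finite_induct) (auto simp: upoly_ev_add)

lemma upoly_ev_prod: "upoly_ev x (prod f A) = (\<Prod>a\<in>A. upoly_ev x (f a))"
  by (induction A rule: infinite_finite_induct) (auto simp: upoly_ev_mult)

lemma upoly_ev_linear: "upoly_ev x [:- c, 1:] = x - const c"
  by (simp add: upoly_ev_pCons single_uminus)

lemma countable_UNIV_monomials: "countable (UNIV :: (4 \<Rightarrow>\<^sub>0 nat) set)"
proof (rule countableI')
  show "inj (\<lambda>m :: 4 \<Rightarrow>\<^sub>0 nat. to_nat (Poly_Mapping.lookup m))"
    by (auto intro!: injI poly_mapping_eqI)
qed

text \<open>C is uncountable, while there are only countably many finite sets of monomials; hence
  not every fibre of c \<mapsto> \<open>Poly_Mapping.keys (g c)\<close> can be finite.\<close>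

lemma infinite_same_keys:
  fixes g :: "complex \<Rightarrow> cpoly"
  shows "\<exists>K. finite K \<and> infinite {c. Poly_Mapping.keys (g c) = K}"
proof (rule ccontr)
  assume "\<not> ?thesis"
  then have *: "countable {c. Poly_Mapping.keys (g c) = K}" if "finite K" for K
    using that countable_finite by blast
  have "countable {K :: (4 \<Rightarrow>\<^sub>0 nat) set. finite K}"
    using countable_Collect_finite_subset[OF countable_UNIV_monomials] by simp
  then have "countable (\<Union>K\<in>{K. finite K}. {c. Poly_Mapping.keys (g c) = K})"
    using * by (intro countable_UN) auto
  moreover have "c \<in> (\<Union>K\<in>{K. finite K}. {c. Poly_Mapping.keys (g c) = K})" for c
    by (rule UN_I[of "Poly_Mapping.keys (g c)"]) simp_all
  then have "(UNIV :: complex set) \<subseteq> (\<Union>K\<in>{K. finite K}. {c. Poly_Mapping.keys (g c) = K})"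
    by (intro subsetI)
  ultimately show False using uncountable_UNIV_complex countable_subset by blast
qed

text \<open>
  If every \<open>x - c\<close> were invertible modulo \<open>I\<close>, infinitely many of the inverses would have the same
  monomials and hence satisfy a linear relation; clearing denominators gives a nonzero univariate
  polynomial \<open>f\<close> with \<open>f(x) \<in> I\<close>, although \<open>f(x)\<close> is a product of factors \<open>x - c\<close>.
\<close>

lemma adjoin_coordinate_value:
  assumes I: "idl UNIV I" and proper: "1 \<notin> I"
  shows "\<exists>c. \<forall>r. 1 - r * (x - const c) \<notin> I"
proof (rule ccontr)
  assume "\<not> ?thesis"
  then obtain g where g: "\<And>c. 1 - g c * (x - const c) \<in> I" by metis
  obtain K where K: "finite K" "infinite {c. Poly_Mapping.keys (g c) = K}"
    using infinite_same_keys by blast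
  obtain A l c0 where A: "finite A" and c0: "c0 \<in> A" "l c0 \<noteq> 0"
    and dep: "(\<Sum>c\<in>A. const (l c) * g c) = 0"
    using finite_support_dependence[OF K, of g] by auto
  define P where "P c = (\<Prod>b\<in>A - {c}. [:- b, 1::complex:])" for c
  \<comment> \<open>This is the sum of the l_c / (T - c) times the product of all T - b. At c0 only
    the summand of c0 survives, so f is nonzero.\<close>
  define f where "f = (\<Sum>c\<in>A. smult (l c) (P c))"
  have "poly (P c) c0 = 0" if "c \<in> A" "c \<noteq> c0" for c
    using that A c0 by (auto simp: P_def poly_prod)
  then have "poly f c0 = (\<Sum>c\<in>A. if c = c0 then l c * poly (P c) c0 else 0)"
    unfolding f_def poly_sum by (intro sum.cong) auto
  also have "\<dots> = l c0 * poly (P c0) c0" using A c0 by simp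
  also have "\<dots> \<noteq> 0" using c0 A by (auto simp: P_def poly_prod)
  finally have f0: "f \<noteq> 0" by auto
  define Q where "Q = (\<Prod>b\<in>A. x - const b)"
  have Q: "Q = (x - const c) * upoly_ev x (P c)" if "c \<in> A" for c
    using A that by (simp add: Q_def P_def upoly_ev_prod upoly_ev_linear prod.remove)
  \<comment> \<open>\<open>g c\<close> is an inverse of x - c modulo I, so P_c(x) is congruent to Q
    g_c, and f(x) to Q times the vanishing combination of the g_c.\<close>
  have "const (l c) * upoly_ev x (P c) - Q * (const (l c) * g c) \<in> I" if "c \<in> A" for c
  proof -
    have "const (l c) * upoly_ev x (P c) - Q * (const (l c) * g c)
        = (const (l c) * upoly_ev x (P c)) * (1 - g c * (x - const c))"
      by (simp add: Q[OF that] algebra_simps)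
    then show ?thesis using idl_mult[OF I UNIV_I g[of c]] by metis
  qed
  then have "(\<Sum>c\<in>A. const (l c) * upoly_ev x (P c) - Q * (const (l c) * g c)) \<in> I"
    using A by (induction A rule: infinite_finite_induct) (auto intro: idl_add[OF I] idl_zero[OF I])
  then have fI: "upoly_ev x f \<in> I"
    using dep by (simp add: f_def upoly_ev_sum upoly_ev_smult sum_subtractf sum_distrib_left[symmetric])
  \<comment> \<open>Over C a nonzero p splits into linear factors. Each factor x - z is cancelled
    modulo I by \<open>g z\<close>, until a nonzero constant remains in I.\<close>
  have "upoly_ev x p \<in> I \<Longrightarrow> p \<noteq> 0 \<Longrightarrow> 1 \<in> I" for p
  proof (induction "degree p" arbitrary: p)
    case 0
    then obtain a where "p = [:a:]" "a \<noteq> 0" by (metis degree_eq_zeroE pCons_0_0)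
    with 0 idl_mult[OF I UNIV_I, of "upoly_ev x p" "const (inverse a)"] show ?case
      by (simp add: upoly_ev_pCons const_mult)
  next
    case (Suc n)
    then have "\<not> constant (poly p)" by (simp add: constant_degree)
    then obtain z where "poly p z = 0" using fundamental_theorem_of_algebra by blast
    then obtain q where q: "p = [:- z, 1:] * q" by (metis dvd_def poly_eq_0_iff_dvd)
    have "upoly_ev x q - g z * upoly_ev x p = upoly_ev x q * (1 - g z * (x - const z))"
      by (simp only: q upoly_ev_mult upoly_ev_linear) (simp add: algebra_simps)
    also have "\<dots> \<in> I" using g I by (intro idl_mult) auto
    finally have "upoly_ev x q \<in> I"
      using idl_cong[OF subring_set_UNIV I] idl_mult[OF I UNIV_I Suc.prems(1)] by blast
    moreover have q0: "q \<noteq> 0" using Suc.prems(2) q by auto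
    moreover have "degree p = Suc (degree q)"
      unfolding q using q0 by (subst degree_mult_eq) auto
    ultimately show ?case using Suc.hyps by auto
  qed
  with fI f0 proper show False by blast
qed

text \<open>The coordinates are fixed one after the other: x_s - b is adjoined to J, where b is
  chosen so that x_s - b is not invertible modulo J and the enlarged ideal stays proper.\<close>

lemma weak_nullstellensatz:
  assumes "idl UNIV I" "1 \<notin> I"
  shows "\<exists>c J. I \<subseteq> J \<and> idl UNIV J \<and> 1 \<notin> J \<and> (\<forall>t. coord t - const (c t) \<in> J)"
proof -
  have "\<exists>c J. I \<subseteq> J \<and> idl UNIV J \<and> 1 \<notin> J \<and> (\<forall>t\<in>T. coord t - const (c t) \<in> J)" if "finite T" for T
    using that
  proof (induction T)
    case empty
    then show ?case using assms by blast
  next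
    case (insert s T)
    then obtain c J where J: "I \<subseteq> J" "idl UNIV J" "1 \<notin> J" "\<forall>t\<in>T. coord t - const (c t) \<in> J"
      by blast
    obtain b where b: "\<And>r. 1 - r * (coord s - const b) \<notin> J"
      using adjoin_coordinate_value[OF J(2,3)] by blast
    define J' where "J' = {y. \<exists>r\<in>UNIV. y - r * (coord s - const b) \<in> J}"
    have "idl UNIV J'" unfolding J'_def using J(2) by (intro idl_adjoin) auto
    moreover have "J \<subseteq> J'" unfolding J'_def by (auto intro: exI[of _ 0])
    moreover have "1 \<notin> J'" using b by (auto simp: J'_def)
    moreover have "coord s - const b \<in> J'"
      using idl_zero[OF J(2)] by (auto simp: J'_def intro: exI[of _ 1])
    ultimately show ?case using J insert.hyps
      by (intro exI[of _ "c(s := b)"] exI[of _ J']) auto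
  qed
  from this[of UNIV] show ?thesis by simp
qed

lemma ev_const_coord: "ev const coord F = F"
proof -
  have "scalar_hom const" by (simp add: scalar_hom_def single_add const_mult)
  then show ?thesis
    by (induction F rule: cpoly_alg_induct) (simp_all add: ev_const ev_coord ev_add ev_mult)
qed

lemma ev_mem:
  assumes R: "subring_set R" and h: "scalar_hom h" "range h \<subseteq> R" and y: "\<And>i. y i \<in> R"
  shows "ev h y F \<in> R"
proof (induction F rule: cpoly_alg_induct)
  case (const c)
  show ?case using h by (auto simp: ev_const)
qed (use R y in \<open>simp_all add: ev_coord ev_add ev_mult h(1) subring_set_def\<close>)

text \<open>\<open>ev h y\<close> and F \<mapsto> h(F(c)) are both compatible with sums and
  products, and they agree modulo I on constants and coordinates.\<close>

lemma ev_cong_ideal: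
  assumes R: "subring_set R" and I: "idl R I"
    and h: "scalar_hom h" "range h \<subseteq> R"
    and y: "\<And>i. y i \<in> R" "\<And>i. y i - h (c i) \<in> I"
  shows "ev h y F - h (ev (\<lambda>c. c) c F) \<in> I"
proof (induction F rule: cpoly_alg_induct)
  case (const a)
  show ?case using idl_zero[OF I] by (simp add: ev_const h(1) scalar_hom_id)
next
  case (coord i)
  show ?case using y(2) by (simp add: ev_coord h(1) scalar_hom_id)
next
  case (add F G)
  have "h (a + b) = h a + h b" for a b using h(1) by (simp add: scalar_hom_def)
  with idl_add[OF I add] show ?case
    by (simp add: ev_add h(1) scalar_hom_id algebra_simps)
next
  case (mult F G)
  have "h (a * b) = h a * h b" for a b using h(1) by (simp add: scalar_hom_def)
  then have "ev h y (F * G) - h (ev (\<lambda>c. c) c (F * G))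
      = ev h y G * (ev h y F - h (ev (\<lambda>c. c) c F))
        + h (ev (\<lambda>c. c) c F) * (ev h y G - h (ev (\<lambda>c. c) c G))"
    by (simp add: ev_mult h(1) scalar_hom_id algebra_simps)
  also have "\<dots> \<in> I"
    using mult ev_mem[OF R h y(1)] h(2) by (intro idl_add[OF I] idl_mult[OF I]) auto
  finally show ?case .
qed

text \<open>F is congruent to the constant F(c) modulo J, and a nonzero constant in J would make J
  the whole ring.\<close>

lemma zero_of_proper_ideal:
  assumes J: "idl UNIV J" "1 \<notin> J" "\<And>t. coord t - const (c t) \<in> J"
    and F: "F \<in> J"
  shows "ev (\<lambda>c. c) c F = 0"
proof -
  have "scalar_hom const" by (simp add: scalar_hom_def single_add const_mult)
  from ev_cong_ideal[OF subring_set_UNIV J(1) this, of coord c F] J(3)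
  have "F - const (ev (\<lambda>c. c) c F) \<in> J" by (simp add: ev_const_coord)
  from idl_diff[OF subring_set_UNIV J(1) F this]
  have "const (ev (\<lambda>c. c) c F) \<in> J" by simp
  from idl_mult[OF J(1) UNIV_I this, of "const (inverse (ev (\<lambda>c. c) c F))"]
  show ?thesis
    using J(2) by (cases "ev (\<lambda>c. c) c F = 0") (auto simp: const_mult)
qed


section \<open>Homogeneous polynomials\<close>

lemma homog_zero [simp]: "homog d 0"
  by (simp add: homog_def)

lemma homog_const [simp]: "homog 0 (const c)"
  by (cases "c = 0") (auto simp: homog_def)

lemma homog_one [simp]: "homog 0 1"
  using homog_const[of 1] by simp

lemma homog_single: "homog (mdeg m) (Poly_Mapping.single m c)"
  by (cases "c = 0") (auto simp: homog_def)

lemma homog_coord: "homog 1 (coord i)"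
proof -
  have "mdeg (Poly_Mapping.single i (1::nat)) = 1" by (simp add: lookup_single when_def)
  then show ?thesis using homog_single[of "Poly_Mapping.single i 1" 1] by (simp add: coord_def)
qed

lemma homog_add: "homog d F \<Longrightarrow> homog d G \<Longrightarrow> homog d (F + G)"
  using Poly_Mapping.keys_add[of F G] by (auto simp: homog_def)

lemma homog_mult:
  assumes "homog d F" "homog e G"
  shows "homog (d + e) (F * G)"
  unfolding homog_def
proof
  fix m assume "m \<in> Poly_Mapping.keys (F * G)"
  then obtain a b where "m = a + b" "a \<in> Poly_Mapping.keys F" "b \<in> Poly_Mapping.keys G"
    using keys_mult[of F G] by blast
  with assms show "mdeg m = d + e" by (simp add: homog_def mdeg_add)
qed

lemma homog_uminus: "homog d F \<Longrightarrow> homog d (- F)"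
  by (auto simp: homog_def in_keys_iff)

lemma homog_diff: "homog d F \<Longrightarrow> homog d G \<Longrightarrow> homog d (F - G)"
  using homog_add[of d F "- G"] by (simp add: homog_uminus)

lemma homog_power: "homog d F \<Longrightarrow> homog (n * d) (F ^ n)"
  by (induction n) (auto intro: homog_mult)

lemma homog_coord_power: "homog n (coord i ^ n)"
  using homog_power[OF homog_coord] by simp

definition hcomp :: "nat \<Rightarrow> cpoly \<Rightarrow> cpoly" where
  "hcomp n F = (\<Sum>m\<in>{m\<in>Poly_Mapping.keys F. mdeg m = n}.
     Poly_Mapping.single m (Poly_Mapping.lookup F m))"

lemma lookup_hcomp:
  "Poly_Mapping.lookup (hcomp n F) m = (if mdeg m = n then Poly_Mapping.lookup F m else 0)"
  by (auto simp: hcomp_def lookup_sum lookup_single when_def in_keys_iff sum.delta')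

lemma hcomp_add: "hcomp n (F + G) = hcomp n F + hcomp n G"
  by (rule poly_mapping_eqI) (simp add: lookup_hcomp lookup_add)

lemma homog_hcomp: "homog n (hcomp n F)"
  by (auto simp: homog_def in_keys_iff lookup_hcomp split: if_splits)

lemma hcomp_zero [simp]: "hcomp n 0 = 0"
  by (simp add: hcomp_def)

lemma hcomp_homog: "homog e G \<Longrightarrow> hcomp n G = (if n = e then G else 0)"
  by (rule poly_mapping_eqI) (auto simp: lookup_hcomp homog_def in_keys_iff)

lemma sum_hcomp: "\<exists>N. F = (\<Sum>n<N. hcomp n F)"
proof -
  have "finite (mdeg ` Poly_Mapping.keys F)" by simp
  then obtain N where N: "\<And>m. m \<in> Poly_Mapping.keys F \<Longrightarrow> mdeg m < N"
    unfolding finite_nat_set_iff_bounded by auto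
  have "F = (\<Sum>n<N. hcomp n F)"
    by (rule poly_mapping_eqI) (use N in \<open>auto simp: lookup_sum lookup_hcomp in_keys_iff\<close>)
  then show ?thesis ..
qed

lemma hcomp_mult:
  assumes "homog d F"
  shows "hcomp (d + n) (F * G) = F * hcomp n G"
proof (induction G rule: cpoly_induct)
  case (single m c)
  show ?case
    using hcomp_homog[OF homog_mult[OF assms homog_single], of "d + n"]
      hcomp_homog[OF homog_single, of n] by simp
qed (simp_all add: hcomp_add distrib_left)

text \<open>Multiplication by F carries the component of G in degree n to that of F G in degree d +
  n, and F G lives in degree e only. This keeps fractions of degree zero when F is split off a
  numerator.\<close>

lemma homog_cofactor:
  assumes F: "homog d F" "F \<noteq> 0" and FG: "homog e (F * G)" "G \<noteq> 0"
  shows "\<exists>n. e = d + n \<and> homog n G"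
proof -
  have *: "d + n = e" if "hcomp n G \<noteq> 0" for n
    using that F(2) hcomp_homog[OF FG(1), of "d + n"] hcomp_mult[OF F(1), of n G]
    by (auto split: if_splits)
  obtain N where N: "G = (\<Sum>n<N. hcomp n G)" using sum_hcomp by blast
  then obtain n where n: "hcomp n G \<noteq> 0" using FG(2) by (metis sum.neutral)
  have "mdeg m = n" if "m \<in> Poly_Mapping.keys G" for m
  proof -
    have "hcomp (mdeg m) G \<noteq> 0"
      using that lookup_hcomp[of "mdeg m" G m] by (auto simp: in_keys_iff)
    from *[OF this] *[OF n] show ?thesis by simp
  qed
  with *[OF n] show ?thesis by (auto simp: homog_def)
qed

section \<open>Points of projective space\<close>

lemma P3_ideal: "q \<in> P3 \<Longrightarrow> idl UNIV q"
  using ideal_iff_idl[OF subring_set_UNIV, of q] by (simp add: P3_def primeideal.axioms(1))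

lemma P3_one: "q \<in> P3 \<Longrightarrow> 1 \<notin> q"
  using idl_one[OF subring_set_UNIV P3_ideal, of q] primeideal.I_notcarr[of q cpoly_ring]
  by (auto simp: P3_def)

lemma P3_prime: "q \<in> P3 \<Longrightarrow> a * b \<in> q \<longleftrightarrow> a \<in> q \<or> b \<in> q"
proof -
  assume q: "q \<in> P3"
  then have "a * b \<in> q \<Longrightarrow> a \<in> q \<or> b \<in> q"
    using primeideal.I_prime[of q cpoly_ring a b] by (simp add: P3_def)
  then show ?thesis
    using idl_mult[OF P3_ideal[OF q]] idl_mult'[OF P3_ideal[OF q]] by blast
qed

lemma P3_power: "q \<in> P3 \<Longrightarrow> a ^ n \<in> q \<Longrightarrow> a \<in> q"
  by (induction n) (auto simp: P3_prime P3_one)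

lemma P3_coord: "q \<in> P3 \<Longrightarrow> \<exists>i. coord i \<notin> q"
  by (auto simp: P3_def)

lemma P3_zero: "q \<in> P3 \<Longrightarrow> 0 \<in> q"
  by (rule idl_zero[OF P3_ideal])

text \<open>Evaluation in a chart or on a line is simple only for homogeneous polynomials. As these
  generate a point of \<open>P3\<close>, inclusions are checked on them.\<close>

lemma homog_ideal_subset:
  assumes "q \<in> P3" "idl UNIV L" "\<And>F d. F \<in> q \<Longrightarrow> homog d F \<Longrightarrow> F \<in> L"
  shows "q \<subseteq> L"
proof -
  have "q = Idl\<^bsub>cpoly_ring\<^esub> {F \<in> q. \<exists>d. homog d F}"
    using assms(1) by (simp add: P3_def homog_ideal_def)
  also have "\<dots> \<subseteq> L"
    using assms(2,3) by (auto simp: genideal_def ideal_iff_idl)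
  finally show ?thesis .
qed

text \<open>A closed set consists of the primes containing a fixed set of polynomials, so with p it
  contains every larger point of \<open>P3\<close>.\<close>

lemma closed_point_maximal:
  assumes "closed_point p" "q \<in> P3" "p \<subseteq> q"
  shows "q = p"
proof -
  from assms(1) obtain A where "{p} = {q \<in> P3. A \<subseteq> q}"
    by (auto simp: closed_point_def zclosed_def)
  with assms show ?thesis by blast
qed

lemma closed_point_P3: "closed_point p \<Longrightarrow> p \<in> P3"
  by (simp add: closed_point_def)

lemma closure_dim_closed_point:
  assumes "closed_point p"
  shows "closure_dim p = 0"
proof -
  have "n = 0" if "\<forall>i\<le>n. f i \<in> P3 \<and> p \<subseteq> f i" "\<forall>i<n. f i \<subset> f (Suc i)"
    for n and f :: "nat \<Rightarrow> point"
  proof (rule ccontr)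
    assume "n \<noteq> 0"
    then have "f 0 = p" "f 1 = p" "f 0 \<subset> f 1"
      using that closed_point_maximal[OF assms] by auto
    then show False by simp
  qed
  then have "closure_dim p \<le> 0"
    unfolding closure_dim_def by (intro SUP_least) (auto simp: zero_enat_def)
  then show ?thesis by simp
qed

section \<open>Affine charts and dehomogenisation\<close>

abbreviation emb :: "cpoly \<Rightarrow> ratfun" where
  "emb F \<equiv> Fract F 1"

abbreviation scal :: "complex \<Rightarrow> ratfun" where
  "scal c \<equiv> emb (const c)"

text \<open>x_j / x_i, the j-th coordinate in the chart x_i \<noteq> 0. Thus
  \<open>ev scal (aff i) F\<close> is F dehomogenised at x_i, as a rational function of degree
  zero.\<close>

abbreviation aff :: "4 \<Rightarrow> 4 \<Rightarrow> ratfun" where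
  "aff i j \<equiv> Fract (coord j) (coord i)"

lemma emb_add: "emb (F + G) = emb F + emb G"
  and emb_mult: "emb (F * G) = emb F * emb G"
  and emb_eq: "emb F = emb G \<longleftrightarrow> F = G"
  and emb_1: "emb 1 = 1"
  and emb_0: "emb 0 = 0"
  by (simp_all add: eq_fract fract_collapse)

lemma emb_power: "emb (F ^ n) = emb F ^ n"
  by (induction n) (simp_all add: emb_1 emb_mult del: mult_fract)

lemma emb_eq_0: "emb F = 0 \<longleftrightarrow> F = 0"
  using emb_eq[of F 0] by (simp add: emb_0)

lemma Fract_eq_divide: "Fract a b = emb a / emb b"
  by simp

lemma scalar_hom_scal: "scalar_hom scal"
  by (simp add: scalar_hom_def single_add mult_single fract_collapse)

lemma coord_nonzero: "coord i \<noteq> 0"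
proof
  assume "coord i = 0"
  then have "Poly_Mapping.lookup (coord i) (Poly_Mapping.single i 1) = 0" by simp
  then show False by (simp add: coord_def)
qed

lemma ev_emb_coord: "ev scal (\<lambda>j. emb (coord j)) F = emb F"
  by (induction F rule: cpoly_alg_induct)
    (simp_all add: ev_const ev_coord ev_add ev_mult scalar_hom_scal)

lemma ev_aff_homog:
  assumes "homog d F"
  shows "emb (coord i) ^ d * ev scal (aff i) F = emb F"
proof -
  have "emb (coord j) = emb (coord i) * aff i j" for j
    using coord_nonzero by (simp add: eq_fract)
  then have "emb F = ev scal (\<lambda>j. emb (coord i) * aff i j) F"
    by (metis (lifting) ev_emb_coord ext)
  then show ?thesis
    by (simp add: ev_homog_scale[OF scalar_hom_scal assms] del: mult_fract)
qed

lemma ev_aff_eq_Fract: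
  assumes "homog d F"
  shows "ev scal (aff i) F = Fract F (coord i ^ d)"
proof -
  have "emb (coord i) ^ d \<noteq> 0" using coord_nonzero by (simp add: emb_eq_0)
  then have "ev scal (aff i) F = emb F / emb (coord i) ^ d"
    using ev_aff_homog[OF assms, of i] by (simp add: nonzero_eq_divide_eq mult.commute)
  then show ?thesis by (simp only: Fract_eq_divide[of F "coord i ^ d"] emb_power)
qed

text \<open>An inhomogeneous F has no single degree, so only some power of x_i is claimed to clear
  the denominators. This allows multiplication by arbitrary polynomials in the ideal of the next
  lemma.\<close>

lemma ev_aff_denominator: "\<exists>N b. emb (coord i) ^ N * ev scal (aff i) F = emb b"
proof (induction F rule: cpoly_alg_induct)
  case (const c)
  show ?case by (rule exI[of _ 0]) (auto simp: ev_const scalar_hom_scal)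
next
  case (coord j)
  show ?case using ev_aff_homog[OF homog_coord] by blast
next
  case (add F G)
  then obtain M a N b where *: "emb (coord i) ^ M * ev scal (aff i) F = emb a"
    "emb (coord i) ^ N * ev scal (aff i) G = emb b" by blast
  have "emb (coord i) ^ (M + N) * ev scal (aff i) (F + G)
    = emb (coord i) ^ N * (emb (coord i) ^ M * ev scal (aff i) F)
      + emb (coord i) ^ M * (emb (coord i) ^ N * ev scal (aff i) G)"
    by (simp add: ev_add scalar_hom_scal power_add distrib_left mult_ac del: mult_fract)
  also have "\<dots> = emb (coord i ^ N * a + coord i ^ M * b)"
    unfolding * by (simp only: emb_power emb_mult emb_add)
  finally show ?case by blast
next
  case (mult F G)
  then obtain M a N b where *: "emb (coord i) ^ M * ev scal (aff i) F = emb a"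
    "emb (coord i) ^ N * ev scal (aff i) G = emb b" by blast
  have "emb (coord i) ^ (M + N) * ev scal (aff i) (F * G)
    = (emb (coord i) ^ M * ev scal (aff i) F) * (emb (coord i) ^ N * ev scal (aff i) G)"
    by (simp add: ev_mult scalar_hom_scal power_add mult_ac del: mult_fract)
  also have "\<dots> = emb (a * b)" unfolding * by (simp only: emb_mult)
  finally show ?case by blast
qed

text \<open>The affine chart \<open>x\<^sub>i = 1\<close> meets the zero set of \<open>p\<close>.\<close>

lemma dehomogenization_proper:
  assumes p: "p \<in> P3" and i: "coord i \<notin> p"
  shows "1 - r * (coord i - 1) \<notin> p"
proof
  assume F: "1 - r * (coord i - 1) \<in> p"
  note pi = P3_ideal[OF p]
  \<comment> \<open>The polynomials whose dehomogenisation lies in p after clearing powers of x_i.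
    They form an ideal containing p, but 1 - r (x_i - 1) dehomogenises to 1, so a power of x_i would
    lie in p.\<close>
  define L where "L = {F. \<exists>N. \<exists>a\<in>p. emb (coord i) ^ N * ev scal (aff i) F = emb a}"
  have L_iff: "F \<in> L \<longleftrightarrow> (\<exists>N. \<exists>a\<in>p. emb (coord i) ^ N * ev scal (aff i) F = emb a)" for F
    by (simp add: L_def)
  have "idl UNIV L"
    unfolding idl_def
  proof (intro conjI ballI)
    show "0 \<in> L" unfolding L_iff using P3_zero[OF p]
      by (intro exI[of _ 0] bexI[of _ 0]) (simp_all add: ev_zero emb_0)
  next
    fix F G assume "F \<in> L" "G \<in> L"
    then obtain M a N b where *: "emb (coord i) ^ M * ev scal (aff i) F = emb a"
      "emb (coord i) ^ N * ev scal (aff i) G = emb b" and ab: "a \<in> p" "b \<in> p"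
      unfolding L_iff by blast
    have "emb (coord i) ^ (M + N) * ev scal (aff i) (F + G)
      = emb (coord i) ^ N * (emb (coord i) ^ M * ev scal (aff i) F)
        + emb (coord i) ^ M * (emb (coord i) ^ N * ev scal (aff i) G)"
      by (simp add: ev_add scalar_hom_scal power_add distrib_left mult_ac del: mult_fract)
    also have "\<dots> = emb (coord i ^ N * a + coord i ^ M * b)"
      unfolding * by (simp only: emb_power emb_mult emb_add)
    finally show "F + G \<in> L" unfolding L_iff
      using idl_add[OF pi idl_mult[OF pi UNIV_I ab(1)] idl_mult[OF pi UNIV_I ab(2)]] by blast
  next
    fix G F assume "F \<in> L"
    then obtain M a N b where *: "emb (coord i) ^ M * ev scal (aff i) F = emb a"
      "emb (coord i) ^ N * ev scal (aff i) G = emb b" and a: "a \<in> p"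
      using ev_aff_denominator[of i G] unfolding L_iff by blast
    have "emb (coord i) ^ (M + N) * ev scal (aff i) (G * F)
      = (emb (coord i) ^ N * ev scal (aff i) G) * (emb (coord i) ^ M * ev scal (aff i) F)"
      by (simp add: ev_mult scalar_hom_scal power_add mult_ac del: mult_fract)
    also have "\<dots> = emb (b * a)" unfolding * by (simp only: emb_mult)
    finally show "G * F \<in> L" unfolding L_iff using idl_mult[OF pi UNIV_I a] by blast
  qed simp
  moreover have "F \<in> L" if "F \<in> p" "homog d F" for F d
    using that ev_aff_homog unfolding L_iff by blast
  ultimately have "p \<subseteq> L" by (rule homog_ideal_subset[OF p])
  with F have "1 - r * (coord i - 1) \<in> L" by blast
  moreover have "ev scal (aff i) (1 - r * (coord i - 1)) = 1"
  proof -
    have "aff i i = 1" using coord_nonzero by (simp add: One_fract_def eq_fract)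
    then show ?thesis by (simp add: ev_diff ev_mult ev_one ev_coord scalar_hom_scal)
  qed
  ultimately obtain N a where "a \<in> p" "emb (coord i) ^ N = emb a"
    unfolding L_iff by (metis mult.right_neutral)
  then have "coord i ^ N \<in> p" by (simp only: emb_power[symmetric] emb_eq)
  with i P3_power[OF p] show False by blast
qed

section \<open>Closed points as lines through the origin\<close>

lemma scalar_hom_pconst: "scalar_hom (\<lambda>a :: complex. [:a:])"
  by (simp add: scalar_hom_def one_pCons)

lemma ev_line_homog:
  assumes "homog d F"
  shows "ev (\<lambda>a. [:a:]) (\<lambda>j. [:0, c j:]) F = monom (ev (\<lambda>c. c) c F) d"
proof -
  have "ev (\<lambda>a. [:a:]) (\<lambda>j. [:0, c j:]) F = ev (\<lambda>a. [:a:]) (\<lambda>j. [:0, 1:] * [:c j:]) F" by simp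
  also have "\<dots> = [:0, 1:] ^ d * ev (\<lambda>a. [:a:]) (\<lambda>j. [:c j:]) F"
    by (rule ev_homog_scale[OF scalar_hom_pconst assms])
  also have "ev (\<lambda>a. [:a:]) (\<lambda>j. [:c j:]) F = [:ev (\<lambda>c. c) c F:]"
    by (induction F rule: cpoly_alg_induct)
      (simp_all add: ev_const ev_coord ev_add ev_mult scalar_hom_pconst scalar_hom_id)
  finally show ?thesis by (simp add: monom_altdef mult.commute)
qed

text \<open>On the line \<lambda> \<mapsto> \<lambda> c the component of degree n becomes a multiple
  of \<lambda>^n, so components of different degrees cannot cancel. This makes the ideal of the line
  homogeneous.\<close>

lemma ev_line_eq_0:
  "ev (\<lambda>a. [:a:]) (\<lambda>j. [:0, c j:]) F = 0 \<Longrightarrow>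
   ev (\<lambda>a. [:a:]) (\<lambda>j. [:0, c j:]) (hcomp n F) = 0"
  (is "?e F = 0 \<Longrightarrow> _")
proof -
  note h = scalar_hom_pconst and c = ev_line_homog[where c = c]
  assume 0: "?e F = 0"
  obtain N where N: "F = (\<Sum>n<N. hcomp n F)" using sum_hcomp by blast
  have "?e F = (\<Sum>n<N. monom (ev (\<lambda>c. c) c (hcomp n F)) n)"
    by (subst N) (simp add: ev_sum[OF h] c[OF homog_hcomp])
  with 0 have *: "coeff (\<Sum>n<N. monom (ev (\<lambda>c. c) c (hcomp n F)) n) n = 0" by simp
  show ?thesis
  proof (cases "n < N")
    case True
    with * have "ev (\<lambda>c. c) c (hcomp n F) = 0" by (simp add: coeff_sum)
    then show ?thesis by (simp add: c[OF homog_hcomp])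
  next
    case False
    have "hcomp n F = (\<Sum>k<N. hcomp n (hcomp k F))"
      by (subst N) (induction N, simp_all add: hcomp_add)
    also have "\<dots> = 0" using False by (intro sum.neutral) (auto simp: hcomp_homog[OF homog_hcomp])
    finally show ?thesis by (simp add: ev_zero)
  qed
qed

text \<open>The Nullstellensatz gives a zero c of p. The polynomials vanishing on the line through c
  form a point of \<open>P3\<close> above p, which is p because p is closed; and x_j - c_j x_i
  vanishes on that line.\<close>

theorem closed_point_coords:
  assumes p: "closed_point p" and i: "coord i \<notin> p"
  shows "\<exists>c. \<forall>j. coord j - const (c j) * coord i \<in> p"
proof -
  note p3 = closed_point_P3[OF p]
  \<comment> \<open>Adding x_i - 1 keeps the zero away from the origin, which is a zero of p but
    defines no point of \<open>P3\<close>.\<close>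
  define I where "I = {y. \<exists>r\<in>UNIV. y - r * (coord i - 1) \<in> p}"
  have I: "idl UNIV I" unfolding I_def by (intro idl_adjoin P3_ideal p3) auto
  have "1 \<notin> I" using dehomogenization_proper[OF p3 i] by (auto simp: I_def)
  from weak_nullstellensatz[OF I this] obtain c J where J: "I \<subseteq> J" "idl UNIV J" "1 \<notin> J"
    "\<And>t. coord t - const (c t) \<in> J" by blast
  have zero: "ev (\<lambda>c. c) c F = 0" if "F \<in> I" for F
    using zero_of_proper_ideal[OF J(2-4)] that J(1) by blast
  have "coord i - 1 \<in> I" using P3_zero[OF p3] by (auto simp: I_def intro: exI[of _ 1])
  from zero[OF this] have ci: "c i = 1"
    by (simp add: ev_diff ev_coord ev_one scalar_hom_id)
  note h = scalar_hom_pconst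
  \<comment> \<open>Restriction to the line \<lambda> \<mapsto> \<lambda> c, with values in the
    domain C[\<lambda>]; its kernel \<open>Q\<close> is therefore prime.\<close>
  define e where "e = ev (\<lambda>a. [:a:]) (\<lambda>j. [:0, c j:])"
  define Q where "Q = {F. e F = 0}"
  have Qi: "idl UNIV Q" by (auto simp: idl_def Q_def e_def ev_zero ev_add ev_mult h)
  have "Q \<in> P3"
    unfolding P3_def
  proof (intro CollectI conjI)
    show "primeideal Q cpoly_ring"
    proof (rule primeidealI)
      show "ideal Q cpoly_ring" using Qi by (simp add: ideal_iff_idl)
      show "cring cpoly_ring" by (rule cring_ring_on) simp
      have "1 \<notin> Q" by (simp add: Q_def e_def ev_one h)
      then show "carrier cpoly_ring \<noteq> Q" by auto
    qed (auto simp: Q_def e_def ev_mult h)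
    show "homog_ideal Q"
      unfolding homog_ideal_def
    proof
      show "Q \<subseteq> Idl\<^bsub>cpoly_ring\<^esub> {F \<in> Q. \<exists>d. homog d F}"
        unfolding genideal_def
      proof (intro subsetI InterI, elim CollectE conjE)
        fix F I assume F: "F \<in> Q" and "ideal I cpoly_ring" and sub: "{F \<in> Q. \<exists>d. homog d F} \<subseteq> I"
        then have I: "idl UNIV I" by (simp add: ideal_iff_idl)
        obtain N where N: "F = (\<Sum>n<N. hcomp n F)" using sum_hcomp by blast
        have *: "hcomp n F \<in> I" for n
          using F sub homog_hcomp[of n F] ev_line_eq_0[of c F n] by (auto simp: Q_def e_def)
        have "(\<Sum>n<N. hcomp n F) \<in> I"
          by (induction N) (auto intro: * idl_zero[OF I] idl_add[OF I])
        then show "F \<in> I" using N by simp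
      qed
      show "Idl\<^bsub>cpoly_ring\<^esub> {F \<in> Q. \<exists>d. homog d F} \<subseteq> Q"
        using Qi unfolding genideal_def by (intro Inter_lower) (auto simp: ideal_iff_idl)
    qed
    have "coord i \<notin> Q" using ci by (simp add: Q_def e_def ev_coord h)
    then show "\<not> range coord \<subseteq> Q" by blast
  qed
  moreover have "p \<subseteq> Q"
  proof (rule homog_ideal_subset[OF p3 Qi])
    fix F d assume F: "F \<in> p" and hom: "homog d F"
    have "F \<in> I" using F by (auto simp: I_def intro: exI[of _ 0])
    then show "F \<in> Q" using zero ev_line_homog[OF hom, of c] by (simp add: Q_def e_def)
  qed
  ultimately have "Q = p" by (rule closed_point_maximal[OF p])
  moreover have "coord j - const (c j) * coord i \<in> Q" for j
    using ci by (simp add: Q_def e_def ev_diff ev_mult ev_const ev_coord h)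
  ultimately show ?thesis by blast
qed

section \<open>Local rings\<close>

lemma Fract_in_local_maxD:
  assumes q: "q \<in> P3" and b: "b \<notin> q"
  assumes "Fract a b \<in> local_max q"
  shows "a \<in> q"
proof -
  from assms(3) obtain a' b' where *: "Fract a b = Fract a' b'" "b' \<notin> q" "a' \<in> q"
    by (auto simp: local_max_def)
  have "b \<noteq> 0" "b' \<noteq> 0" using b *(2) P3_zero[OF q] by auto
  with * have "a * b' = a' * b" by (simp add: eq_fract)
  then have "a * b' \<in> q" using *(3) P3_prime[OF q, of a' b] by simp
  with *(2) show "a \<in> q" using P3_prime[OF q] by blast
qed

lemma local_setI: "homog d a \<Longrightarrow> homog d b \<Longrightarrow> b \<notin> q \<Longrightarrow> Fract a b \<in> local_set q"
  and local_maxI: "homog d a \<Longrightarrow> homog d b \<Longrightarrow> b \<notin> q \<Longrightarrow> a \<in> q \<Longrightarrow> Fract a b \<in> local_max q"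
  by (auto simp: local_set_def local_max_def)

lemma local_setE:
  assumes "f \<in> local_set q"
  obtains a b d where "f = Fract a b" "homog d a" "homog d b" "b \<notin> q"
  using assms by (auto simp: local_set_def)

lemma local_maxE:
  assumes "f \<in> local_max q"
  obtains a b d where "f = Fract a b" "homog d a" "homog d b" "b \<notin> q" "a \<in> q"
  using assms by (auto simp: local_max_def)

lemma subring_local_set:
  assumes q: "q \<in> P3"
  shows "subring_set (local_set q)"
  unfolding subring_set_def
proof (intro conjI ballI)
  show "0 \<in> local_set q" "1 \<in> local_set q"
    using local_setI[of 0 0 1 q] local_setI[of 0 1 1 q] P3_one[OF q]
    by (simp_all add: fract_collapse)
next
  fix f g assume "f \<in> local_set q" "g \<in> local_set q"
  then obtain a b d a' b' d' where *: "f = Fract a b" "g = Fract a' b'" "homog d a" "homog d b" "b \<notin> q"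
    "homog d' a'" "homog d' b'" "b' \<notin> q"
    by (elim local_setE)
  have bb: "b * b' \<notin> q" using * P3_prime[OF q] by blast
  have "b \<noteq> 0" "b' \<noteq> 0" using * P3_zero[OF q] by auto
  then have "f + g = Fract (a * b' + b * a') (b * b')" by (simp add: * mult.commute)
  then show "f + g \<in> local_set q"
    using * bb by (auto intro!: local_setI homog_add homog_mult)
  have "f * g = Fract (a * a') (b * b')" by (simp add: *)
  then show "f * g \<in> local_set q"
    using * bb by (auto intro!: local_setI homog_mult)
next
  fix f assume "f \<in> local_set q"
  then show "- f \<in> local_set q"
    by (elim local_setE) (auto intro!: local_setI homog_uminus)
qed

lemma idl_local_max:
  assumes q: "q \<in> P3"
  shows "idl (local_set q) (local_max q)"
  unfolding idl_def
proof (intro conjI ballI)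
  show "local_max q \<subseteq> local_set q" by (auto simp: local_set_def local_max_def)
  show "0 \<in> local_max q"
    using local_maxI[of 0 0 1 q] P3_one[OF q] P3_zero[OF q] by (simp add: fract_collapse)
next
  fix f g assume "f \<in> local_max q" "g \<in> local_max q"
  then obtain a b d a' b' d' where *: "f = Fract a b" "g = Fract a' b'" "homog d a" "homog d b" "b \<notin> q"
    "homog d' a'" "homog d' b'" "b' \<notin> q" "a \<in> q" "a' \<in> q"
    by (elim local_maxE)
  have bb: "b * b' \<notin> q" using * P3_prime[OF q] by blast
  have "b \<noteq> 0" "b' \<noteq> 0" using * P3_zero[OF q] by auto
  then have "f + g = Fract (a * b' + b * a') (b * b')" by (simp add: * mult.commute)
  moreover have "a * b' + b * a' \<in> q"
    using * P3_prime[OF q] by (intro idl_add[OF P3_ideal[OF q]]) auto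
  ultimately show "f + g \<in> local_max q"
    using * bb by (auto intro!: local_maxI homog_add homog_mult)
next
  fix r f assume "r \<in> local_set q" "f \<in> local_max q"
  then obtain a b d a' b' d' where *: "r = Fract a b" "f = Fract a' b'" "homog d a" "homog d b" "b \<notin> q"
    "homog d' a'" "homog d' b'" "b' \<notin> q" "a' \<in> q"
    by (elim local_setE local_maxE)
  then have "b * b' \<notin> q" "a * a' \<in> q" using P3_prime[OF q] by blast+
  then show "r * f \<in> local_max q"
    using * by (auto intro!: local_maxI homog_mult)
qed

lemma one_notin_local_max:
  assumes "q \<in> P3"
  shows "1 \<notin> local_max q"
  using Fract_in_local_maxD[OF assms P3_one[OF assms], of 1] P3_one[OF assms]
  by (auto simp: fract_collapse)

lemma local_set_unit:
  assumes q: "q \<in> P3" and f: "f \<in> local_set q" "f \<notin> local_max q"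
  shows "\<exists>g\<in>local_set q. f * g = 1"
proof -
  obtain a b d where *: "f = Fract a b" "homog d a" "homog d b" "b \<notin> q"
    using f(1) by (elim local_setE)
  then have "a \<notin> q" using f(2) local_maxI by blast
  moreover from this have "a \<noteq> 0" "b \<noteq> 0" using * P3_zero[OF q] by auto
  then have "f * Fract b a = 1" by (simp add: * One_fract_def eq_fract)
  ultimately show ?thesis using * by (blast intro: local_setI)
qed

lemma scal_in_local_set: "q \<in> P3 \<Longrightarrow> scal c \<in> local_set q"
  using P3_one by (auto intro: local_setI[of 0])

lemma scal_notin_local_max:
  assumes "q \<in> P3" "scal c \<in> local_max q"
  shows "c = 0"
proof (rule ccontr)
  assume "c \<noteq> 0"
  then have "scal (inverse c) * scal c = 1"
    by (simp add: mult_single One_fract_def)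
  then have "1 \<in> local_max q"
    using idl_mult[OF idl_local_max[OF assms(1)] scal_in_local_set[OF assms(1)] assms(2), of "inverse c"]
    by simp
  with one_notin_local_max assms show False by blast
qed

lemma aff_in_local_set: "coord i \<notin> q \<Longrightarrow> aff i j \<in> local_set q"
  by (rule local_setI[OF homog_coord homog_coord])

lemma proper_ideal_in_local_max:
  assumes q: "q \<in> P3" and I: "idl (local_set q) I" and "I \<noteq> local_set q"
  shows "I \<subseteq> local_max q"
proof
  fix f assume f: "f \<in> I"
  show "f \<in> local_max q"
  proof (rule ccontr)
    assume "f \<notin> local_max q"
    then obtain g where "g \<in> local_set q" "f * g = 1"
      using local_set_unit[OF q idl_subset[OF I f]] by blast
    with idl_mult'[OF I _ f] have "1 \<in> I" by metis
    with idl_one[OF subring_local_set[OF q] I] assms(3) show False by blast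
  qed
qed


section \<open>Closed points of a smooth surface\<close>

text \<open>The index runs over a whole finite type, so that the functions x_j / x_i - c_j can be
  summed over all four j; the one with j = i is 0.\<close>

definition lin_comb :: "'a::comm_ring_1 set \<Rightarrow> ('b::finite \<Rightarrow> 'a) \<Rightarrow> 'a set" where
  "lin_comb R t = {\<Sum>j\<in>UNIV. r j * t j | r. range r \<subseteq> R}"

lemma idl_lin_comb:
  assumes R: "subring_set R" and t: "range t \<subseteq> R"
  shows "idl R (lin_comb R t)"
  unfolding idl_def
proof (intro conjI ballI)
  have sum_in: "(\<Sum>j\<in>A. f j) \<in> R" if "\<And>j. f j \<in> R" for f :: "'b \<Rightarrow> 'a" and A
    using R that by (induction A rule: infinite_finite_induct) (auto simp: subring_set_def)
  show "lin_comb R t \<subseteq> R"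
    using t R unfolding lin_comb_def
    by (auto intro!: sum_in simp: subring_set_def image_subset_iff)
  show "0 \<in> lin_comb R t"
    using R unfolding lin_comb_def
    by (auto simp: subring_set_def intro!: exI[of _ "\<lambda>_. 0"])
next
  fix f g assume "f \<in> lin_comb R t" "g \<in> lin_comb R t"
  then obtain r s where "f = (\<Sum>j\<in>UNIV. r j * t j)" "g = (\<Sum>j\<in>UNIV. s j * t j)" "range r \<subseteq> R" "range s \<subseteq> R"
    by (auto simp: lin_comb_def)
  then show "f + g \<in> lin_comb R t"
    using R unfolding lin_comb_def
    by (intro CollectI exI[of _ "\<lambda>j. r j + s j"])
      (auto simp: sum.distrib distrib_right subring_set_def image_subset_iff)
next
  fix a f assume "a \<in> R" "f \<in> lin_comb R t"
  then obtain r where "f = (\<Sum>j\<in>UNIV. r j * t j)" "range r \<subseteq> R"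
    by (auto simp: lin_comb_def)
  then show "a * f \<in> lin_comb R t"
    using R \<open>a \<in> R\<close> unfolding lin_comb_def
    by (intro CollectI exI[of _ "\<lambda>j. a * r j"])
      (auto simp: sum_distrib_left mult.assoc subring_set_def image_subset_iff)
qed

lemma lin_comb_gen:
  assumes "subring_set R"
  shows "t k \<in> lin_comb R t"
  unfolding lin_comb_def
proof (intro CollectI exI[of _ "\<lambda>j. if j = k then 1 else 0"] conjI)
  have "(\<Sum>j\<in>UNIV. (if j = k then 1 else 0) * t j) = (\<Sum>j\<in>UNIV. if j = k then t j else 0)"
    by (rule sum.cong) auto
  then show "t k = (\<Sum>j\<in>UNIV. (if j = k then 1 else 0) * t j)" by simp
qed (use assms in \<open>auto simp: subring_set_def\<close>)

lemma closed_point_chart: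
  assumes p: "closed_point p" and i: "coord i \<notin> p"
  obtains c where "c i = 1" "\<And>j. aff i j - scal (c j) \<in> local_max p"
proof -
  note p3 = closed_point_P3[OF p]
  obtain c where c: "\<And>j. coord j - const (c j) * coord i \<in> p"
    using closed_point_coords[OF p i] by blast
  have "aff i j - scal (c j) = Fract (coord j - const (c j) * coord i) (coord i)" for j
    using coord_nonzero by (simp add: mult.commute)
  moreover have "homog 1 (coord j - const (c j) * coord i)" for j
    using homog_mult[OF homog_const homog_coord, of "c j" i] by (intro homog_diff homog_coord) simp
  ultimately have m: "aff i j - scal (c j) \<in> local_max p" for j
    using i c by (auto intro: local_maxI[OF _ homog_coord])
  moreover have "c i = 1"
  proof -
    have "aff i i - scal (c i) = scal (1 - c i)"
      using coord_nonzero by (simp add: One_fract_def single_diff eq_fract left_diff_distrib)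
    with m[of i] have "scal (1 - c i) \<in> local_max p" by simp
    from scal_notin_local_max[OF p3 this] show ?thesis by simp
  qed
  ultimately show ?thesis using that by blast
qed

text \<open>\<open>Fract F (coord i ^ d)\<close> is F evaluated at the chart coordinates, which are
  congruent to c modulo I. The ideal is left general: it is the maximal ideal for the residue field,
  and the span of the x_j / x_i - c_j when that span is identified with the maximal ideal.\<close>

lemma local_value:
  assumes p: "p \<in> P3" and i: "coord i \<notin> p" and I: "idl (local_set p) I"
    and c: "\<And>j. aff i j - scal (c j) \<in> I"
    and F: "homog d F"
  shows "Fract F (coord i ^ d) - scal (ev (\<lambda>c. c) c F) \<in> I"
proof -
  have "ev scal (aff i) F - scal (ev (\<lambda>c. c) c F) \<in> I"
    by (rule ev_cong_ideal[OF subring_local_set[OF p] I scalar_hom_scal])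
      (use i c p in \<open>auto intro: aff_in_local_set scal_in_local_set\<close>)
  then show ?thesis by (simp only: ev_aff_eq_Fract[OF F])
qed

text \<open>With x = x_i^d, a fraction a/b is the quotient of a/x by b/x, whose residues are a(c)
  and b(c); and b(c) = 0 would put b into p.\<close>

lemma residue_field:
  assumes p: "closed_point p" and f: "f \<in> local_set p"
  shows "\<exists>c. f - scal c \<in> local_max p"
proof -
  note p3 = closed_point_P3[OF p] and m = idl_local_max[OF closed_point_P3[OF p]]
    and R = subring_local_set[OF closed_point_P3[OF p]]
  obtain i where i: "coord i \<notin> p" using P3_coord[OF p3] by blast
  obtain c where c: "\<And>j. aff i j - scal (c j) \<in> local_max p"
    using closed_point_chart[OF p i] by metis
  obtain a b d where ab: "f = Fract a b" "homog d a" "homog d b" "b \<notin> p"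
    using f by (elim local_setE)
  define x where "x = coord i ^ d"
  have x: "x \<notin> p" "homog d x" using i P3_power[OF p3] homog_coord_power by (auto simp: x_def)
  have nz: "x \<noteq> 0" "b \<noteq> 0" using x ab P3_zero[OF p3] by auto
  define u v where "u = ev (\<lambda>c. c) c a" and "v = ev (\<lambda>c. c) c b"
  have a: "Fract a x - scal u \<in> local_max p" and b: "Fract b x - scal v \<in> local_max p"
    unfolding u_def v_def x_def using local_value[OF p3 i m c] ab by blast+
  have "v \<noteq> 0"
  proof
    assume "v = 0"
    with b have "Fract b x \<in> local_max p" by (simp add: fract_collapse)
    with Fract_in_local_maxD[OF p3 x(1)] ab(4) show False by blast
  qed
  have "f - scal (u / v) = Fract x b * ((Fract a x - scal u) - scal (u / v) * (Fract b x - scal v))"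
  proof -
    have "scal (u / v) * scal v = scal u" using \<open>v \<noteq> 0\<close> by (simp add: mult_single)
    moreover have "Fract x b * Fract a x = f" "Fract x b * Fract b x = 1"
      using nz by (simp_all add: ab One_fract_def eq_fract)
    ultimately show ?thesis by (simp add: algebra_simps del: mult_fract)
  qed
  also have "\<dots> \<in> local_max p"
    using ab x by (intro idl_mult[OF m] idl_diff[OF R m] a b scal_in_local_set p3) (auto intro: local_setI)
  finally show ?thesis ..
qed

text \<open>The generators are t_j = x_j / x_i - c_j. If a/b lies in the maximal ideal, then a/x_i^d
  is congruent to a(c) modulo their span; so a(c) is a constant in the maximal ideal, hence
  0.\<close>

lemma local_max_generators:
  assumes p: "closed_point p" and i: "coord i \<notin> p"
  obtains t where "t i = 0" "\<And>j. t j \<in> local_max p" "local_max p = lin_comb (local_set p) t"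
proof -
  note p3 = closed_point_P3[OF p] and m = idl_local_max[OF closed_point_P3[OF p]]
    and R = subring_local_set[OF closed_point_P3[OF p]]
  obtain c where c: "c i = 1" "\<And>j. aff i j - scal (c j) \<in> local_max p"
    using closed_point_chart[OF p i] by metis
  define t where "t j = aff i j - scal (c j)" for j
  have tR: "range t \<subseteq> local_set p" using idl_subset[OF m c(2)] by (auto simp: t_def)
  note I = idl_lin_comb[OF R tR]
  have tI: "aff i j - scal (c j) \<in> lin_comb (local_set p) t" for j
    using lin_comb_gen[OF R, of t j] by (simp add: t_def)
  have sub: "lin_comb (local_set p) t \<subseteq> local_max p"
  proof
    fix f assume "f \<in> lin_comb (local_set p) t"
    then obtain r where r: "f = (\<Sum>j\<in>UNIV. r j * t j)" "range r \<subseteq> local_set p"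
      by (auto simp: lin_comb_def)
    have "(\<Sum>j\<in>A. r j * t j) \<in> local_max p" for A
      using r(2) c(2)
      by (induction A rule: infinite_finite_induct)
        (auto simp: t_def intro!: idl_zero[OF m] idl_add[OF m] idl_mult[OF m])
    with r show "f \<in> local_max p" by simp
  qed
  have "f \<in> lin_comb (local_set p) t" if f: "f \<in> local_max p" for f
  proof -
    obtain a b d where ab: "f = Fract a b" "homog d a" "homog d b" "b \<notin> p" "a \<in> p"
      using f by (elim local_maxE)
    define x where "x = coord i ^ d"
    have x: "x \<notin> p" "homog d x" using i P3_power[OF p3] homog_coord_power by (auto simp: x_def)
    have nz: "x \<noteq> 0" "b \<noteq> 0" using x ab P3_zero[OF p3] by auto
    have a: "Fract a x - scal (ev (\<lambda>c. c) c a) \<in> lin_comb (local_set p) t"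
      unfolding x_def by (rule local_value[OF p3 i I tI ab(2)])
    have ax: "Fract a x \<in> local_max p" using ab x by (auto intro: local_maxI)
    from idl_diff[OF R m ax subsetD[OF sub a]] have "scal (ev (\<lambda>c. c) c a) \<in> local_max p" by simp
    then have "ev (\<lambda>c. c) c a = 0" by (rule scal_notin_local_max[OF p3])
    with a have "Fract a x \<in> lin_comb (local_set p) t" by (simp add: fract_collapse)
    from idl_mult[OF I _ this, of "Fract x b"] show ?thesis
      using nz ab x by (simp add: local_setI mult_fract_cancel mult.commute[of _ x])
  qed
  then have "local_max p = lin_comb (local_set p) t" using sub by blast
  moreover have "t i = 0"
  proof -
    have "aff i i = 1" using coord_nonzero by (simp add: One_fract_def eq_fract)
    then show ?thesis by (simp add: t_def c(1) One_fract_def[symmetric])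
  qed
  ultimately show ?thesis using that[of t] c(2) by (simp add: t_def)
qed

section \<open>Partial derivatives and the Jacobian criterion\<close>

lemma pdiff_add: "pdiff i (F + G) = pdiff i F + pdiff i G"
  unfolding pdiff_def
  by (rule setsum_keys_plus_distrib) (auto simp: algebra_simps single_add)

lemma pdiff_single:
  "pdiff i (Poly_Mapping.single m c)
    = Poly_Mapping.single (m - Poly_Mapping.single i 1) (of_nat (Poly_Mapping.lookup m i) * c)"
  by (cases "c = 0") (auto simp: pdiff_def)

lemma pdiff_zero [simp]: "pdiff i 0 = 0"
  by (simp add: pdiff_def)

lemma pdiff_mult: "pdiff i (F * G) = pdiff i F * G + F * pdiff i G"
proof (induction F rule: cpoly_induct)
  case (single m c)
  show ?case
  proof (induction G rule: cpoly_induct)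
    case (single n d)
    \<comment> \<open>Subtraction of exponents is truncated: if x_i does not divide the monomial a,
      the two exponents may differ, but then the coefficient is 0.\<close>
    have *: "Poly_Mapping.single (a - Poly_Mapping.single i 1 + b) (of_nat (Poly_Mapping.lookup a i) * e)
      = Poly_Mapping.single (a + b - Poly_Mapping.single i 1) (of_nat (Poly_Mapping.lookup a i) * e)"
      for a b :: "4 \<Rightarrow>\<^sub>0 nat" and e :: complex
    proof (cases "Poly_Mapping.lookup a i = 0")
      case False
      then have "a - Poly_Mapping.single i 1 + b = a + b - Poly_Mapping.single i 1"
        by (intro poly_mapping_eqI) (auto simp: lookup_add lookup_minus lookup_single when_def)
      then show ?thesis by simp
    qed simp
    show ?case
      using *[of m n "c * d"] *[of n m "c * d"]
      by (simp add: mult_single pdiff_single lookup_add algebra_simps flip: single_add)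
  qed (simp_all add: pdiff_add algebra_simps)
qed (simp_all add: pdiff_add algebra_simps)

text \<open>
  Jacobian criterion: elements of \<open>\<mm>\<^sup>2\<close> are fractions whose numerators have all partial
  derivatives in \<open>p\<close>.
\<close>

lemma local_equation_not_in_square:
  assumes p: "p \<in> P3" and F: "F \<in> p" and F': "pdiff k F \<notin> p" and x: "x \<notin> p"
    and r: "\<And>j::'b::finite. r j \<in> local_max p" and t: "\<And>j. t j \<in> local_max p"
  shows "Fract F x \<noteq> (\<Sum>j\<in>UNIV. r j * t j)"
proof
  assume eq: "Fract F x = (\<Sum>j\<in>UNIV. r j * t j)"
  note i = P3_ideal[OF p]
  define W where "W = {f. \<exists>G B. f = Fract G B \<and> B \<notin> p \<and> G \<in> p \<and> pdiff k G \<in> p}"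
  have "0 = Fract 0 1 \<and> 1 \<notin> p \<and> 0 \<in> p \<and> pdiff k 0 \<in> p"
    using P3_one[OF p] P3_zero[OF p] by (simp add: fract_collapse)
  then have "0 \<in> W" unfolding W_def by blast
  have W_add: "f + g \<in> W" if fg: "f \<in> W" "g \<in> W" for f g
  proof -
    obtain G B G' B' where *: "f = Fract G B" "g = Fract G' B'" and B: "B \<notin> p" "B' \<notin> p"
      and G: "G \<in> p" "pdiff k G \<in> p" "G' \<in> p" "pdiff k G' \<in> p"
      using fg by (auto simp: W_def)
    have "B \<noteq> 0" "B' \<noteq> 0" using B P3_zero[OF p] by auto
    then have "f + g = Fract (G * B' + G' * B) (B * B')" by (simp add: *)
    moreover have "B * B' \<notin> p" using B P3_prime[OF p] by blast
    moreover have "G * B' + G' * B \<in> p" "pdiff k (G * B' + G' * B) \<in> p"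
      using G by (auto simp: pdiff_add pdiff_mult P3_prime[OF p] intro!: idl_add[OF i])
    ultimately show ?thesis unfolding W_def by blast
  qed
  have W_mult: "f * g \<in> W" if fg: "f \<in> local_max p" "g \<in> local_max p" for f g
  proof -
    obtain G B G' B' where *: "f = Fract G B" "g = Fract G' B'" and B: "B \<notin> p" "B' \<notin> p"
      and G: "G \<in> p" "G' \<in> p"
      using fg by (auto simp: local_max_def)
    have "f * g = Fract (G * G') (B * B')" by (simp add: *)
    moreover have "B * B' \<notin> p" using B P3_prime[OF p] by blast
    moreover have "G * G' \<in> p" "pdiff k (G * G') \<in> p"
      using G by (auto simp: pdiff_mult P3_prime[OF p] intro!: idl_add[OF i])
    ultimately show ?thesis unfolding W_def by blast
  qed
  have sum_W: "(\<Sum>j\<in>A. r j * t j) \<in> W" for A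
    by (induction A rule: infinite_finite_induct) (auto intro: \<open>0 \<in> W\<close> W_add W_mult r t)
  have "Fract F x \<in> W" unfolding eq by (rule sum_W)
  then obtain G B where GB: "Fract F x = Fract G B" "B \<notin> p" "G \<in> p" "pdiff k G \<in> p"
    unfolding W_def by blast
  have "x \<noteq> 0" "B \<noteq> 0" using x GB P3_zero[OF p] by auto
  with GB have "F * B = G * x" by (simp add: eq_fract)
  \<comment> \<open>Leibniz rule for F B = G x; every term but \<open>pdiff k F * B\<close> lies in
    p.\<close>
  then have eq': "pdiff k F * B + F * pdiff k B = pdiff k G * x + G * pdiff k x"
    by (metis pdiff_mult)
  have "pdiff k F * B + F * pdiff k B \<in> p"
    unfolding eq' using GB by (intro idl_add[OF i]) (auto simp: P3_prime[OF p])
  moreover have "F * pdiff k B \<in> p" using F by (simp add: P3_prime[OF p])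
  ultimately have "pdiff k F * B \<in> p"
    using idl_diff[OF subring_set_UNIV i] by (metis add_diff_cancel_right')
  with F' GB P3_prime[OF p] show False by blast
qed

text \<open>F G / b equals (G x_i^d / b) (F / x_i^d), so the chart equation F / x_i^d generates the
  stalk; homogeneity of the cofactor G makes the first factor a fraction of degree zero.\<close>

lemma hypersurface_principal:
  assumes p: "p \<in> P3" and i: "coord i \<notin> p" and F: "homog d F" "F \<noteq> 0"
  shows "hypersurface F p = {r * Fract F (coord i ^ d) | r. r \<in> local_set p}"
proof (intro subset_antisym subsetI)
  have x: "coord i ^ d \<notin> p" using i P3_power[OF p] by blast
  fix f assume "f \<in> hypersurface F p"
  then obtain G b e where f: "f = Fract (F * G) b" "homog e (F * G)" "homog e b" "b \<notin> p"
    by (auto simp: hypersurface_def dvd_def)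
  have nz: "b \<noteq> 0" "coord i ^ d \<noteq> 0" using f(4) x P3_zero[OF p] by metis+
  show "f \<in> {r * Fract F (coord i ^ d) | r. r \<in> local_set p}"
  proof (cases "G = 0")
    case True
    then have "f = 0 * Fract F (coord i ^ d)" using f nz by (simp add: fract_collapse)
    then show ?thesis using subring_local_set[OF p] unfolding subring_set_def by blast
  next
    case False
    then obtain n where n: "e = d + n" "homog n G" using homog_cofactor[OF F f(2)] by blast
    have "Fract (G * coord i ^ d) b \<in> local_set p"
      using f n homog_mult[OF n(2) homog_coord_power, of d i]
      by (intro local_setI[of e]) (simp_all add: add.commute)
    moreover have "f = Fract (G * coord i ^ d) b * Fract F (coord i ^ d)"
      using nz f by (simp add: eq_fract mult_ac)
    ultimately show ?thesis by blast
  qed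
next
  have x: "coord i ^ d \<notin> p" using i P3_power[OF p] by blast
  fix f assume "f \<in> {r * Fract F (coord i ^ d) | r. r \<in> local_set p}"
  then obtain a b e where r: "f = Fract a b * Fract F (coord i ^ d)" "homog e a" "homog e b" "b \<notin> p"
    by (auto elim!: local_setE)
  have "f = Fract (a * F) (b * coord i ^ d)" by (simp add: r)
  moreover have "homog (e + d) (a * F)" "homog (e + d) (b * coord i ^ d)"
    using r F by (auto intro: homog_mult homog_coord_power)
  moreover have "b * coord i ^ d \<notin> p" using x r P3_prime[OF p] by blast
  moreover have "F dvd a * F" by simp
  ultimately show "f \<in> hypersurface F p" unfolding hypersurface_def by blast
qed

lemma smooth_surface_principal:
  assumes X: "smooth_surface d X" and q: "q \<in> P3"
  shows "\<exists>g\<in>X q. X q = {r * g | r. r \<in> local_set q} \<and> g \<in> local_set q"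
proof -
  obtain F where F: "F \<noteq> 0" "homog d F" "X q = hypersurface F q"
    using X q by (auto simp: smooth_surface_def scheme_eq_def)
  obtain i where i: "coord i \<notin> q" using P3_coord[OF q] by blast
  define g where "g = Fract F (coord i ^ d)"
  have Xg: "X q = {r * g | r. r \<in> local_set q}"
    unfolding F(3) g_def by (rule hypersurface_principal[OF q i F(2,1)])
  moreover have "g \<in> X q"
    using subring_local_set[OF q] by (auto simp: Xg subring_set_def intro!: exI[of _ 1])
  moreover have "g \<in> local_set q"
    unfolding g_def using i P3_power[OF q] F(2) by (auto intro: local_setI homog_coord_power)
  ultimately show ?thesis by blast
qed

text \<open>Since t_i = 0, three of the t_j span the maximal ideal. By the Jacobian criterion the
  local equation g = sum of r_j t_j is not in its square, so some \<open>r l\<close> with l \<noteq>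
  i is a unit and t_l is eliminated modulo g; the other two are u and v.\<close>

lemma smooth_surface_max_ideal:
  assumes X: "smooth_surface d X" and p: "closed_point p" and Xp: "X p \<subseteq> local_max p"
  shows "\<exists>u\<in>local_max p. \<exists>v\<in>local_max p. \<forall>f\<in>local_max p.
           \<exists>a\<in>local_set p. \<exists>b\<in>local_set p. \<exists>w\<in>X p. f = a * u + b * v + w"
proof -
  note p3 = closed_point_P3[OF p]
  note m = idl_local_max[OF p3] and R = subring_local_set[OF p3]
  obtain F where F: "F \<noteq> 0" "homog d F" "X p = hypersurface F p"
    and sm: "F \<in> p \<Longrightarrow> \<exists>i. pdiff i F \<notin> p"
    using X p3 by (auto simp: smooth_surface_def scheme_eq_def)
  obtain i where i: "coord i \<notin> p" using P3_coord[OF p3] by blast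
  define x where "x = coord i ^ d"
  have x: "x \<notin> p" "homog d x" using i P3_power[OF p3] homog_coord_power by (auto simp: x_def)
  define g where "g = Fract F x"
  have Xg: "X p = {r * g | r. r \<in> local_set p}"
    unfolding F(3) g_def x_def by (rule hypersurface_principal[OF p3 i F(2,1)])
  then have g: "g \<in> X p" using R by (auto simp: subring_set_def intro!: exI[of _ 1])
  then have gm: "g \<in> local_max p" using Xp by blast
  have Fp: "F \<in> p" using gm Fract_in_local_maxD[OF p3 x(1)] by (simp add: g_def)
  then obtain k where k: "pdiff k F \<notin> p" using sm by blast
  obtain t where t: "t i = 0" "\<And>j. t j \<in> local_max p" "local_max p = lin_comb (local_set p) t"
    using local_max_generators[OF p i] by metis
  from gm obtain r where r: "g = (\<Sum>j\<in>UNIV. r j * t j)" "range r \<subseteq> local_set p"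
    unfolding t(3) lin_comb_def by blast
  have "\<exists>l. l \<noteq> i \<and> r l \<notin> local_max p"
  proof (rule ccontr)
    assume neg: "\<not> ?thesis"
    \<comment> \<open>Nothing is known about r_i, but t_i = 0; replacing r_i by 0 leaves g unchanged
      and puts all coefficients into the maximal ideal.\<close>
    define r' where "r' = r(i := 0)"
    have "g = (\<Sum>j\<in>UNIV. r' j * t j)"
      unfolding r(1) r'_def using t(1) by (intro sum.cong) auto
    moreover have "r' j \<in> local_max p" for j
      using neg idl_zero[OF m] by (auto simp: r'_def)
    ultimately show False
      using local_equation_not_in_square[OF p3 Fp k x(1), of r' t] t(2) by (auto simp: g_def)
  qed
  then obtain l where l: "l \<noteq> i" "r l \<notin> local_max p" by blast
  then obtain s where s: "s \<in> local_set p" "r l * s = 1"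
    using local_set_unit[OF p3] r(2) by blast
  have "card (UNIV - {i, l}) = 2" using l by (simp add: card_Diff_subset)
  then obtain a b where ab: "UNIV - {i, l} = {a, b}" "a \<noteq> b" by (auto simp: card_2_iff)
  have expand: "(\<Sum>j\<in>UNIV. h j * t j) = h l * t l + h a * t a + h b * t b" for h
  proof -
    have U: "(UNIV :: 4 set) = {i, l, a, b}" using ab by blast
    have "a \<noteq> i" "b \<noteq> i" "a \<noteq> l" "b \<noteq> l" using ab by blast+
    then show ?thesis using l ab(2) t(1) by (subst U) simp
  qed
  have tl: "t l = s * g - s * r a * t a - s * r b * t b"
  proof -
    have "s * g = (r l * s) * t l + s * r a * t a + s * r b * t b"
      unfolding r(1) expand by (simp add: algebra_simps)
    then show ?thesis by (simp add: s(2))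
  qed
  have "\<exists>\<alpha>\<in>local_set p. \<exists>\<beta>\<in>local_set p. \<exists>w\<in>X p. f = \<alpha> * t a + \<beta> * t b + w"
    if f: "f \<in> local_max p" for f
  proof -
    obtain h where h: "f = (\<Sum>j\<in>UNIV. h j * t j)" "range h \<subseteq> local_set p"
      using f unfolding t(3) lin_comb_def by blast
    have "f = (h a - h l * s * r a) * t a + (h b - h l * s * r b) * t b + (h l * s) * g"
      unfolding h(1) expand tl by (simp add: algebra_simps)
    moreover have mem: "r j \<in> local_set p" "h j \<in> local_set p" for j using r(2) h(2) by auto
    moreover have "h j - h l * s * r j \<in> local_set p" for j
      using R mem s(1) idl_diff[OF R, of "local_set p" "h j" "h l * s * r j"]
      by (auto simp: subring_set_def idl_def)
    moreover have "(h l * s) * g \<in> X p"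
      unfolding Xg using R mem s(1) by (auto simp: subring_set_def)
    ultimately show ?thesis by blast
  qed
  then have "\<forall>f\<in>local_max p. \<exists>\<alpha>\<in>local_set p. \<exists>\<beta>\<in>local_set p. \<exists>w\<in>X p. f = \<alpha> * t a + \<beta> * t b + w"
    by (rule ballI)
  then show ?thesis by (rule bexI[OF bexI[OF _ t(2)] t(2)])
qed


section \<open>Transversal ideals\<close>

text \<open>
  Writing \<open>u = c\<^sub>1 + e\<^sub>1\<close> and \<open>v = c\<^sub>2 + e\<^sub>2\<close>, the coefficient matrices \<open>P\<close> of the \<open>c\<^sub>i\<close> and \<open>1 - P\<close> of
  the \<open>e\<^sub>i\<close> are both singular modulo \<open>\<mm>\<close>, so \<open>P\<close> has trace 1 there and one diagonal entry of \<open>P\<close> is a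
  unit.
\<close>

lemma transversal_generators:
  assumes q: "q \<in> P3" and C: "idl (local_set q) C" and E: "idl (local_set q) E"
    and X: "X \<subseteq> C" "X \<subseteq> E" "idl (local_set q) X"
    and CE: "C \<subseteq> local_max q" "E \<subseteq> local_max q" "C \<noteq> local_max q" "E \<noteq> local_max q"
    and sum: "\<And>f. f \<in> local_max q \<Longrightarrow> \<exists>c\<in>C. \<exists>e\<in>E. f = c + e"
    and uv: "u \<in> local_max q" "v \<in> local_max q"
    and gen: "\<And>f. f \<in> local_max q \<Longrightarrow>
        \<exists>a\<in>local_set q. \<exists>b\<in>local_set q. \<exists>w\<in>X. f = a * u + b * v + w"
  shows "\<exists>x\<in>C. \<exists>y\<in>E. \<forall>f\<in>local_max q.
           \<exists>a\<in>local_set q. \<exists>b\<in>local_set q. \<exists>w\<in>X. f = a * x + b * y + w"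
proof -
  note R = subring_local_set[OF q] and m = idl_local_max[OF q]
  define L where "L = local_set q"
  have L_mult: "a * b \<in> L" and L_diff: "a - b \<in> L" if "a \<in> L" "b \<in> L" for a b
    using R idl_diff[OF R, of L a b] that by (auto simp: L_def subring_set_def idl_def)
  have one: "1 \<in> L" using R by (simp add: L_def subring_set_def)
  have L_neg: "- a \<in> L" "1 - a \<in> L" if "a \<in> L" for a
    using R that L_diff[OF one that] by (auto simp: L_def subring_set_def)
  \<comment> \<open>Cramer's rule: two elements generate the maximal ideal modulo X once the
    determinant of their coefficients is a unit.\<close>
  have key: "\<forall>f\<in>local_max q. \<exists>a\<in>L. \<exists>b\<in>L. \<exists>w\<in>X. f = a * x + b * y + w"
    if cf: "a \<in> L" "b \<in> L" "a' \<in> L" "b' \<in> L" and x: "x - (a * u + b * v) \<in> X"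
      and y: "y - (a' * u + b' * v) \<in> X" and det: "a * b' - a' * b \<notin> local_max q"
    for a b a' b' x y
  proof
    fix f assume "f \<in> local_max q"
    then obtain \<alpha> \<beta> w where f: "f = \<alpha> * u + \<beta> * v + w" "\<alpha> \<in> L" "\<beta> \<in> L" "w \<in> X"
      using gen unfolding L_def by blast
    have "a * b' - a' * b \<in> L" using cf by (intro L_diff L_mult)
    then obtain s where s: "s \<in> L" "(a * b' - a' * b) * s = 1"
      using local_set_unit[OF q _ det] unfolding L_def by blast
    define X1 X2 where "X1 = x - (a * u + b * v)" and "X2 = y - (a' * u + b' * v)"
    define A B where "A = s * (\<alpha> * b' - \<beta> * a')" and "B = s * (\<beta> * a - \<alpha> * b)"
    have AB: "A \<in> L" "B \<in> L" unfolding A_def B_def using f s cf by (auto intro!: L_mult L_diff)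
    have "A * (a * u + b * v) + B * (a' * u + b' * v)
        = ((a * b' - a' * b) * s) * (\<alpha> * u + \<beta> * v)"
      by (simp add: A_def B_def algebra_simps)
    then have "A * (a * u + b * v) + B * (a' * u + b' * v) = \<alpha> * u + \<beta> * v"
      by (simp add: s(2))
    then have "f = A * x + B * y + (w - A * X1 - B * X2)"
      by (simp add: f(1) X1_def X2_def algebra_simps)
    moreover have "w - A * X1 - B * X2 \<in> X"
      using f(4) x y AB X1_def X2_def
      by (intro idl_diff[OF R X(3)] idl_mult[OF X(3)]) (auto simp: L_def)
    ultimately show "\<exists>a\<in>L. \<exists>b\<in>L. \<exists>w\<in>X. f = a * x + b * y + w" using AB by blast
  qed
  \<comment> \<open>Two elements of an ideal strictly inside the maximal ideal cannot generate it
    modulo X, so their determinant is not a unit.\<close>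
  have det_C: "a * b' - a' * b \<in> local_max q"
    if "a \<in> L" "b \<in> L" "a' \<in> L" "b' \<in> L" and x: "x - (a * u + b * v) \<in> X"
      and y: "y - (a' * u + b' * v) \<in> X" and xy: "x \<in> I" "y \<in> I"
      and I: "idl (local_set q) I" "X \<subseteq> I" "I \<subseteq> local_max q" "I \<noteq> local_max q"
    for a b a' b' x y I
  proof (rule ccontr)
    assume "a * b' - a' * b \<notin> local_max q"
    note k = key[OF that(1-4) x y this]
    have "local_max q \<subseteq> I"
    proof
      fix f assume "f \<in> local_max q"
      then obtain A B w where "A \<in> L" "B \<in> L" "w \<in> X" "f = A * x + B * y + w" using k by blast
      then show "f \<in> I"
        using xy I(2) by (auto simp: L_def intro!: idl_add[OF I(1)] idl_mult[OF I(1)])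
    qed
    with I show False by blast
  qed
  obtain c1 e1 where c1: "c1 \<in> C" "e1 \<in> E" "u = c1 + e1" using sum[OF uv(1)] by blast
  obtain c2 e2 where c2: "c2 \<in> C" "e2 \<in> E" "v = c2 + e2" using sum[OF uv(2)] by blast
  obtain a b w1 where ab: "a \<in> L" "b \<in> L" "w1 \<in> X" "c1 = a * u + b * v + w1"
    using gen c1(1) CE(1) unfolding L_def by blast
  obtain a' b' w2 where ab': "a' \<in> L" "b' \<in> L" "w2 \<in> X" "c2 = a' * u + b' * v + w2"
    using gen c2(1) CE(1) unfolding L_def by blast
  have e1: "e1 - ((1 - a) * u + (- b) * v) \<in> X"
  proof -
    have "e1 = u - c1" using c1(3) by simp
    then have "e1 - ((1 - a) * u + (- b) * v) = - w1" by (simp add: ab(4) algebra_simps)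
    then show ?thesis using idl_uminus[OF R X(3) ab(3)] by simp
  qed
  have e2: "e2 - ((- a') * u + (1 - b') * v) \<in> X"
  proof -
    have "e2 = v - c2" using c2(3) by simp
    then have "e2 - ((- a') * u + (1 - b') * v) = - w2" by (simp add: ab'(4) algebra_simps)
    then show ?thesis using idl_uminus[OF R X(3) ab'(3)] by simp
  qed
  have cX: "c1 - (a * u + b * v) \<in> X" "c2 - (a' * u + b' * v) \<in> X"
    using ab ab' by auto
  have d1: "a * b' - a' * b \<in> local_max q"
    by (rule det_C[OF ab(1,2) ab'(1,2) cX c1(1) c2(1) C X(1) CE(1,3)])
  have d2: "(1 - a) * (1 - b') - (- a') * (- b) \<in> local_max q"
    by (rule det_C[OF _ _ _ _ e1 e2 c1(2) c2(2) E X(2) CE(2,4)])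
      (intro L_neg ab ab')+
  have "a \<notin> local_max q \<or> b' \<notin> local_max q"
  proof (rule ccontr)
    assume "\<not> ?thesis"
    then have "a + b' \<in> local_max q" using idl_add[OF m] by blast
    moreover have "1 = ((1 - a) * (1 - b') - (- a') * (- b)) + (a + b') - (a * b' - a' * b)"
      by (simp add: algebra_simps)
    ultimately have "1 \<in> local_max q"
      using idl_diff[OF R m idl_add[OF m d2] d1] by metis
    with one_notin_local_max[OF q] show False by blast
  qed
  then show ?thesis
  proof
    assume a: "a \<notin> local_max q"
    \<comment> \<open>The determinant of c1 and e2 is a - (a b' - a' b), congruent to a modulo the
      maximal ideal. In the other case that of c2 and e1 is (a b' - a' b) - b'.\<close>
    have det: "a * (1 - b') - (- a') * b \<notin> local_max q"
    proof
      assume "a * (1 - b') - (- a') * b \<in> local_max q"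
      from idl_add[OF m this d1] have "a \<in> local_max q" by (simp add: algebra_simps)
      with a show False ..
    qed
    have "\<forall>f\<in>local_max q. \<exists>a\<in>L. \<exists>b\<in>L. \<exists>w\<in>X. f = a * c1 + b * e2 + w"
      by (rule key[OF ab(1,2) _ _ cX(1) e2 det]) (intro L_neg ab')+
    with c1(1) c2(2) show ?thesis
      unfolding L_def by (intro bexI[of _ c1] bexI[of _ e2])
  next
    assume b': "b' \<notin> local_max q"
    have det: "a' * (- b) - (1 - a) * b' \<notin> local_max q"
    proof
      assume "a' * (- b) - (1 - a) * b' \<in> local_max q"
      from idl_diff[OF R m d1 this] have "b' \<in> local_max q" by (simp add: algebra_simps)
      with b' show False ..
    qed
    have "\<forall>f\<in>local_max q. \<exists>a\<in>L. \<exists>b\<in>L. \<exists>w\<in>X. f = a * c2 + b * e1 + w"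
      by (rule key[OF ab'(1,2) _ _ cX(2) e1 det]) (intro L_neg ab)+
    with c2(1) c1(2) show ?thesis
      unfolding L_def by (intro bexI[of _ c2] bexI[of _ e1])
  qed
qed

text \<open>
  If \<open>y s \<in> C\<close> and \<open>s \<notin> C\<close>, then \<open>x\<close>, \<open>y\<close> and \<open>X\<close> annihilate \<open>s\<close> modulo \<open>C\<close>, so the annihilator of \<open>s\<close> is \<open>\<mm>\<close>.
\<close>

lemma nonzerodivisor_mod:
  assumes q: "q \<in> P3" and C: "idl (local_set q) C" and X: "X \<subseteq> C"
    and nass: "\<not> (\<exists>s\<in>local_set q. local_max q = {a \<in> local_set q. a * s \<in> C})"
    and x: "x \<in> C"
    and gen: "\<And>f. f \<in> local_max q \<Longrightarrow>
        \<exists>a\<in>local_set q. \<exists>b\<in>local_set q. \<exists>w\<in>X. f = a * x + b * y + w"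
    and s: "s \<in> local_set q" "y * s \<in> C"
  shows "s \<in> C"
proof (rule ccontr)
  assume "s \<notin> C"
  have "local_max q \<subseteq> {a \<in> local_set q. a * s \<in> C}"
  proof
    fix f assume f: "f \<in> local_max q"
    then obtain a b w where *: "a \<in> local_set q" "b \<in> local_set q" "w \<in> X" "f = a * x + b * y + w"
      using gen by blast
    have "f * s = s * (a * x) + b * (y * s) + s * w" by (simp add: * algebra_simps)
    also have "\<dots> \<in> C"
      by (intro idl_add[OF C] idl_mult[OF C s(1)] idl_mult[OF C *(1) x] idl_mult[OF C *(2) s(2)]
          subsetD[OF X *(3)])
    finally show "f \<in> {a \<in> local_set q. a * s \<in> C}"
      using idl_subset[OF idl_local_max[OF q] f] by simp
  qed
  moreover have "a \<in> local_max q" if a: "a \<in> local_set q" "a * s \<in> C" for a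
  proof (rule ccontr)
    assume "a \<notin> local_max q"
    then obtain b where b: "b \<in> local_set q" "a * b = 1" using local_set_unit[OF q a(1)] by blast
    have "b * (a * s) = (a * b) * s" by (simp add: mult_ac)
    also have "\<dots> = s" by (simp only: b(2) mult_1)
    finally have "s \<in> C" using idl_mult[OF C b(1) a(2)] by (rule subst)
    with \<open>s \<notin> C\<close> show False ..
  qed
  ultimately show False using nass s(1) by blast
qed

section \<open>Open neighbourhoods\<close>

lemma zopen_subset: "zopen U \<Longrightarrow> U \<subseteq> P3"
  by (simp add: zopen_def)

lemma zopen_Int:
  assumes "zopen U" "zopen V"
  shows "zopen (U \<inter> V)"
proof -
  obtain A B where A: "\<forall>F\<in>A. \<exists>d. homog d F" "P3 - U = {p \<in> P3. A \<subseteq> p}"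
    and B: "\<forall>F\<in>B. \<exists>d. homog d F" "P3 - V = {p \<in> P3. B \<subseteq> p}"
    using assms by (auto simp: zopen_def zclosed_def)
  have "P3 - U \<inter> V = {p \<in> P3. {F * G | F G. F \<in> A \<and> G \<in> B} \<subseteq> p}" (is "_ = ?Z")
  proof -
    have *: "A \<subseteq> p \<or> B \<subseteq> p \<longleftrightarrow> {F * G | F G. F \<in> A \<and> G \<in> B} \<subseteq> p" if "p \<in> P3" for p
      using P3_prime[OF that] by blast
    have "P3 - U \<inter> V = (P3 - U) \<union> (P3 - V)" by blast
    also have "\<dots> = {p \<in> P3. A \<subseteq> p \<or> B \<subseteq> p}" unfolding A(2) B(2) by blast
    also have "\<dots> = ?Z" by (intro Collect_cong conj_cong refl *)
    finally show ?thesis .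
  qed
  moreover have "\<exists>d. homog d H" if "H \<in> {F * G | F G. F \<in> A \<and> G \<in> B}" for H
    using that A(1) B(1) homog_mult by blast
  ultimately have "zclosed (P3 - U \<inter> V)" unfolding zclosed_def by blast
  then show ?thesis using assms by (auto simp: zopen_def)
qed

lemma zopen_basic: "homog d b \<Longrightarrow> zopen {q \<in> P3. b \<notin> q}"
  unfolding zopen_def zclosed_def by (auto intro!: exI[of _ "{b}"])

lemma regular_nbhd:
  assumes "x \<in> P3" "f \<in> local_set x"
  shows "\<exists>V. zopen V \<and> x \<in> V \<and> f \<in> reg_sections V"
proof -
  obtain a b d where *: "f = Fract a b" "homog d a" "homog d b" "b \<notin> x"
    using assms(2) by (elim local_setE)
  then have "f \<in> reg_sections {q \<in> P3. b \<notin> q}"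
    by (auto simp: reg_sections_def intro: local_setI)
  with * zopen_basic[of d b] assms(1) show ?thesis by (intro exI[of _ "{q \<in> P3. b \<notin> q}"]) auto
qed

lemma closed_subscheme_ideal: "closed_subscheme Y \<Longrightarrow> q \<in> P3 \<Longrightarrow> idl (local_set q) (Y q)"
  unfolding closed_subscheme_def stalk_def by (metis ideal_iff_idl subring_local_set)

text \<open>Coherence: the germs at x that extend to sections of the ideal sheaf near x form an
  ideal \<open>J\<close> of the stalk, and \<open>J\<close> contains the local generators
  \<open>A\<close>.\<close>

lemma subscheme_nbhd:
  assumes Y: "closed_subscheme Y" and x: "x \<in> P3" and f: "f \<in> Y x"
  shows "\<exists>V. zopen V \<and> x \<in> V \<and> f \<in> reg_sections V \<and> (\<forall>q\<in>V. f \<in> Y q)"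
proof -
  obtain U A where U: "zopen U" "x \<in> U" "A \<subseteq> reg_sections U" "\<And>y. y \<in> U \<Longrightarrow> Y y = Idl\<^bsub>stalk y\<^esub> A"
    using Y x unfolding closed_subscheme_def by metis
  define J where "J = {g. \<exists>V. zopen V \<and> x \<in> V \<and> V \<subseteq> U \<and> g \<in> reg_sections V \<and> (\<forall>q\<in>V. g \<in> Y q)}"
  have sub: "subring_set (local_set q)" "idl (local_set q) (Y q)" if "q \<in> V" "zopen V" for q V
    using that zopen_subset subring_local_set closed_subscheme_ideal[OF Y] by blast+
  have A_Y: "A \<subseteq> Y q" if "q \<in> U" for q
    unfolding U(4)[OF that] genideal_def by blast
  have "idl (local_set x) J"
    unfolding idl_def
  proof (intro conjI ballI)
    show "J \<subseteq> local_set x" by (auto simp: J_def reg_sections_def)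
    have "0 \<in> local_set q \<and> 0 \<in> Y q" if "q \<in> U" for q
      using idl_zero[OF sub(2)[OF that U(1)]] idl_subset[OF sub(2)[OF that U(1)]] by blast
    then show "0 \<in> J" unfolding J_def
      using U(1,2) by (auto simp: reg_sections_def intro!: exI[of _ U])
  next
    fix g h assume "g \<in> J" "h \<in> J"
    then obtain V W where V: "zopen V" "x \<in> V" "V \<subseteq> U" "g \<in> reg_sections V" "\<forall>q\<in>V. g \<in> Y q"
      and W: "zopen W" "x \<in> W" "W \<subseteq> U" "h \<in> reg_sections W" "\<forall>q\<in>W. h \<in> Y q"
      unfolding J_def by blast
    have "g + h \<in> Y q" "g + h \<in> local_set q" if "q \<in> V \<inter> W" for q
      using that V W idl_add[OF sub(2)[of q V], of g h] idl_subset[OF sub(2)[of q V], of "g + h"] by auto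
    then show "g + h \<in> J" unfolding J_def
      using V W zopen_Int by (auto simp: reg_sections_def intro!: exI[of _ "V \<inter> W"])
  next
    fix r g assume r: "r \<in> local_set x" and "g \<in> J"
    then obtain V W where V: "zopen V" "x \<in> V" "V \<subseteq> U" "g \<in> reg_sections V" "\<forall>q\<in>V. g \<in> Y q"
      and W: "zopen W" "x \<in> W" "r \<in> reg_sections W"
      using regular_nbhd[OF x r] unfolding J_def by blast
    have "r * g \<in> Y q" "r * g \<in> local_set q" if "q \<in> V \<inter> W" for q
      using that V W idl_mult[OF sub(2)[of q V], of r g] idl_subset[OF sub(2)[of q V], of "r * g"]
      by (auto simp: reg_sections_def)
    then show "r * g \<in> J" unfolding J_def
      using V W zopen_Int by (auto simp: reg_sections_def intro!: exI[of _ "V \<inter> W"])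
  qed
  moreover have "A \<subseteq> J"
  proof
    fix g assume "g \<in> A"
    then have "g \<in> reg_sections U" "\<forall>q\<in>U. g \<in> Y q" using U(3) A_Y by blast+
    then show "g \<in> J" unfolding J_def using U(1,2) by blast
  qed
  ultimately have "Y x \<subseteq> J"
    unfolding U(4)[OF U(2)] genideal_def stalk_def
    by (auto simp: ideal_iff_idl[OF subring_local_set[OF x]])
  then show ?thesis using f unfolding J_def by blast
qed


section \<open>Sections of homomorphism sheaves by representatives\<close>

abbreviation coset :: "'a::comm_ring_1 set \<Rightarrow> 'a set \<Rightarrow> 'a \<Rightarrow> 'a set" where
  "coset R I a \<equiv> I +>\<^bsub>ring_on R\<^esub> a"

lemma coset_eq_image: "coset R I a = (\<lambda>i. i + a) ` I"
  by (auto simp: a_r_coset_def r_coset_def)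

lemma mem_coset: "b \<in> coset R I a \<longleftrightarrow> b - a \<in> I"
  by (force simp: coset_eq_image image_iff)

lemma coset_eq_iff:
  assumes "subring_set R" "idl R I"
  shows "coset R I a = coset R I b \<longleftrightarrow> a - b \<in> I"
proof
  assume "coset R I a = coset R I b"
  moreover have "a \<in> coset R I a" using idl_zero[OF assms(2)] by (simp add: mem_coset)
  ultimately show "a - b \<in> I" by (simp add: mem_coset)
next
  assume ab: "a - b \<in> I"
  have "x - a \<in> I \<longleftrightarrow> x - b \<in> I" for x
    using idl_add[OF assms(2) _ ab, of "x - a"] idl_diff[OF assms _ ab, of "x - b"] by auto
  then show "coset R I a = coset R I b" by (auto simp: mem_coset)
qed

lemma coset_zero: "coset R I 0 = I"
  by (auto simp: mem_coset)

lemma set_add_iff: "f \<in> A <+>\<^bsub>ring_on R\<^esub> B \<longleftrightarrow> (\<exists>a\<in>A. \<exists>b\<in>B. f = a + b)"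
  by (auto simp: set_add_def')

lemma coset_set_add:
  assumes "subring_set R" "idl R I" "idl R J" "I \<subseteq> J"
  shows "coset R I a <+>\<^bsub>ring_on R\<^esub> J = coset R J a"
proof (intro subset_antisym subsetI)
  fix x assume "x \<in> coset R I a <+>\<^bsub>ring_on R\<^esub> J"
  then obtain u v where "u - a \<in> I" "v \<in> J" "x = u + v" by (auto simp: set_add_iff mem_coset)
  with assms idl_add[OF assms(3), of "u - a" v] show "x \<in> coset R J a"
    by (auto simp: mem_coset algebra_simps)
next
  fix x assume "x \<in> coset R J a"
  then have "x = a + (x - a)" "x - a \<in> J" "a \<in> coset R I a"
    using idl_zero[OF assms(2)] by (auto simp: mem_coset)
  then show "x \<in> coset R I a <+>\<^bsub>ring_on R\<^esub> J" unfolding set_add_iff by blast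
qed

lemma coset_ops:
  assumes R: "subring_set R" and I: "idl R I" and ab: "a \<in> R" "b \<in> R"
  shows "coset R I a \<oplus>\<^bsub>ring_on R Quot I\<^esub> coset R I b = coset R I (a + b)"
    and "coset R I a \<otimes>\<^bsub>ring_on R Quot I\<^esub> coset R I b = coset R I (a * b)"
proof -
  interpret ideal I "ring_on R" using I by (simp add: ideal_iff_idl[OF R])
  show "coset R I a \<oplus>\<^bsub>ring_on R Quot I\<^esub> coset R I b = coset R I (a + b)"
    using a_rcos_sum[of a b] ab by (simp add: FactRing_def)
  show "coset R I a \<otimes>\<^bsub>ring_on R Quot I\<^esub> coset R I b = coset R I (a * b)"
    using rcoset_mult_add[of a b] ab by (simp add: FactRing_def)
qed

lemma carrier_Quot: "carrier (ring_on R Quot I) = coset R I ` R"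
  by (auto simp: FactRing_def A_RCOSETS_def')

text \<open>\<open>x\<close> picks a representative in R for each value of a homomorphism from Y to
  R/Z and is itself additive and linear only modulo Z. Equations between cosets become memberships
  in Z.\<close>

definition is_hom :: "'a::comm_ring_1 set \<Rightarrow> 'a set \<Rightarrow> 'a set \<Rightarrow> ('a \<Rightarrow> 'a) \<Rightarrow> bool" where
  "is_hom R Y Z x \<longleftrightarrow> (\<forall>f\<in>Y. x f \<in> R) \<and> (\<forall>f\<in>Y. \<forall>g\<in>Y. x (f + g) - (x f + x g) \<in> Z) \<and>
     (\<forall>a\<in>R. \<forall>f\<in>Y. x (a * f) - a * x f \<in> Z)"

definition hom_of :: "'a::comm_ring_1 set \<Rightarrow> 'a set \<Rightarrow> 'a set \<Rightarrow> ('a \<Rightarrow> 'a) \<Rightarrow> 'a \<Rightarrow> 'a set" where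
  "hom_of R Y Z x = (\<lambda>f\<in>Y. coset R Z (x f))"

lemma hom_stalk_carrier:
  assumes q: "q \<in> P3" and Y: "idl (local_set q) (Y q)" and Z: "idl (local_set q) (Z q)"
  shows "carrier (hom_stalk Y Z q)
    = {hom_of (local_set q) (Y q) (Z q) x | x. is_hom (local_set q) (Y q) (Z q) x}"
    (is "?L = ?R")
proof -
  note R = subring_local_set[OF q]
  let ?O = "local_set q" and ?Q = "ring_on (local_set q) Quot Z q"
  have carr: "\<phi> \<in> ?L \<longleftrightarrow> \<phi> \<in> Y q \<rightarrow>\<^sub>E coset ?O (Z q) ` ?O \<and>
         (\<forall>f\<in>Y q. \<forall>g\<in>Y q. \<phi> (f + g) = \<phi> f \<oplus>\<^bsub>?Q\<^esub> \<phi> g) \<and>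
         (\<forall>a\<in>?O. \<forall>f\<in>Y q. \<phi> (a * f) = coset ?O (Z q) a \<otimes>\<^bsub>?Q\<^esub> \<phi> f)" for \<phi>
    by (simp add: hom_stalk_def Let_def stalk_def carrier_Quot)
  show ?thesis
  proof (intro subset_antisym subsetI)
    fix \<phi> assume "\<phi> \<in> ?L"
    then have \<phi>: "\<phi> \<in> Y q \<rightarrow>\<^sub>E coset ?O (Z q) ` ?O"
      "\<And>f g. f \<in> Y q \<Longrightarrow> g \<in> Y q \<Longrightarrow> \<phi> (f + g) = \<phi> f \<oplus>\<^bsub>?Q\<^esub> \<phi> g"
      "\<And>a f. a \<in> ?O \<Longrightarrow> f \<in> Y q \<Longrightarrow> \<phi> (a * f) = coset ?O (Z q) a \<otimes>\<^bsub>?Q\<^esub> \<phi> f"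
      unfolding carr by blast+
    have "\<forall>f\<in>Y q. \<exists>a. a \<in> ?O \<and> \<phi> f = coset ?O (Z q) a" using \<phi>(1) by auto
    then obtain x where x: "\<And>f. f \<in> Y q \<Longrightarrow> x f \<in> ?O \<and> \<phi> f = coset ?O (Z q) (x f)" by metis
    have "x (f + g) - (x f + x g) \<in> Z q" if "f \<in> Y q" "g \<in> Y q" for f g
      using \<phi>(2)[OF that] x that idl_add[OF Y that]
      by (simp add: coset_ops[OF R Z] coset_eq_iff[OF R Z])
    moreover have "x (a * f) - a * x f \<in> Z q" if "a \<in> ?O" "f \<in> Y q" for a f
      using \<phi>(3)[OF that] x that idl_mult[OF Y that]
      by (simp add: coset_ops[OF R Z] coset_eq_iff[OF R Z])
    ultimately have "is_hom ?O (Y q) (Z q) x" using x by (simp add: is_hom_def)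
    moreover have "\<phi> = hom_of ?O (Y q) (Z q) x"
    proof
      fix f
      show "\<phi> f = hom_of ?O (Y q) (Z q) x f"
        using PiE_arb[OF \<phi>(1), of f] x[of f] by (cases "f \<in> Y q") (simp_all add: hom_of_def)
    qed
    ultimately show "\<phi> \<in> ?R" by blast
  next
    fix \<phi> assume "\<phi> \<in> ?R"
    then obtain x where x: "is_hom ?O (Y q) (Z q) x" and \<phi>: "\<phi> = hom_of ?O (Y q) (Z q) x" by blast
    show "\<phi> \<in> ?L"
      unfolding carr \<phi> hom_of_def
      using x idl_add[OF Y] idl_mult[OF Y]
      by (simp add: is_hom_def coset_ops[OF R Z] coset_eq_iff[OF R Z] Pi_iff imageI)
  qed
qed

lemma hom_of_cong:
  assumes "subring_set R" "idl R Z"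
  shows "hom_of R Y Z x = hom_of R Y Z y \<longleftrightarrow> (\<forall>f\<in>Y. x f - y f \<in> Z)"
  by (auto simp: hom_of_def fun_eq_iff coset_eq_iff[OF assms])

lemma hom_stalk_ops:
  assumes q: "q \<in> P3" and Y: "idl (local_set q) (Y q)" and Z: "idl (local_set q) (Z q)"
    and x: "is_hom (local_set q) (Y q) (Z q) x"
  shows "zero (hom_stalk Y Z q) = hom_of (local_set q) (Y q) (Z q) (\<lambda>_. 0)"
    and "is_hom (local_set q) (Y q) (Z q) y \<Longrightarrow>
      hom_of (local_set q) (Y q) (Z q) x \<oplus>\<^bsub>hom_stalk Y Z q\<^esub> hom_of (local_set q) (Y q) (Z q) y
      = hom_of (local_set q) (Y q) (Z q) (\<lambda>f. x f + y f)"
    and "a \<in> local_set q \<Longrightarrow> a \<odot>\<^bsub>hom_stalk Y Z q\<^esub> hom_of (local_set q) (Y q) (Z q) x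
      = hom_of (local_set q) (Y q) (Z q) (\<lambda>f. a * x f)"
  using x coset_ops[OF subring_local_set[OF q] Z]
  by (auto simp: hom_stalk_def Let_def hom_of_def stalk_def is_hom_def FactRing_def coset_zero fun_eq_iff)

lemma is_hom_zero: "idl R Z \<Longrightarrow> subring_set R \<Longrightarrow> is_hom R Y Z (\<lambda>_. 0)"
  by (simp add: is_hom_def idl_zero subring_set_def)

lemma is_hom_add:
  assumes "subring_set R" "idl R Z" "is_hom R Y Z x" "is_hom R Y Z y"
  shows "is_hom R Y Z (\<lambda>f. x f + y f)"
  unfolding is_hom_def
proof (intro conjI ballI)
  fix f g assume "f \<in> Y" "g \<in> Y"
  then have "(x (f + g) - (x f + x g)) + (y (f + g) - (y f + y g)) \<in> Z"
    using assms by (intro idl_add[OF assms(2)]) (auto simp: is_hom_def)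
  then show "x (f + g) + y (f + g) - (x f + y f + (x g + y g)) \<in> Z" by (simp add: algebra_simps)
next
  fix a f assume "a \<in> R" "f \<in> Y"
  then have "(x (a * f) - a * x f) + (y (a * f) - a * y f) \<in> Z"
    using assms by (intro idl_add[OF assms(2)]) (auto simp: is_hom_def)
  then show "x (a * f) + y (a * f) - a * (x f + y f) \<in> Z" by (simp add: algebra_simps)
qed (use assms in \<open>auto simp: is_hom_def subring_set_def\<close>)

lemma is_hom_smult:
  assumes "subring_set R" "idl R Z" "is_hom R Y Z x" "c \<in> R"
  shows "is_hom R Y Z (\<lambda>f. c * x f)"
  unfolding is_hom_def
proof (intro conjI ballI)
  fix f g assume "f \<in> Y" "g \<in> Y"
  then have "c * (x (f + g) - (x f + x g)) \<in> Z"
    using assms by (intro idl_mult[OF assms(2)]) (auto simp: is_hom_def)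
  then show "c * x (f + g) - (c * x f + c * x g) \<in> Z" by (simp add: algebra_simps)
next
  fix a f assume "a \<in> R" "f \<in> Y"
  then have "c * (x (a * f) - a * x f) \<in> Z"
    using assms by (intro idl_mult[OF assms(2)]) (auto simp: is_hom_def)
  then show "c * x (a * f) - a * (c * x f) \<in> Z" by (simp add: algebra_simps)
qed (use assms in \<open>auto simp: is_hom_def subring_set_def\<close>)

text \<open>\<open>ideal_smult\<close> is an intersection of submodules, so it is bounded by one of
  them: the homomorphisms \<open>H\<close> whose values have representatives in I. Every multiple by
  an element of I lies in \<open>H\<close>.\<close>

lemma ideal_smult_normal:
  assumes q: "q \<in> P3" and Y: "idl (local_set q) (Y q)" and I: "idl (local_set q) I"
    and sub: "Y q \<subseteq> I"
  shows "hom_of (local_set q) (Y q) (Y q) (\<lambda>_. 0) \<in> ideal_smult (stalk q) I (normal_stalk Y q)"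
    and "\<mu> \<in> ideal_smult (stalk q) I (normal_stalk Y q) \<Longrightarrow>
      \<exists>y. is_hom (local_set q) (Y q) (Y q) y \<and> \<mu> = hom_of (local_set q) (Y q) (Y q) y \<and> (\<forall>f\<in>Y q. y f \<in> I)"
proof -
  note R = subring_local_set[OF q]
  let ?O = "local_set q" and ?N = "normal_stalk Y q"
  let ?hom = "hom_of ?O (Y q) (Y q)" and ?is = "is_hom ?O (Y q) (Y q)"
  note ops = hom_stalk_ops[where Y = Y and Z = Y, OF q Y Y]
  note carr = hom_stalk_carrier[where Y = Y and Z = Y, OF q Y Y]
  note z = is_hom_zero[OF Y R]
  have "zero ?N \<in> H" if "submodule H (stalk q) ?N" for H
    using subgroup.one_closed[OF submodule.axioms(1)[OF that]] by simp
  then show "?hom (\<lambda>_. 0) \<in> ideal_smult (stalk q) I ?N"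
    unfolding ideal_smult_def ops(1)[OF z] by blast
  define H where "H = {?hom y | y. ?is y \<and> (\<forall>f\<in>Y q. y f \<in> I)}"
  have "submodule H (stalk q) ?N"
  proof (intro submodule.intro subgroup.intro submodule_axioms.intro)
    show "H \<subseteq> carrier (add_monoid ?N)" unfolding H_def using carr by auto
    show "\<one>\<^bsub>add_monoid ?N\<^esub> \<in> H"
      using z idl_zero[OF I] unfolding H_def by (auto simp: ops(1)[OF z])
  next
    fix \<mu> \<nu> assume "\<mu> \<in> H" "\<nu> \<in> H"
    then obtain y y' where y: "\<mu> = ?hom y" "?is y" "\<forall>f\<in>Y q. y f \<in> I"
      and y': "\<nu> = ?hom y'" "?is y'" "\<forall>f\<in>Y q. y' f \<in> I" unfolding H_def by blast
    have "?is (\<lambda>f. y f + y' f)" "\<forall>f\<in>Y q. y f + y' f \<in> I"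
      using y y' by (auto intro: is_hom_add[OF R Y] idl_add[OF I])
    then show "\<mu> \<otimes>\<^bsub>add_monoid ?N\<^esub> \<nu> \<in> H"
      unfolding H_def y(1) y'(1) by (auto simp: ops(2)[OF y(2) y'(2)])
  next
    fix \<mu> assume "\<mu> \<in> H"
    then obtain y where y: "\<mu> = ?hom y" "?is y" "\<forall>f\<in>Y q. y f \<in> I" unfolding H_def by blast
    have neg: "?is (\<lambda>f. (- 1) * y f)"
      using R by (intro is_hom_smult[OF R Y y(2)]) (auto simp: subring_set_def)
    \<comment> \<open>\<open>inv\<close> is a definite description, so the inverse law and
      uniqueness are both checked on representatives.\<close>
    have "inv\<^bsub>add_monoid ?N\<^esub> \<mu> = ?hom (\<lambda>f. (- 1) * y f)"
      unfolding m_inv_def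
    proof (rule the_equality)
      show "?hom (\<lambda>f. (- 1) * y f) \<in> carrier (add_monoid ?N) \<and>
        \<mu> \<otimes>\<^bsub>add_monoid ?N\<^esub> ?hom (\<lambda>f. (- 1) * y f) = \<one>\<^bsub>add_monoid ?N\<^esub> \<and>
        ?hom (\<lambda>f. (- 1) * y f) \<otimes>\<^bsub>add_monoid ?N\<^esub> \<mu> = \<one>\<^bsub>add_monoid ?N\<^esub>"
        using neg y carr ops(2)[OF y(2) neg] ops(2)[OF neg y(2)] ops(1)[OF z] by auto
    next
      fix \<nu> assume *: "\<nu> \<in> carrier (add_monoid ?N) \<and>
        \<mu> \<otimes>\<^bsub>add_monoid ?N\<^esub> \<nu> = \<one>\<^bsub>add_monoid ?N\<^esub> \<and> \<nu> \<otimes>\<^bsub>add_monoid ?N\<^esub> \<mu> = \<one>\<^bsub>add_monoid ?N\<^esub>"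
      then obtain v where v: "\<nu> = ?hom v" "?is v" using carr by auto
      then have "?hom (\<lambda>f. y f + v f) = ?hom (\<lambda>_. 0)"
        using * y(1) ops(2)[OF y(2) v(2)] ops(1)[OF z] by simp
      then have "\<forall>f\<in>Y q. v f - (- 1) * y f \<in> Y q"
        by (simp add: hom_of_cong[OF R Y] add.commute)
      then show "\<nu> = ?hom (\<lambda>f. (- 1) * y f)" unfolding v(1) hom_of_cong[OF R Y] .
    qed
    moreover have "\<forall>f\<in>Y q. (- 1) * y f \<in> I" using y(3) idl_uminus[OF R I] by simp
    ultimately show "inv\<^bsub>add_monoid ?N\<^esub> \<mu> \<in> H" unfolding H_def using neg by blast
  next
    fix a \<mu> assume a: "a \<in> carrier (stalk q)" and "\<mu> \<in> H"
    then obtain y where y: "\<mu> = ?hom y" "?is y" "\<forall>f\<in>Y q. y f \<in> I" unfolding H_def by blast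
    have aO: "a \<in> ?O" using a by (simp add: stalk_def)
    have "?is (\<lambda>f. a * y f)" "\<forall>f\<in>Y q. a * y f \<in> I"
      using y aO by (auto intro: is_hom_smult[OF R Y] idl_mult[OF I])
    then show "a \<odot>\<^bsub>?N\<^esub> \<mu> \<in> H"
      unfolding H_def y(1) ops(3)[OF y(2) aO] by blast
  qed
  moreover have "a \<odot>\<^bsub>?N\<^esub> \<nu> \<in> H" if a: "a \<in> I" and \<nu>: "\<nu> \<in> carrier ?N" for a \<nu>
  proof -
    obtain y where y: "\<nu> = ?hom y" "?is y" using \<nu> carr by blast
    have aO: "a \<in> ?O" using idl_subset[OF I a] .
    have "?is (\<lambda>f. a * y f)" by (rule is_hom_smult[OF R Y y(2) aO])
    moreover have "\<forall>f\<in>Y q. a * y f \<in> I"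
      using y(2) idl_mult'[OF I _ a] by (simp add: is_hom_def)
    ultimately show ?thesis unfolding H_def y(1) ops(3)[OF y(2) aO] by blast
  qed
  ultimately have "ideal_smult (stalk q) I ?N \<subseteq> H" unfolding ideal_smult_def by blast
  then show "\<exists>y. ?is y \<and> \<mu> = ?hom y \<and> (\<forall>f\<in>Y q. y f \<in> I)"
    if "\<mu> \<in> ideal_smult (stalk q) I ?N" using that unfolding H_def by blast
qed

lemma restrict_normal_members:
  assumes q: "q \<in> P3" and Y: "idl (local_set q) (Y q)" and I: "idl (local_set q) (Z q)"
    and sub: "Y q \<subseteq> Z q"
    and x: "is_hom (local_set q) (Y q) (Y q) x" and \<xi>: "\<xi> q = hom_of (local_set q) (Y q) (Y q) x"
  shows "\<xi> q \<in> restrict_normal Y Z \<xi> q"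
    and "\<eta> \<in> restrict_normal Y Z \<xi> q \<Longrightarrow>
      \<exists>y. \<eta> = hom_of (local_set q) (Y q) (Y q) y \<and> (\<forall>f\<in>Y q. y f - x f \<in> Z q)"
proof -
  note R = subring_local_set[OF q]
  note sm = ideal_smult_normal[where Y = Y, OF q Y I sub]
  note ops = hom_stalk_ops[where Y = Y and Z = Y, OF q Y Y]
  have mem: "\<eta> \<in> restrict_normal Y Z \<xi> q \<longleftrightarrow>
     (\<exists>\<mu>\<in>ideal_smult (stalk q) (Z q) (normal_stalk Y q). \<eta> = \<mu> \<oplus>\<^bsub>normal_stalk Y q\<^esub> \<xi> q)" for \<eta>
    using q by (simp add: restrict_normal_def a_r_coset_def r_coset_def)
  show "\<xi> q \<in> restrict_normal Y Z \<xi> q"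
    unfolding mem
    by (rule bexI[OF _ sm(1)]) (simp add: \<xi> ops(2)[OF is_hom_zero[OF Y R] x])
  assume "\<eta> \<in> restrict_normal Y Z \<xi> q"
  then obtain \<mu> where "\<mu> \<in> ideal_smult (stalk q) (Z q) (normal_stalk Y q)"
    and \<eta>: "\<eta> = \<mu> \<oplus>\<^bsub>normal_stalk Y q\<^esub> \<xi> q" unfolding mem by blast
  then obtain y where y: "is_hom (local_set q) (Y q) (Y q) y" "\<mu> = hom_of (local_set q) (Y q) (Y q) y"
    "\<forall>f\<in>Y q. y f \<in> Z q" using sm(2) by blast
  then have "\<eta> = hom_of (local_set q) (Y q) (Y q) (\<lambda>f. y f + x f)"
    unfolding \<eta> \<xi> by (simp add: ops(2)[OF y(1) x])
  with y show "\<exists>y. \<eta> = hom_of (local_set q) (Y q) (Y q) y \<and> (\<forall>f\<in>Y q. y f - x f \<in> Z q)"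
    by (intro exI[of _ "\<lambda>f. y f + x f"]) simp
qed

text \<open>Members of the restricted class differ by homomorphisms with values in Z, so all give
  the same coset and the union collapses. Both \<open>r_map\<close> and the comparison of
  \<open>Upsilon5\<close> with \<open>Upsilon6\<close> are computed this way.\<close>

lemma induced_restrict:
  assumes q: "q \<in> P3" and Y: "idl (local_set q) (Y q)" and I: "idl (local_set q) (Z q)"
    and sub: "Y q \<subseteq> Z q" and W: "W q \<subseteq> Y q" "f \<in> W q"
    and x: "is_hom (local_set q) (Y q) (Y q) x" and \<xi>: "\<xi> q = hom_of (local_set q) (Y q) (Y q) x"
  shows "induced_hom W Z (restrict_normal Y Z \<xi>) q f = coset (local_set q) (Z q) (x f)"
proof -
  note R = subring_local_set[OF q]
  note T = restrict_normal_members[where Y = Y and Z = Z and \<xi> = \<xi>, OF q Y I sub x \<xi>]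
  have f: "f \<in> Y q" using W by blast
  have "\<eta> f <+>\<^bsub>stalk q\<^esub> Z q = coset (local_set q) (Z q) (x f)"
    if \<eta>: "\<eta> \<in> restrict_normal Y Z \<xi> q" for \<eta>
  proof -
    obtain y where y: "\<eta> = hom_of (local_set q) (Y q) (Y q) y" "\<forall>f\<in>Y q. y f - x f \<in> Z q"
      using T(2)[OF \<eta>] by blast
    then have "\<eta> f <+>\<^bsub>stalk q\<^esub> Z q = coset (local_set q) (Z q) (y f)"
      using f by (simp add: hom_of_def stalk_def coset_set_add[OF R Y I sub])
    also have "\<dots> = coset (local_set q) (Z q) (x f)"
      using y(2) f by (simp add: coset_eq_iff[OF R I])
    finally show ?thesis .
  qed
  then have "(\<Union>\<eta>\<in>restrict_normal Y Z \<xi> q. \<eta> f <+>\<^bsub>stalk q\<^esub> Z q) = coset (local_set q) (Z q) (x f)"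
    using T(1) by (metis (no_types, lifting) SUP_eq_const empty_iff)
  then show ?thesis using q W by (simp add: induced_hom_def)
qed

text \<open>Representatives are chosen at each point separately, so \<open>x q f\<close> need not
  vary regularly with q; the second clause asks that its class modulo Z lift locally to one regular
  function.\<close>

definition hom_family :: "scheme \<Rightarrow> scheme \<Rightarrow> (point \<Rightarrow> ratfun \<Rightarrow> ratfun) \<Rightarrow> bool" where
  "hom_family Y Z x \<longleftrightarrow> (\<forall>q\<in>P3. is_hom (local_set q) (Y q) (Z q) (x q)) \<and>
     (\<forall>U f p. zopen U \<longrightarrow> f \<in> reg_sections U \<longrightarrow> (\<forall>q\<in>U. f \<in> Y q) \<longrightarrow> p \<in> U \<longrightarrow>
       (\<exists>V g. zopen V \<and> p \<in> V \<and> V \<subseteq> U \<and> g \<in> reg_sections V \<and> (\<forall>q\<in>V. x q f - g \<in> Z q)))"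

definition section_of ::
  "scheme \<Rightarrow> scheme \<Rightarrow> (point \<Rightarrow> ratfun \<Rightarrow> ratfun) \<Rightarrow> point \<Rightarrow> ratfun \<Rightarrow> ratfun set" where
  "section_of Y Z x = (\<lambda>q\<in>P3. hom_of (local_set q) (Y q) (Z q) (x q))"

lemma hom_sections_eq:
  assumes Y: "\<And>q. q \<in> P3 \<Longrightarrow> idl (local_set q) (Y q)" and Z: "\<And>q. q \<in> P3 \<Longrightarrow> idl (local_set q) (Z q)"
  shows "hom_sections Y Z = {section_of Y Z x | x. hom_family Y Z x}"
proof -
  have eq: "section_of Y Z x q f = Z q +>\<^bsub>stalk q\<^esub> g \<longleftrightarrow> x q f - g \<in> Z q"
    if "q \<in> P3" "f \<in> Y q" for x q f g
    using that by (simp add: section_of_def hom_of_def stalk_def coset_eq_iff[OF subring_local_set Z])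
  have carr: "carrier (hom_stalk Y Z q)
      = {hom_of (local_set q) (Y q) (Z q) x | x. is_hom (local_set q) (Y q) (Z q) x}" if "q \<in> P3" for q
    by (rule hom_stalk_carrier[where Y = Y and Z = Z, OF that Y[OF that] Z[OF that]])
  have local_eq: "(\<forall>q\<in>V. section_of Y Z x q f = Z q +>\<^bsub>stalk q\<^esub> g) \<longleftrightarrow> (\<forall>q\<in>V. x q f - g \<in> Z q)"
    if "zopen U" "\<forall>q\<in>U. f \<in> Y q" "V \<subseteq> U" for U V x f g
    using that zopen_subset[OF that(1)] by (intro ball_cong refl eq) blast+
  show ?thesis
  proof (intro subset_antisym subsetI)
    fix \<xi> assume \<xi>: "\<xi> \<in> hom_sections Y Z"
    then have PiE: "\<xi> \<in> (\<Pi>\<^sub>E q\<in>P3. carrier (hom_stalk Y Z q))" by (simp add: hom_sections_def)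
    then have "\<forall>q\<in>P3. \<exists>x. is_hom (local_set q) (Y q) (Z q) x \<and> \<xi> q = hom_of (local_set q) (Y q) (Z q) x"
      using carr by (fastforce simp: PiE_iff)
    then obtain x where x: "\<And>q. q \<in> P3 \<Longrightarrow> is_hom (local_set q) (Y q) (Z q) (x q)"
      "\<And>q. q \<in> P3 \<Longrightarrow> \<xi> q = hom_of (local_set q) (Y q) (Z q) (x q)" by metis
    have "\<xi> = section_of Y Z x"
    proof
      fix q
      show "\<xi> q = section_of Y Z x q"
        using PiE_arb[OF PiE, of q] x(2)[of q] by (cases "q \<in> P3") (simp_all add: section_of_def)
    qed
    moreover have "hom_family Y Z x"
      unfolding hom_family_def
    proof (intro conjI ballI allI impI x(1))
      fix U f p assume U: "zopen U" "f \<in> reg_sections U" "\<forall>q\<in>U. f \<in> Y q" "p \<in> U"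
      with \<xi> obtain V g where "zopen V" "p \<in> V" "V \<subseteq> U" "g \<in> reg_sections V"
        "\<forall>q\<in>V. section_of Y Z x q f = Z q +>\<^bsub>stalk q\<^esub> g"
        unfolding hom_sections_def \<open>\<xi> = section_of Y Z x\<close> by blast
      with local_eq[OF U(1,3)] show "\<exists>V g. zopen V \<and> p \<in> V \<and> V \<subseteq> U \<and> g \<in> reg_sections V \<and>
          (\<forall>q\<in>V. x q f - g \<in> Z q)" by blast
    qed
    ultimately show "\<xi> \<in> {section_of Y Z x | x. hom_family Y Z x}" by blast
  next
    fix \<xi> assume "\<xi> \<in> {section_of Y Z x | x. hom_family Y Z x}"
    then obtain x where x: "hom_family Y Z x" "\<xi> = section_of Y Z x" by blast
    moreover have "section_of Y Z x \<in> (\<Pi>\<^sub>E q\<in>P3. carrier (hom_stalk Y Z q))"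
      using x(1) carr by (auto simp: section_of_def hom_family_def)
    moreover have "\<exists>V g. zopen V \<and> p \<in> V \<and> V \<subseteq> U \<and> g \<in> reg_sections V \<and>
        (\<forall>q\<in>V. section_of Y Z x q f = Z q +>\<^bsub>stalk q\<^esub> g)"
      if U: "zopen U" "f \<in> reg_sections U" "\<forall>q\<in>U. f \<in> Y q" "p \<in> U" for U f p
    proof -
      obtain V g where "zopen V" "p \<in> V" "V \<subseteq> U" "g \<in> reg_sections V" "\<forall>q\<in>V. x q f - g \<in> Z q"
        using x(1) U unfolding hom_family_def by blast
      with local_eq[OF U(1,3)] show ?thesis by blast
    qed
    ultimately show "\<xi> \<in> hom_sections Y Z"
      unfolding hom_sections_def by blast
  qed
qed

section \<open>Gluing and interpolating sections\<close>

lemma idl_local_set: "q \<in> P3 \<Longrightarrow> idl (local_set q) (local_set q)"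
  using subring_local_set[of q] by (auto simp: idl_def subring_set_def)

lemma hom_familyD:
  assumes "hom_family Y Z x" "q \<in> P3"
  shows "f \<in> Y q \<Longrightarrow> x q f \<in> local_set q"
    and "f \<in> Y q \<Longrightarrow> g \<in> Y q \<Longrightarrow> x q (f + g) - (x q f + x q g) \<in> Z q"
    and "a \<in> local_set q \<Longrightarrow> f \<in> Y q \<Longrightarrow> x q (a * f) - a * x q f \<in> Z q"
  using assms by (auto simp: hom_family_def is_hom_def)

lemma hom_family_nbhd:
  assumes "hom_family Y Z x" "zopen U" "f \<in> reg_sections U" "\<And>q. q \<in> U \<Longrightarrow> f \<in> Y q" "p \<in> U"
  obtains V g where "zopen V" "p \<in> V" "V \<subseteq> U" "g \<in> reg_sections V" "\<And>q. q \<in> V \<Longrightarrow> x q f - g \<in> Z q"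
proof -
  have "\<exists>V g. zopen V \<and> p \<in> V \<and> V \<subseteq> U \<and> g \<in> reg_sections V \<and> (\<forall>q\<in>V. x q f - g \<in> Z q)"
    using assms unfolding hom_family_def by simp
  then show ?thesis using that by (elim exE conjE) simp
qed

lemma hom_family_zero:
  assumes "\<And>q. q \<in> P3 \<Longrightarrow> idl (local_set q) (Z q)"
  shows "hom_family Y Z (\<lambda>_ _. 0)"
  unfolding hom_family_def
proof (intro conjI ballI allI impI)
  fix q assume "q \<in> P3"
  then show "is_hom (local_set q) (Y q) (Z q) (\<lambda>_. 0)"
    by (intro is_hom_zero assms subring_local_set)
next
  fix U f p assume U: "zopen U" "p \<in> U"
  have "0 \<in> local_set q" "0 \<in> Z q" if "q \<in> U" for q
    using that zopen_subset[OF U(1)] subring_local_set[of q] idl_zero[OF assms, of q]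
    by (auto simp: subring_set_def)
  then show "\<exists>V g. zopen V \<and> p \<in> V \<and> V \<subseteq> U \<and> g \<in> reg_sections V \<and> (\<forall>q\<in>V. 0 - g \<in> Z q)"
    using U by (intro exI[of _ U] exI[of _ 0]) (auto simp: reg_sections_def)
qed

text \<open>Constants are regular on all of \<open>P3\<close>, so the same combination of local
  lifts is a local lift of the combination.\<close>

lemma hom_family_comb:
  assumes Z: "\<And>q. q \<in> P3 \<Longrightarrow> idl (local_set q) (Z q)"
    and x: "hom_family Y Z x" and y: "hom_family Y Z y"
  shows "hom_family Y Z (\<lambda>q f. x q f + scal c * y q f)"
  unfolding hom_family_def
proof (intro conjI ballI allI impI)
  fix q assume q: "q \<in> P3"
  note R = subring_local_set[OF q]
  show "is_hom (local_set q) (Y q) (Z q) (\<lambda>f. x q f + scal c * y q f)"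
    using x y q
    by (intro is_hom_add[OF R Z[OF q]] is_hom_smult[OF R Z[OF q]] scal_in_local_set)
      (auto simp: hom_family_def)
next
  fix U f p assume U: "zopen U" "f \<in> reg_sections U" "\<forall>q\<in>U. f \<in> Y q" "p \<in> U"
  obtain V g where V: "zopen V" "p \<in> V" "V \<subseteq> U" "g \<in> reg_sections V" "\<And>q. q \<in> V \<Longrightarrow> x q f - g \<in> Z q"
    using hom_family_nbhd[OF x U(1,2) _ U(4)] U(3) by metis
  obtain W h where W: "zopen W" "p \<in> W" "W \<subseteq> U" "h \<in> reg_sections W" "\<And>q. q \<in> W \<Longrightarrow> y q f - h \<in> Z q"
    using hom_family_nbhd[OF y U(1,2) _ U(4)] U(3) by metis
  have *: "g + scal c * h \<in> local_set q \<and> x q f + scal c * y q f - (g + scal c * h) \<in> Z q"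
    if q: "q \<in> V \<inter> W" for q
  proof
    have q3: "q \<in> P3" using q zopen_subset[OF V(1)] by blast
    note R = subring_local_set[OF q3] and s = scal_in_local_set[OF q3, of c]
    show "g + scal c * h \<in> local_set q"
      using q V(4) W(4) R s unfolding reg_sections_def subring_set_def by blast
    have "(x q f - g) + scal c * (y q f - h) \<in> Z q"
      using q V(5) W(5) s by (intro idl_add[OF Z[OF q3]] idl_mult[OF Z[OF q3]]) auto
    then show "x q f + scal c * y q f - (g + scal c * h) \<in> Z q" by (simp add: algebra_simps)
  qed
  then show "\<exists>V g. zopen V \<and> p \<in> V \<and> V \<subseteq> U \<and> g \<in> reg_sections V \<and>
      (\<forall>q\<in>V. x q f + scal c * y q f - g \<in> Z q)"
    using V(1-3) W(1,2) zopen_Int[OF V(1) W(1)]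
    by (intro exI[of _ "V \<inter> W"] exI[of _ "g + scal c * h"]) (auto simp: reg_sections_def)
qed

text \<open>From x - z = c + e one gets h = x - c = z + e, which represents x modulo C and z modulo
  E at once and is therefore linear modulo the intersection of the two ideals.\<close>

lemma glue_hom_families:
  assumes C: "closed_subscheme C" and E: "closed_subscheme E"
    and D: "\<And>q. q \<in> P3 \<Longrightarrow> D q = C q \<inter> E q"
    and x: "hom_family C C x" and z: "hom_family E E z"
    and agree: "\<And>q f. q \<in> P3 \<Longrightarrow> f \<in> D q \<Longrightarrow> \<exists>c\<in>C q. \<exists>e\<in>E q. x q f - z q f = c + e"
  obtains h where "hom_family D D h" "\<And>q f. q \<in> P3 \<Longrightarrow> f \<in> D q \<Longrightarrow> h q f - x q f \<in> C q"
proof -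
  note Ci = closed_subscheme_ideal[OF C] and Ei = closed_subscheme_ideal[OF E]
  obtain c e where ce: "\<And>q f. q \<in> P3 \<Longrightarrow> f \<in> D q \<Longrightarrow>
      c q f \<in> C q \<and> e q f \<in> E q \<and> x q f - z q f = c q f + e q f"
    using agree by metis
  define h where "h q f = x q f - c q f" for q f
  have hC: "x q f - h q f \<in> C q" and hE: "z q f - h q f \<in> E q" if "q \<in> P3" "f \<in> D q" for q f
  proof -
    have "z q f - h q f = - e q f" using ce[OF that] by (simp add: h_def algebra_simps)
    then show "z q f - h q f \<in> E q"
      using ce[OF that] idl_uminus[OF subring_local_set Ei] that by simp
    show "x q f - h q f \<in> C q" using ce[OF that] by (simp add: h_def)
  qed
  have "hom_family D D h"
    unfolding hom_family_def
  proof (intro conjI ballI allI impI)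
    fix q assume q: "q \<in> P3"
    note R = subring_local_set[OF q]
    have Di: "f + g \<in> D q" "a * f \<in> D q" "f \<in> C q" "f \<in> E q"
      if "f \<in> D q" "g \<in> D q" "a \<in> local_set q" for f g a
      using that idl_add[OF Ci[OF q]] idl_add[OF Ei[OF q]] idl_mult[OF Ci[OF q]] idl_mult[OF Ei[OF q]]
      by (auto simp: D[OF q])
    have DI: "v \<in> D q" if "v \<in> C q" "v \<in> E q" for v using that D[OF q] by blast
    have zero: "0 \<in> local_set q" "1 \<in> local_set q" using R by (auto simp: subring_set_def)
    show "is_hom (local_set q) (D q) (D q) (h q)"
      unfolding is_hom_def
    proof (intro conjI ballI)
      fix f assume f: "f \<in> D q"
      have "x q f \<in> local_set q" using f by (intro hom_familyD(1)[OF x q]) (simp add: D[OF q])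
      from idl_diff[OF R idl_local_set[OF q] this idl_subset[OF Ci[OF q] hC[OF q f]]]
      show "h q f \<in> local_set q" by simp
    next
      fix f g assume fg: "f \<in> D q" "g \<in> D q"
      note m = Di(3,4)[OF fg(1) fg(2) zero(1)] Di(3,4)[OF fg(2) fg(2) zero(1)] Di(1)[OF fg zero(1)]
      show "h q (f + g) - (h q f + h q g) \<in> D q"
      proof (rule DI)
        have "(x q (f + g) - (x q f + x q g)) - (x q (f + g) - h q (f + g))
            + ((x q f - h q f) + (x q g - h q g)) \<in> C q"
          using m by (intro idl_add[OF Ci[OF q]] idl_diff[OF R Ci[OF q]] hC[OF q] fg hom_familyD(2)[OF x q])
        then show "h q (f + g) - (h q f + h q g) \<in> C q" by (simp add: algebra_simps)
        have "(z q (f + g) - (z q f + z q g)) - (z q (f + g) - h q (f + g))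
            + ((z q f - h q f) + (z q g - h q g)) \<in> E q"
          using m by (intro idl_add[OF Ei[OF q]] idl_diff[OF R Ei[OF q]] hE[OF q] fg hom_familyD(2)[OF z q])
        then show "h q (f + g) - (h q f + h q g) \<in> E q" by (simp add: algebra_simps)
      qed
    next
      fix a f assume a: "a \<in> local_set q" and f: "f \<in> D q"
      note m = Di(2-4)[OF f f a]
      show "h q (a * f) - a * h q f \<in> D q"
      proof (rule DI)
        have "(x q (a * f) - a * x q f) - (x q (a * f) - h q (a * f)) + a * (x q f - h q f) \<in> C q"
          using m a f by (intro idl_add[OF Ci[OF q]] idl_diff[OF R Ci[OF q]] idl_mult[OF Ci[OF q]]
              hC[OF q] hom_familyD(3)[OF x q])
        then show "h q (a * f) - a * h q f \<in> C q" by (simp add: algebra_simps)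
        have "(z q (a * f) - a * z q f) - (z q (a * f) - h q (a * f)) + a * (z q f - h q f) \<in> E q"
          using m a f by (intro idl_add[OF Ei[OF q]] idl_diff[OF R Ei[OF q]] idl_mult[OF Ei[OF q]]
              hE[OF q] hom_familyD(3)[OF z q])
        then show "h q (a * f) - a * h q f \<in> E q" by (simp add: algebra_simps)
      qed
    qed
  next
    fix U f p assume U: "zopen U" "f \<in> reg_sections U" "\<forall>q\<in>U. f \<in> D q" "p \<in> U"
    have U3: "q \<in> P3" if "q \<in> U" for q using that zopen_subset[OF U(1)] by blast
    have fC: "f \<in> C q" and fE: "f \<in> E q" if "q \<in> U" for q using that U(3) D[OF U3] by auto
    obtain V1 g1 where V1: "zopen V1" "p \<in> V1" "V1 \<subseteq> U" "g1 \<in> reg_sections V1"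
      "\<And>q. q \<in> V1 \<Longrightarrow> x q f - g1 \<in> C q"
      using hom_family_nbhd[OF x U(1,2) fC U(4)] by metis
    obtain V2 g2 where V2: "zopen V2" "p \<in> V2" "V2 \<subseteq> U" "g2 \<in> reg_sections V2"
      "\<And>q. q \<in> V2 \<Longrightarrow> z q f - g2 \<in> E q"
      using hom_family_nbhd[OF z U(1,2) fE U(4)] by metis
    note p = U3[OF U(4)]
    have fD: "f \<in> D p" using U(3,4) by blast
    \<comment> \<open>The splitting c + e need not be regular in q. For the lift it is used at p
      alone, to split g1 - g2 into germs a and b of the two ideals; these extend to a neighbourhood,
      where g1 - a = g2 + b lifts h modulo both.\<close>
    define a b where "a = c p f - (x p f - g1)" and "b = e p f + (z p f - g2)"
    have "a \<in> C p" "b \<in> E p"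
      unfolding a_def b_def
      using ce[OF p fD] V1(5)[OF V1(2)] V2(5)[OF V2(2)]
      by (auto intro: idl_diff[OF subring_local_set[OF p] Ci[OF p]] idl_add[OF Ei[OF p]])
    moreover have ab: "g1 - g2 = a + b" using ce[OF p fD] by (simp add: a_def b_def algebra_simps)
    ultimately obtain W1 W2 where W1: "zopen W1" "p \<in> W1" "a \<in> reg_sections W1" "\<forall>q\<in>W1. a \<in> C q"
      and W2: "zopen W2" "p \<in> W2" "b \<in> reg_sections W2" "\<forall>q\<in>W2. b \<in> E q"
      using subscheme_nbhd[OF C p] subscheme_nbhd[OF E p] by metis
    define V where "V = V1 \<inter> V2 \<inter> (W1 \<inter> W2)"
    have V: "zopen V" "p \<in> V" "V \<subseteq> U"
      using V1 V2 W1 W2 by (auto simp: V_def intro: zopen_Int)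
    have "g1 - a \<in> local_set q \<and> h q f - (g1 - a) \<in> D q" if q: "q \<in> V" for q
    proof
      have qU: "q \<in> U" using q V(3) by blast
      note q3 = U3[OF qU] and fq = bspec[OF U(3) qU]
      note R = subring_local_set[OF q3]
      have mem: "a \<in> C q" "b \<in> E q" "x q f - g1 \<in> C q" "z q f - g2 \<in> E q"
        "g1 \<in> local_set q" "a \<in> local_set q"
        using q V1(4,5) V2(5) W1 W2 by (auto simp: V_def reg_sections_def)
      show "g1 - a \<in> local_set q"
        using mem(5,6) by (rule idl_diff[OF R idl_local_set[OF q3]])
      have "h q f - (g1 - a) \<in> C q"
        using idl_add[OF Ci[OF q3] idl_diff[OF R Ci[OF q3] mem(3) hC[OF q3 fq]] mem(1)]
        by (simp add: algebra_simps)
      moreover from idl_diff[OF R Ei[OF q3] idl_diff[OF R Ei[OF q3] mem(4) hE[OF q3 fq]] mem(2)]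
      have "h q f - (g2 + b) \<in> E q" by (simp add: algebra_simps)
      moreover have "g2 + b = g1 - a" using ab by (simp add: algebra_simps)
      ultimately show "h q f - (g1 - a) \<in> D q" by (simp add: D[OF q3])
    qed
    then show "\<exists>V g. zopen V \<and> p \<in> V \<and> V \<subseteq> U \<and> g \<in> reg_sections V \<and> (\<forall>q\<in>V. h q f - g \<in> D q)"
      using V by (intro exI[of _ V] exI[of _ "g1 - a"]) (auto simp: reg_sections_def)
  qed
  moreover have "h q f - x q f \<in> C q" if "q \<in> P3" "f \<in> D q" for q f
    using idl_uminus[OF subring_local_set[OF that(1)] Ci[OF that(1)] hC[OF that]] by simp
  ultimately show ?thesis using that by blast
qed

section \<open>First order freeness in terms of representatives\<close>

lemma idl_reduced_points: "q \<in> P3 \<Longrightarrow> idl (local_set q) (reduced_points S q)"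
  by (simp add: reduced_points_def idl_local_max idl_local_set)

lemma supp_local_max:
  assumes "closed_subscheme Y" "q \<in> supp Y"
  shows "Y q \<subseteq> local_max q"
  using proper_ideal_in_local_max[OF _ closed_subscheme_ideal[OF assms(1)], of q] assms(2)
  by (simp add: supp_def)

text \<open>At q in S - {p} the vanishing restriction puts \<xi> into the maximal ideal times the
  normal stalk, whose members take values in that ideal. \<open>r_map\<close> is reduction of y
  modulo the ideal of {p}; away from p the target is zero, so it can be nonzero only at p.\<close>

lemma first_order_free_family:
  assumes E: "closed_subscheme E" and XE: "subscheme E X"
    and S: "S \<subseteq> supp E" and free: "first_order_free E X S" and p: "p \<in> S"
  obtains y where "hom_family E E y" "\<And>q f. q \<in> S - {p} \<Longrightarrow> f \<in> E q \<Longrightarrow> y q f \<in> local_max q"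
    "\<exists>f\<in>X p. y p f \<notin> local_max p"
proof -
  note Ei = closed_subscheme_ideal[OF E]
  obtain \<xi> where \<xi>: "\<xi> \<in> normal_sections E"
    and rc: "rc_map E S p \<xi> = zero_restricted E (reduced_points (S - {p}))"
    and r: "r_map E X p \<xi> \<noteq> zero_hom X (reduced_points {p})"
    using free p unfolding first_order_free_def by blast
  obtain y where y: "hom_family E E y" and \<xi>y: "\<xi> = section_of E E y"
    using \<xi> hom_sections_eq[of E E, OF Ei Ei] by blast
  have hom: "is_hom (local_set q) (E q) (E q) (y q)" if "q \<in> P3" for q
    using y that by (simp add: hom_family_def)
  have \<xi>q: "\<xi> q = hom_of (local_set q) (E q) (E q) (y q)" if "q \<in> P3" for q
    using that by (simp add: \<xi>y section_of_def)
  have sub: "E q \<subseteq> reduced_points T q" if "q \<in> P3" "T \<subseteq> S" for q T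
    using that S supp_local_max[OF E] idl_subset[OF Ei[OF that(1)]]
    by (auto simp: reduced_points_def)
  have "y q f \<in> local_max q" if q: "q \<in> S - {p}" and f: "f \<in> E q" for q f
  proof -
    have q3: "q \<in> P3" using q S by (auto simp: supp_def)
    note R = subring_local_set[OF q3]
    let ?Z = "reduced_points (S - {p})"
    note Zi = idl_reduced_points[OF q3, of "S - {p}"]
    have subq: "E q \<subseteq> ?Z q" by (rule sub[OF q3]) blast
    have "\<xi> q \<in> restrict_normal E ?Z \<xi> q"
      by (rule restrict_normal_members(1)[where Y = E and Z = ?Z and \<xi> = \<xi> and q = q,
            OF q3 Ei[OF q3] Zi subq hom[OF q3] \<xi>q[OF q3]])
    also have "restrict_normal E ?Z \<xi> q = ideal_smult (stalk q) (?Z q) (normal_stalk E q)"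
      using rc q3 by (simp add: rc_map_def zero_restricted_def fun_eq_iff)
    finally obtain v where v: "\<xi> q = hom_of (local_set q) (E q) (E q) v" "\<forall>f\<in>E q. v f \<in> ?Z q"
      using ideal_smult_normal(2)[where Y = E, OF q3 Ei[OF q3] Zi subq] by blast
    have "y q f - v f \<in> E q"
      using v(1) f unfolding \<xi>q[OF q3] hom_of_cong[OF R Ei[OF q3]] by blast
    then have "(y q f - v f) + v f \<in> ?Z q" using subq v(2) f by (intro idl_add[OF Zi]) auto
    then show ?thesis using q by (simp add: reduced_points_def)
  qed
  moreover have "\<exists>f\<in>X p. y p f \<notin> local_max p"
  proof (rule ccontr)
    assume neg: "\<not> ?thesis"
    let ?Z = "reduced_points {p}"
    have "r_map E X p \<xi> q = zero_hom X ?Z q" for q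
    proof (cases "q \<in> P3")
      case q: True
      note R = subring_local_set[OF q] and Zi = idl_reduced_points[OF q, of "{p}"]
      have XEq: "X q \<subseteq> E q" using XE q by (simp add: subscheme_def)
      have subq: "E q \<subseteq> ?Z q" using p by (intro sub[OF q]) simp
      have "r_map E X p \<xi> q f = zero_hom X ?Z q f" for f
      proof (cases "f \<in> X q")
        case f: True
        have "y q f \<in> ?Z q"
          using neg f XEq hom[OF q] by (auto simp: reduced_points_def is_hom_def)
        then have "coset (local_set q) (?Z q) (y q f) = ?Z q"
          using coset_eq_iff[OF R Zi, of "y q f" 0] by (simp add: coset_zero)
        then show ?thesis
          using induced_restrict[where Y = E and Z = ?Z and W = X and f = f and q = q and \<xi> = \<xi>,
              OF q Ei[OF q] Zi subq XEq f hom[OF q] \<xi>q[OF q]] q f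
          by (simp add: r_map_def zero_hom_def)
      qed (simp add: r_map_def zero_hom_def induced_hom_def q)
      then show ?thesis by blast
    qed (simp add: r_map_def zero_hom_def induced_hom_def)
    with r show False by blast
  qed
  ultimately show ?thesis using that y by blast
qed

text \<open>
  Constant multiples suffice to prescribe the values at \<open>S\<close> because the residue fields there
  are \<open>\<complex>\<close>.
\<close>

lemma interpolate_sections:
  assumes Ei: "\<And>q. q \<in> P3 \<Longrightarrow> idl (local_set q) (E q)"
    and S: "\<And>p. p \<in> S \<Longrightarrow> closed_point p" and g: "\<And>p. p \<in> S \<Longrightarrow> g p \<in> E p"
    and y: "\<And>p. p \<in> S \<Longrightarrow> hom_family E E (y p)"
    and off: "\<And>p q f. p \<in> S \<Longrightarrow> q \<in> S - {p} \<Longrightarrow> f \<in> E q \<Longrightarrow> y p q f \<in> local_max q"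
    and at: "\<And>p. p \<in> S \<Longrightarrow> y p p (g p) \<notin> local_max p"
    and t: "\<And>p. p \<in> S \<Longrightarrow> t p \<in> local_set p"
    and T: "finite T" "T \<subseteq> S"
  shows "\<exists>z. hom_family E E z \<and> (\<forall>p\<in>T. z p (g p) - t p \<in> local_max p) \<and>
           (\<forall>p\<in>S - T. \<forall>f\<in>E p. z p f \<in> local_max p)"
  using T
proof (induction T)
  case empty
  have "0 \<in> local_max p" if "p \<in> S" for p
    using idl_zero[OF idl_local_max[OF closed_point_P3[OF S[OF that]]]] .
  then show ?case using hom_family_zero[of E E, OF Ei] by auto
next
  case (insert p T)
  then obtain z where z: "hom_family E E z" "\<And>p. p \<in> T \<Longrightarrow> z p (g p) - t p \<in> local_max p"
    "\<And>p f. p \<in> S - T \<Longrightarrow> f \<in> E p \<Longrightarrow> z p f \<in> local_max p" by blast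
  have pS: "p \<in> S" using insert.prems by blast
  note p3 = closed_point_P3[OF S[OF pS]]
  note R = subring_local_set[OF p3] and m = idl_local_max[OF p3]
  obtain a where a: "t p - scal a \<in> local_max p" using residue_field[OF S[OF pS] t[OF pS]] by blast
  obtain b where b: "y p p (g p) - scal b \<in> local_max p"
    using residue_field[OF S[OF pS] hom_familyD(1)[OF y[OF pS] p3 g[OF pS]]] by blast
  have "b \<noteq> 0" using at[OF pS] b by (auto simp: fract_collapse)
  then have ab: "scal (a / b) * scal b = scal a" by (simp add: mult_single)
  \<comment> \<open>The old z has values in the maximal ideal at p, and a/b times the residue b is
    the wanted residue a. At the other points of S the added multiple of \<open>y p\<close> lies in
    the maximal ideal.\<close>
  define z' where "z' q f = z q f + scal (a / b) * y p q f" for q f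
  have "hom_family E E z'" unfolding z'_def by (rule hom_family_comb[OF Ei z(1) y[OF pS]])
  moreover have "z' q f - z q f \<in> local_max q" if "q \<in> S - {p}" "f \<in> E q" for q f
  proof -
    have q3: "q \<in> P3" using that S closed_point_P3 by blast
    show ?thesis
      using idl_mult[OF idl_local_max[OF q3] scal_in_local_set[OF q3] off[OF pS that]]
      by (simp add: z'_def)
  qed note old = this
  have "z' p (g p) - t p \<in> local_max p"
  proof -
    have "z' p (g p) - t p = z p (g p) + scal (a / b) * (y p p (g p) - scal b) - (t p - scal a)"
      by (simp add: z'_def right_diff_distrib ab del: mult_fract)
    also have "\<dots> \<in> local_max p"
      using z(3)[of p] pS insert.hyps(2) g[OF pS]
      by (intro idl_diff[OF R m] idl_add[OF m] idl_mult[OF m] a b scal_in_local_set[OF p3]) auto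
    finally show ?thesis .
  qed
  moreover have "z' q (g q) - t q \<in> local_max q" if q: "q \<in> T" for q
  proof -
    have qS: "q \<in> S - {p}" using q insert by blast
    have "(z' q (g q) - z q (g q)) + (z q (g q) - t q) \<in> local_max q"
      using qS g by (intro idl_add[OF idl_local_max] closed_point_P3 S old z(2) q) auto
    then show ?thesis by simp
  qed
  moreover have "z' q f \<in> local_max q" if q: "q \<in> S - insert p T" "f \<in> E q" for q f
  proof -
    have "(z' q f - z q f) + z q f \<in> local_max q"
      using q by (intro idl_add[OF idl_local_max] closed_point_P3 S old z(3)) auto
    then show ?thesis by simp
  qed
  ultimately show ?case by (intro exI[of _ z']) blast
qed


section \<open>The union of two curves\<close>

lemma divisor_add_subset:
  assumes q: "q \<in> P3" and C: "idl (local_set q) (C q)" and E: "idl (local_set q) (E q)"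
    and X: "X q \<subseteq> C q" "X q \<subseteq> E q"
  shows "divisor_add X C E q \<subseteq> C q \<inter> E q"
proof -
  note R = subring_local_set[OF q]
  interpret cring "ring_on (local_set q)" by (rule cring_ring_on[OF R])
  have "C q \<cdot>\<^bsub>ring_on (local_set q)\<^esub> E q \<subseteq> C q \<inter> E q"
    using C E by (intro ideal_prod_inter) (simp_all add: ideal_iff_idl[OF R])
  moreover have "s + w \<in> C q \<inter> E q" if "s \<in> C q \<inter> E q" "w \<in> X q" for s w
    using that X by (auto intro: idl_add[OF C] idl_add[OF E])
  ultimately show ?thesis
    unfolding divisor_add_def stalk_def subset_iff set_add_iff by blast
qed

lemma divisor_addI:
  assumes "c1 \<in> C q" "e1 \<in> E q" "c2 \<in> C q" "e2 \<in> E q" "w \<in> X q"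
  shows "c1 * e1 + c2 * e2 + w \<in> divisor_add X C E q"
proof -
  have "c1 * e1 + c2 * e2 \<in> C q \<cdot>\<^bsub>ring_on (local_set q)\<^esub> E q"
    using ideal_prod.sum[OF ideal_prod.prod[OF assms(1,2)] ideal_prod.prod[OF assms(3,4)],
        of "ring_on (local_set q)"] by simp
  with assms(5) show ?thesis by (auto simp: divisor_add_def stalk_def set_add_iff)
qed

text \<open>The \<open>add\<close> case also supplies membership of both summands in the divisor
  ideal: a homomorphism is additive only on the ideal where it is defined.\<close>

lemma divisor_add_induct [consumes 1, case_names prod add base]:
  assumes "f \<in> divisor_add X C E q"
    and "\<And>c e. c \<in> C q \<Longrightarrow> e \<in> E q \<Longrightarrow> P (c * e)"
    and "\<And>f g. f \<in> divisor_add X C E q \<Longrightarrow> g \<in> divisor_add X C E q \<Longrightarrow> P f \<Longrightarrow> P g \<Longrightarrow> P (f + g)"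
    and "\<And>w. w \<in> X q \<Longrightarrow> P w" and "0 \<in> X q" and "0 \<in> C q \<and> 0 \<in> E q"
  shows "P f"
proof -
  obtain s w where s: "s \<in> C q \<cdot>\<^bsub>ring_on (local_set q)\<^esub> E q" and w: "w \<in> X q" and f: "f = s + w"
    using assms(1) by (auto simp: divisor_add_def stalk_def set_add_iff)
  have D: "u \<in> divisor_add X C E q" if "u \<in> C q \<cdot>\<^bsub>ring_on (local_set q)\<^esub> E q" for u
  proof -
    have "u = u + 0" by simp
    then show ?thesis
      using that assms(5) unfolding divisor_add_def stalk_def set_add_iff by blast
  qed
  have "P s"
    using s
  proof (induction rule: ideal_prod.induct)
    case (prod c e)
    then show ?case using assms(2) by simp
  next
    case (sum s1 s2)
    then show ?case using assms(3)[OF D D] by simp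
  qed
  moreover have "w \<in> divisor_add X C E q"
    using divisor_addI[of 0 C q 0 E 0 0 w X] w assms(6) by simp
  ultimately show ?thesis unfolding f using assms(3)[OF D[OF s]] assms(4)[OF w] by blast
qed

lemma divisor_multiple_one:
  assumes q: "q \<in> P3" and E: "idl (local_set q) (E q)" and X: "X q \<subseteq> E q" "0 \<in> X q"
  shows "divisor_multiple X 1 E q = E q"
proof -
  have eq: "divisor_multiple X 1 E = divisor_add X E local_set"
    by (simp add: divisor_multiple_def)
  have "divisor_add X E local_set q \<subseteq> E q \<inter> local_set q"
    using X idl_subset[OF E] by (intro divisor_add_subset[where C = E and E = local_set, OF q E idl_local_set[OF q]]) auto
  moreover have "f \<in> divisor_add X E local_set q" if "f \<in> E q" for f
    using divisor_addI[of f E q 1 local_set 0 0 0 X] that X(2) idl_zero[OF E] subring_local_set[OF q]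
    by (simp add: subring_set_def)
  ultimately show ?thesis unfolding eq by blast
qed

lemma smooth_surface_ideal:
  assumes X: "smooth_surface d X" and q: "q \<in> P3"
  shows "idl (local_set q) (X q)"
proof -
  note R = subring_local_set[OF q]
  obtain g where g: "X q = {r * g | r. r \<in> local_set q}" "g \<in> local_set q"
    using smooth_surface_principal[OF X q] by blast
  have zero: "idl (local_set q) {0}" using R by (auto simp: idl_def subring_set_def)
  have "X q = {y. \<exists>r\<in>local_set q. y - r * g \<in> {0}}" unfolding g(1) by auto
  then show ?thesis using idl_adjoin[OF R zero g(2)] by simp
qed

section \<open>Absence of embedded points and the ideal of C + E at points of C.E\<close>

lemma curve_no_closed_assoc:
  assumes "curve C" "closed_point p"
  shows "\<not> (\<exists>s\<in>local_set p. local_max p = {a \<in> local_set p. a * s \<in> C p})"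
proof
  assume "\<exists>s\<in>local_set p. local_max p = {a \<in> local_set p. a * s \<in> C p}"
  then have "assoc_point C p"
    using closed_point_P3[OF assms(2)] by (simp add: assoc_point_def)
  then have "closure_dim p = 1" using assms(1) by (simp add: curve_def)
  then show False by (simp add: closure_dim_closed_point[OF assms(2)])
qed

text \<open>Otherwise the maximal ideal would be the annihilator of 1 modulo C, and the closed point
  p an associated point of the curve.\<close>

lemma curve_ne_local_max:
  assumes C: "curve C" and p: "closed_point p"
  shows "C p \<noteq> local_max p"
proof
  note p3 = closed_point_P3[OF p]
  assume eq: "C p = local_max p"
  have "local_max p = {a \<in> local_set p. a * 1 \<in> C p}"
    using idl_subset[OF idl_local_max[OF p3]] by (auto simp: eq)
  then show False
    using curve_no_closed_assoc[OF C p] subring_local_set[OF p3] by (auto simp: subring_set_def)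
qed

lemma transversal_intersection:
  assumes X: "smooth_surface d X" and C: "curve C" "subscheme C X" and E: "curve E" "subscheme E X"
    and p: "closed_point p" and pE: "p \<in> supp E" and pC: "p \<in> supp C"
    and sum: "\<And>f. f \<in> local_max p \<Longrightarrow> \<exists>c\<in>C p. \<exists>e\<in>E p. f = c + e"
  shows "C p \<inter> E p \<subseteq> divisor_add X C E p"
proof
  note p3 = closed_point_P3[OF p] and R = subring_local_set[OF closed_point_P3[OF p]]
  have cs: "closed_subscheme C" "closed_subscheme E" using C E by (auto simp: curve_def)
  note Ci = closed_subscheme_ideal[OF cs(1) p3] and Ei = closed_subscheme_ideal[OF cs(2) p3]
  note Xi = smooth_surface_ideal[OF X p3]
  have XC: "X p \<subseteq> C p" "X p \<subseteq> E p" using C E p3 by (auto simp: subscheme_def)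
  have Cm: "C p \<subseteq> local_max p" "E p \<subseteq> local_max p" using supp_local_max cs pC pE by blast+
  obtain u v where uv: "u \<in> local_max p" "v \<in> local_max p"
    and gen_uv: "\<forall>f\<in>local_max p. \<exists>a\<in>local_set p. \<exists>b\<in>local_set p. \<exists>w\<in>X p. f = a * u + b * v + w"
    using smooth_surface_max_ideal[OF X p subset_trans[OF XC(1) Cm(1)]] by (elim bexE)
  have "\<exists>x\<in>C p. \<exists>y\<in>E p. \<forall>f\<in>local_max p.
      \<exists>a\<in>local_set p. \<exists>b\<in>local_set p. \<exists>w\<in>X p. f = a * x + b * y + w"
    by (rule transversal_generators[OF p3 Ci Ei XC Xi Cm curve_ne_local_max[OF C(1) p]
          curve_ne_local_max[OF E(1) p] sum uv bspec[OF gen_uv]])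
  then obtain x y where x: "x \<in> C p" and y: "y \<in> E p" and gen: "\<And>f. f \<in> local_max p \<Longrightarrow>
      \<exists>a\<in>local_set p. \<exists>b\<in>local_set p. \<exists>w\<in>X p. f = a * x + b * y + w" by blast
  have gen': "\<exists>a\<in>local_set p. \<exists>b\<in>local_set p. \<exists>w\<in>X p. f = a * y + b * x + w"
    if f: "f \<in> local_max p" for f
  proof -
    obtain a b w where "a \<in> local_set p" "b \<in> local_set p" "w \<in> X p" "f = a * x + b * y + w"
      using gen[OF f] by blast
    then show ?thesis by (intro bexI[of _ b] bexI[of _ a] bexI[of _ w]) (simp_all add: add.commute)
  qed
  fix f assume f: "f \<in> C p \<inter> E p"
  then obtain a b w where ab: "a \<in> local_set p" "b \<in> local_set p" "w \<in> X p" "f = a * x + b * y + w"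
    using gen Cm by blast
  have "f - a * x - w \<in> C p"
    using f ab x XC by (intro idl_diff[OF R Ci] idl_mult[OF Ci]) auto
  then have yb: "y * b \<in> C p" by (simp add: ab(4) mult.commute)
  have b: "b \<in> C p"
    by (rule nonzerodivisor_mod[OF p3 Ci XC(1) curve_no_closed_assoc[OF C(1) p] x gen ab(2) yb])
  have "f - b * y - w \<in> E p"
    using f ab y XC by (intro idl_diff[OF R Ei] idl_mult[OF Ei]) auto
  then have xa: "x * a \<in> E p" by (simp add: ab(4) mult.commute)
  have a: "a \<in> E p"
    by (rule nonzerodivisor_mod[OF p3 Ei XC(2) curve_no_closed_assoc[OF E(1) p] y gen' ab(1) xa])
  show "f \<in> divisor_add X C E p"
    using divisor_addI[where C = C and E = E and X = X, OF x a b y ab(3)] by (simp add: ab(4) mult.commute)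
qed

theorem simple_extension_of_first_order_free:
  assumes X: "smooth_surface d X" and E: "curve E" "integral_scheme E" "subscheme E X"
    and S: "finite S" "S \<subseteq> {p \<in> supp E. closed_point p}" and free: "first_order_free E X S"
    and C: "curve C" "subscheme C X" and CE: "subscheme (scheme_inter C E) (reduced_points S)"
  shows "simple_extension X C (divisor_add X C E)"
proof -
  have cs: "closed_subscheme C" "closed_subscheme E" using C E by (auto simp: curve_def)
  note Ci = closed_subscheme_ideal[OF cs(1)] and Ei = closed_subscheme_ideal[OF cs(2)]
  note Xi = smooth_surface_ideal[OF X]
  have XC: "X q \<subseteq> C q" and XE: "X q \<subseteq> E q" if "q \<in> P3" for q
    using C E that by (auto simp: subscheme_def)
  have SE: "S \<subseteq> supp E" and Sc: "\<And>p. p \<in> S \<Longrightarrow> closed_point p" using S(2) by auto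
  \<comment> \<open>The inclusion C.E \<subseteq> S of schemes: I_C + I_E contains the maximal ideal
    at points of S and is the whole ring elsewhere.\<close>
  have sum: "\<exists>c\<in>C q. \<exists>e\<in>E q. f = c + e" if "q \<in> P3" "f \<in> reduced_points S q" for q f
    using CE that by (auto simp: subscheme_def scheme_inter_def stalk_def set_add_iff subset_iff)
  define D where "D = divisor_add X C E"
  \<comment> \<open>Off S one has 1 = c + e, while at a common point of the supports c and e both
    lie in the maximal ideal.\<close>
  have meet: "q \<in> S" if "q \<in> supp E" "q \<in> supp C" for q
  proof (rule ccontr)
    assume "q \<notin> S"
    have q: "q \<in> P3" using that by (simp add: supp_def)
    have "1 \<in> reduced_points S q"
      using \<open>q \<notin> S\<close> subring_local_set[OF q] by (simp add: reduced_points_def subring_set_def)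
    then obtain c e where "c \<in> C q" "e \<in> E q" "1 = c + e" using sum[OF q] by blast
    then have "1 \<in> local_max q"
      using supp_local_max[OF cs(1) that(2)] supp_local_max[OF cs(2) that(1)]
        idl_add[OF idl_local_max[OF q], of c e] by auto
    with one_notin_local_max[OF q] show False ..
  qed
  have all: "\<exists>c\<in>C q. \<exists>e\<in>E q. f = c + e"
    if q: "q \<in> P3" and ns: "\<not> (q \<in> supp E \<and> q \<in> supp C)" and f: "f \<in> local_set q" for q f
  proof -
    have "C q = local_set q \<or> E q = local_set q" using q ns by (auto simp: supp_def)
    then show ?thesis
      using f idl_zero[OF Ci[OF q]] idl_zero[OF Ei[OF q]]
      by (metis add.left_neutral add.right_neutral)
  qed
  have DCE: "D q = C q \<inter> E q" if q: "q \<in> P3" for q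
  proof
    show "D q \<subseteq> C q \<inter> E q"
      unfolding D_def by (rule divisor_add_subset[where C = C and E = E and X = X, OF q Ci[OF q] Ei[OF q] XC[OF q] XE[OF q]])
    show "C q \<inter> E q \<subseteq> D q"
    proof (cases "q \<in> supp E \<and> q \<in> supp C")
      case True
      have "\<exists>c\<in>C q. \<exists>e\<in>E q. f = c + e" if "f \<in> local_max q" for f
        using sum[OF q, of f] that meet True by (simp add: reduced_points_def)
      then show ?thesis
        unfolding D_def using True Sc[OF meet]
        by (intro transversal_intersection[OF X C E(1,3)]) auto
    next
      case False
      have "1 \<in> local_set q" using subring_local_set[OF q] by (simp add: subring_set_def)
      then obtain c e where ce: "c \<in> C q" "e \<in> E q" "1 = c + e" using all[OF q False] by blast
      show ?thesis
      proof
        fix f assume f: "f \<in> C q \<inter> E q"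
        \<comment> \<open>For comaximal ideals, 1 = c + e writes an element f of the intersection as
          a sum of two products.\<close>
        have "c * f + f * e + 0 = (c + e) * f" by (simp add: algebra_simps)
        also have "\<dots> = f" by (simp flip: ce(3))
        finally show "f \<in> D q"
          unfolding D_def
          using divisor_addI[of c C q f E f e 0 X] ce f idl_zero[OF Xi[OF q]] by simp
      qed
    qed
  qed
  have "\<exists>y. hom_family E E y \<and> (\<forall>q f. q \<in> S - {p} \<longrightarrow> f \<in> E q \<longrightarrow> y q f \<in> local_max q) \<and>
      (\<exists>f\<in>X p. y p f \<notin> local_max p)" if "p \<in> S" for p
    using first_order_free_family[OF cs(2) E(3) SE free that] by metis
  then obtain y where y: "\<And>p. p \<in> S \<Longrightarrow> hom_family E E (y p)"
    "\<And>p q f. p \<in> S \<Longrightarrow> q \<in> S - {p} \<Longrightarrow> f \<in> E q \<Longrightarrow> y p q f \<in> local_max q"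
    "\<And>p. p \<in> S \<Longrightarrow> \<exists>f\<in>X p. y p p f \<notin> local_max p" by metis
  have "\<forall>p\<in>S. \<exists>g. g \<in> X p \<and> X p = {r * g | r. r \<in> local_set p}"
    using smooth_surface_principal[OF X] closed_point_P3 Sc by blast
  from bchoice[OF this] obtain g where "\<forall>p\<in>S. g p \<in> X p \<and> X p = {r * g p | r. r \<in> local_set p}" ..
  then have g: "g p \<in> X p" "X p = {r * g p | r. r \<in> local_set p}" if "p \<in> S" for p
    using that by (blast, blast)
  have gE: "g p \<in> E p" and gC: "g p \<in> C p" if "p \<in> S" for p
    using g(1)[OF that] XE XC closed_point_P3[OF Sc[OF that]] by blast+
  \<comment> \<open>The value on r g is r times the value on g modulo the maximal ideal, so a
    section that is nonzero at p somewhere on \<open>X p\<close> is nonzero on the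
    generator.\<close>
  have y_g: "y p p (g p) \<notin> local_max p" if p: "p \<in> S" for p
  proof
    note p3 = closed_point_P3[OF Sc[OF p]]
    note m = idl_local_max[OF p3]
    assume yg: "y p p (g p) \<in> local_max p"
    obtain f where f: "f \<in> X p" "y p p f \<notin> local_max p" using y(3)[OF p] by blast
    then obtain r where r: "r \<in> local_set p" "f = r * g p" using g(2)[OF p] by auto
    have "y p p (r * g p) - r * y p p (g p) \<in> local_max p"
      using hom_familyD(3)[OF y(1)[OF p] p3 r(1) gE[OF p]] supp_local_max[OF cs(2)] SE p by blast
    from idl_add[OF m this idl_mult[OF m r(1) yg]] f(2) show False by (simp add: r(2))
  qed
  have "Upsilon6 C D \<xi> \<in> induced_hom D C ` Upsilon5 C D ` normal_sections D"
    if \<xi>: "\<xi> \<in> normal_sections C" for \<xi>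
  proof -
    obtain x where x: "hom_family C C x" and \<xi>x: "\<xi> = section_of C C x"
      using \<xi> hom_sections_eq[of C C, OF Ci Ci] by blast
    have "\<exists>z. hom_family E E z \<and> (\<forall>p\<in>S. z p (g p) - x p (g p) \<in> local_max p) \<and>
        (\<forall>p\<in>S - S. \<forall>f\<in>E p. z p f \<in> local_max p)"
      using hom_familyD(1)[OF x closed_point_P3[OF Sc] gC]
      by (intro interpolate_sections[where y = y and t = "\<lambda>p. x p (g p)"] Ei Sc gE y(1,2) y_g S(1) order_refl)
    then obtain z where z: "hom_family E E z" and zg: "\<And>p. p \<in> S \<Longrightarrow> z p (g p) - x p (g p) \<in> local_max p"
      by blast
    have agree: "\<exists>c\<in>C q. \<exists>e\<in>E q. x q f - z q f = c + e" if q: "q \<in> P3" and f: "f \<in> D q" for q f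
    proof (cases "q \<in> supp E \<and> q \<in> supp C")
      case False
      have "x q f - z q f \<in> local_set q"
        using f hom_familyD(1)[OF x q] hom_familyD(1)[OF z q]
          idl_diff[OF subring_local_set[OF q] idl_local_set[OF q]] by (simp add: DCE[OF q])
      then show ?thesis by (rule all[OF q False])
    next
      case True
      then have qS: "q \<in> S" using meet by blast
      note R = subring_local_set[OF q] and m = idl_local_max[OF q]
      have Cm: "C q \<subseteq> local_max q" and Em: "E q \<subseteq> local_max q"
        using supp_local_max cs True by blast+
      have "x q f - z q f \<in> local_max q"
        using f unfolding D_def
      proof (induction rule: divisor_add_induct)
        \<comment> \<open>x is linear on C, so x(e c) is e x(c) up to C, and e lies in the maximal
          ideal; symmetrically z(c e) is c z(e) up to E.\<close>
        case (prod c e)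
        then have ce: "c \<in> local_set q" "e \<in> local_set q"
          using idl_subset[OF Ci[OF q]] idl_subset[OF Ei[OF q]] by auto
        have "x q (e * c) - e * x q c \<in> local_max q" "z q (c * e) - c * z q e \<in> local_max q"
          using hom_familyD(3)[OF x q ce(2) prod(1)] hom_familyD(3)[OF z q ce(1) prod(2)] Cm Em by blast+
        moreover have "e * x q c \<in> local_max q" "c * z q e \<in> local_max q"
          using hom_familyD(1)[OF x q prod(1)] hom_familyD(1)[OF z q prod(2)] prod Cm Em
          by (auto intro: idl_mult'[OF m])
        ultimately have "x q (e * c) \<in> local_max q" "z q (c * e) \<in> local_max q"
          using idl_cong[OF R m] by blast+
        then show ?case using idl_diff[OF R m] by (simp add: mult.commute)
      next
        case (add f g)
        then have fg: "f \<in> C q" "f \<in> E q" "g \<in> C q" "g \<in> E q"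
          using DCE[OF q] by (auto simp: D_def)
        from idl_add[OF m idl_diff[OF R m subsetD[OF Cm hom_familyD(2)[OF x q fg(1,3)]]
              subsetD[OF Em hom_familyD(2)[OF z q fg(2,4)]]] idl_add[OF m add.IH]]
        show ?case by (simp add: algebra_simps)
      next
        case (base w)
        then obtain r where r: "r \<in> local_set q" "w = r * g q" using g(2)[OF qS] by auto
        from idl_diff[OF R m idl_diff[OF R m subsetD[OF Cm hom_familyD(3)[OF x q r(1) gC[OF qS]]]
              subsetD[OF Em hom_familyD(3)[OF z q r(1) gE[OF qS]]]] idl_mult[OF m r(1) zg[OF qS]]]
        show ?case by (simp add: r(2) algebra_simps)
      qed (use idl_zero[OF Xi[OF q]] idl_zero[OF Ci[OF q]] idl_zero[OF Ei[OF q]] in auto)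
      then show ?thesis using sum[OF q] qS by (simp add: reduced_points_def)
    qed
    obtain h where h: "hom_family D D h" "\<And>q f. q \<in> P3 \<Longrightarrow> f \<in> D q \<Longrightarrow> h q f - x q f \<in> C q"
      using glue_hom_families[OF cs DCE x z agree] by metis
    have Di: "idl (local_set q) (D q)" if q: "q \<in> P3" for q
      using Ci[OF q] Ei[OF q] unfolding DCE[OF q] by (auto simp: idl_def)
    have "section_of D D h \<in> normal_sections D"
      using h(1) hom_sections_eq[of D D, OF Di Di] by blast
    moreover have "Upsilon6 C D \<xi> = induced_hom D C (Upsilon5 C D (section_of D D h))"
    proof
      fix q
      show "Upsilon6 C D \<xi> q = induced_hom D C (Upsilon5 C D (section_of D D h)) q"
      proof (cases "q \<in> P3")
        case q: True
        have DC: "D q \<subseteq> C q" using DCE[OF q] by blast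
        have hom: "is_hom (local_set q) (D q) (D q) (h q)"
          using h(1) q by (simp add: hom_family_def)
        show ?thesis
        proof
          fix f
          show "Upsilon6 C D \<xi> q f = induced_hom D C (Upsilon5 C D (section_of D D h)) q f"
          proof (cases "f \<in> D q")
            case f: True
            have "induced_hom D C (restrict_normal D C (section_of D D h)) q f
                = coset (local_set q) (C q) (h q f)"
              by (rule induced_restrict[where Y = D and Z = C and W = D,
                    OF q Di[OF q] Ci[OF q] DC order_refl f hom])
                (simp add: section_of_def q)
            also have "\<dots> = coset (local_set q) (C q) (x q f)"
              using h(2)[OF q f] by (simp add: coset_eq_iff[OF subring_local_set[OF q] Ci[OF q]])
            also have "\<dots> = Upsilon6 C D \<xi> q f"
              using q f DC by (auto simp: Upsilon6_def \<xi>x section_of_def hom_of_def)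
            finally show ?thesis by (simp add: Upsilon5_def)
          qed (simp add: Upsilon6_def induced_hom_def q)
        qed
      qed (simp add: Upsilon6_def induced_hom_def)
    qed
    ultimately show ?thesis by blast
  qed
  moreover have "scheme_eq D (divisor_add X C (divisor_multiple X 1 E))"
    unfolding scheme_eq_def
  proof
    fix q assume q: "q \<in> P3"
    show "D q = divisor_add X C (divisor_multiple X 1 E) q"
      using divisor_multiple_one[of q E X, OF q Ei[OF q] XE[OF q] idl_zero[OF Xi[OF q]]]
      by (simp add: D_def divisor_add_def)
  qed
  moreover have "finite (supp E \<inter> supp C)"
    using meet by (intro finite_subset[OF _ S(1)]) blast
  moreover have "reduced_scheme E" using E(2) by (simp add: integral_scheme_def)
  ultimately show ?thesis
    unfolding simple_extension_def D_def[symmetric]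
    \<comment> \<open>D - C is E with multiplicity n = 1.\<close>
    using E by (intro conjI exI[of _ 1] exI[of _ E]) auto
qed

theorem theorem1p3:
  fixes d :: nat and X E :: scheme
  assumes "smooth_surface d X"
    and "curve E" and "integral_scheme E" and "subscheme E X"
  shows "(\<forall>S. finite S \<and> S \<subseteq> {p \<in> supp E. closed_point p} \<and> first_order_free E X S \<longrightarrow>
            (\<forall>C. curve C \<and> subscheme C X \<and>
                 subscheme (scheme_inter C E) (reduced_points S) \<longrightarrow>
                 simple_extension X C (divisor_add X C E))) \<and>
         (\<forall>C. curve C \<and> subscheme C X \<and> \<not> simple_extension X C (divisor_add X C E) \<longrightarrow>
            (\<forall>S. finite S \<and> S \<subseteq> {p \<in> supp E. closed_point p} \<and>
                 subscheme (scheme_inter C E) (reduced_points S) \<longrightarrow>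
                 \<not> first_order_free E X S))"
  \<comment> \<open>The second half is the contrapositive of the first.\<close>
  using simple_extension_of_first_order_free[OF assms] by blast

end
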